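(* Let $G_L=\langle (12),(23),(34),(67),A\rangle\leq GL(7,\mathbb{C})$ and let $\Sigma=\langle (12),(23),(34),(67)\rangle\leq G_L$. Then: (i) $\Sigma$ consists of all the permutation matrices in $G_L$. (ii) There are exactly six double cosets $\Sigma\alpha\Sigma$ ($\alpha\in G_L$) in the double coset decomposition of $G_L$ with respect to $\Sigma$. Representative matrices for the double cosets are $$I_7,\quad A,\quad ((123)(67)A)^2,\quad ((123)(67)A)^3,\quad ((123)A)^3,\quad ((123)(67)A)^4,$$ and the corresponding double coset sizes are $1\cdot 48,\ 12\cdot 48,\ 12\cdot 48,\ 12\cdot 48,\ 2\cdot 48,\ 1\cdot 48$. (iii) The invariances $L(\vec{x})=L(\alpha\vec{x})$ of the $L$ function corresponding to these six representatives $\alpha$ (in the same order) are, for all $\vec{x}=(a,b,c,d,e,f,g)^T\in\mathbb{C}^7$ with $e+f+g-a-b-c-d=1$ for which both sides are defined, \begin{align*} L(a,b,c,d;e;f,g)&=L(a,b,c,d;e;f,g),\\ L(a,b,c,d;e;f,g)&=L(a,b,g-c,g-d;\,1+a+b-f;\,1+a+b-e,\,g),\\ L(a,b,c,d;e;f,g)&=L(1+a-e,\,g-c,\,a,\,f-c;\,1+a-c;\,1+a+b-e,\,1+a+d-e),\\ L(a,b,c,d;e;f,g)&=L(1+d-e,\,1+a-e,\,g-c,\,g-b;\,1+g-b-c;\,1+a+d-e,\,1+g-e),\\ L(a,b,c,d;e;f,g)&=L(g-a,\,g-b,\,g-c,\,g-d;\,1+g-f;\,1+g-e,\,g),\\ L(a,b,c,d;e;f,g)&=L(1+c-e,\,1+d-e,\,1+a-e,\,1+b-e;\,2-e;\,1+g-e,\,1+f-e).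 \end{align*}
   Context: A permutation $\sigma\in S_7$ is identified with the matrix in $GL(7,\mathbb{C})$ that permutes the standard basis by $e_i\mapsto e_{\sigma(i)}$ (so, e.g., $(123)$ sends $e_1\mapsto e_2\mapsto e_3\mapsto e_1$). $I_7$ is the identity matrix. The matrix $A$ is $$A=\begin{pmatrix}1&0&0&0&0&0&0\\0&1&0&0&0&0&0\\0&0&-1&0&0&0&1\\0&0&0&-1&0&0&1\\0&0&-1&-1&1&0&1\\0&0&-1&-1&0&1&1\\0&0&0&0&0&0&1\end{pmatrix}.$$ A double coset of $\Sigma$ in $G_L$ is a set $\Sigma\alpha\Sigma=\{\sigma\alpha\tau:\sigma,\tau\in\Sigma\}$ with $\alpha\in G_L$; distinct double cosets partition $G_L$. All elements of $G_L$ preserve the affine hyperplane $V=\{(a,b,c,d,e,f,g)^T\in\mathbb{C}^7: e+f+g-a-b-c-d=1\}$. For complex parameters with no $b_i$ a nonpositive integer, ${}_4F_3\left[{a_1,a_2,a_3,a_4;\atop b_1,b_2,b_3;}1\right]=\sum_{n=0}^{\infty}\frac{(a_1)_n(a_2)_n(a_3)_n(a_4)_n}{n!\,(b_1)_n(b_2)_n(b_3)_n}$, where $(x)_0=1$ and $(x)_n=x(x+1)\cdots(x+n-1)$ for $n>0$. For $\vec{x}=(a,b,c,d,e,f,g)^T\in V$, define $L(\vec{x})=L(a,b,c,d;e;f,g)$ by $$L(a,b,c,d;e;f,g)=\frac{{}_4F_3\left[{a,b,c,d;\atop e,f,g;}1\right]}{\sin (\pi e)\,\Gamma(e)\Gamma(f)\Gamma(g)\Gamma(1+a-e)\Gamma(1+b-e)\Gamma(1+c-e)\Gamma(1+d-e)}-\frac{{}_4F_3\left[{1+a-e,\,1+b-e,\,1+c-e,\,1+d-e;\atop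 1+f-e,\,1+g-e,\,2-e;}1\right]}{\sin (\pi e)\,\Gamma(a)\Gamma(b)\Gamma(c)\Gamma(d)\Gamma(1+f-e)\Gamma(1+g-e)\Gamma(2-e)},$$ where $1/\Gamma$ is regarded as an entire function. $L(a,b,c,d;e;f,g)$ is defined when $e\notin\mathbb{Z}$ and none of $f,\ g,\ 1+f-e,\ 1+g-e$ is a nonpositive integer. *)

theory Defs
  imports
    "HOL-Analysis.Analysis"
    "HOL-Algebra.Generated_Groups"
    "HOL-Combinatorics.Cycles"
begin

text \<open>
  Coordinates are indexed by the seven-element type \<^typ>\<open>7\<close>, whose elements are
  \<open>1, \<dots>, 6\<close> and \<open>7\<close>; since arithmetic there is modulo 7, the index \<open>7\<close> is the same
  element as \<open>0\<close>. The library's \<^const>\<open>vector\<close> fills the positions \<open>1, 2, \<dots>, 7\<close> in this order.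
\<close>

lemma vector_7:
  "(vector [a, b, c, d, e, f, g] :: 'a::zero ^ 7) $ i =
    (if i = 1 then a else if i = 2 then b else if i = 3 then c else if i = 4 then d
     else if i = 5 then e else if i = 6 then f else if i = 7 then g else 0)"
  by (simp add: vector_def)

lemma vector_7_nth [simp]:
  "(vector [a, b, c, d, e, f, g] :: 'a::zero ^ 7) $ 1 = a"
  "(vector [a, b, c, d, e, f, g] :: 'a::zero ^ 7) $ 2 = b"
  "(vector [a, b, c, d, e, f, g] :: 'a::zero ^ 7) $ 3 = c"
  "(vector [a, b, c, d, e, f, g] :: 'a::zero ^ 7) $ 4 = d"
  "(vector [a, b, c, d, e, f, g] :: 'a::zero ^ 7) $ 5 = e"
  "(vector [a, b, c, d, e, f, g] :: 'a::zero ^ 7) $ 6 = f"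
  "(vector [a, b, c, d, e, f, g] :: 'a::zero ^ 7) $ 7 = g"
  by (simp_all add: vector_7)

definition GL7 :: "(complex ^ 7 ^ 7) monoid" where
  "GL7 = \<lparr>carrier = {M. invertible M}, mult = (**), one = mat 1\<rparr>"

lemma group_GL7: "group GL7"
proof (rule groupI)
  fix M assume "M \<in> carrier GL7"
  then obtain N where "M ** N = mat 1" "N ** M = mat 1"
    by (auto simp: GL7_def invertible_def)
  then show "\<exists>N\<in>carrier GL7. N \<otimes>\<^bsub>GL7\<^esub> M = \<one>\<^bsub>GL7\<^esub>"
    by (auto simp: GL7_def invertible_def)
qed (auto simp: GL7_def invertible_mult matrix_mul_assoc, auto simp: invertible_def)

text \<open>Column \<open>j\<close> of the matrix is the basis vector with index \<open>\<sigma> j\<close>, i.e. \<open>e\<^sub>j \<mapsto> e\<^bsub>\<sigma> j\<^esub>\<close>.\<close>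

definition perm_mat :: "(7 \<Rightarrow> 7) \<Rightarrow> complex ^ 7 ^ 7" where
  "perm_mat \<sigma> = (\<chi> i j. if i = \<sigma> j then 1 else 0)"

text \<open>\<^term>\<open>cycle_of_list [i, j, k]\<close> is the cycle \<open>i \<mapsto> j \<mapsto> k \<mapsto> i\<close>.\<close>

abbreviation cyc_mat :: "7 list \<Rightarrow> complex ^ 7 ^ 7" where
  "cyc_mat is \<equiv> perm_mat (cycle_of_list is)"

definition A_mat :: "complex ^ 7 ^ 7" where
  "A_mat = vector
    [vector [1, 0,  0,  0, 0, 0, 0],
     vector [0, 1,  0,  0, 0, 0, 0],
     vector [0, 0, -1,  0, 0, 0, 1],
     vector [0, 0,  0, -1, 0, 0, 1],
     vector [0, 0, -1, -1, 1, 0, 1],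
     vector [0, 0, -1, -1, 0, 1, 1],
     vector [0, 0,  0,  0, 0, 0, 1]]"

definition Sigma_gens :: "(complex ^ 7 ^ 7) set" where
  "Sigma_gens = {cyc_mat [1, 2], cyc_mat [2, 3], cyc_mat [3, 4], cyc_mat [6, 7]}"

definition Sigma_grp :: "(complex ^ 7 ^ 7) set" where
  "Sigma_grp = generate GL7 Sigma_gens"

definition G_L :: "(complex ^ 7 ^ 7) set" where
  "G_L = generate GL7 (insert A_mat Sigma_gens)"

definition double_coset :: "('a, 'b) monoid_scheme \<Rightarrow> 'a set \<Rightarrow> 'a \<Rightarrow> 'a set" where
  "double_coset G H \<alpha> = {\<sigma> \<otimes>\<^bsub>G\<^esub> \<alpha> \<otimes>\<^bsub>G\<^esub> \<tau> | \<sigma> \<tau>. \<sigma> \<in> H \<and> \<tau> \<in> H}"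

definition coset_reps :: "(complex ^ 7 ^ 7) list" where
  "coset_reps =
    [mat 1,
     A_mat,
     (cyc_mat [1, 2, 3] ** cyc_mat [6, 7] ** A_mat) [^]\<^bsub>GL7\<^esub> (2::nat),
     (cyc_mat [1, 2, 3] ** cyc_mat [6, 7] ** A_mat) [^]\<^bsub>GL7\<^esub> (3::nat),
     (cyc_mat [1, 2, 3] ** A_mat) [^]\<^bsub>GL7\<^esub> (3::nat),
     (cyc_mat [1, 2, 3] ** cyc_mat [6, 7] ** A_mat) [^]\<^bsub>GL7\<^esub> (4::nat)]"

text \<open>
  The generators really are invertible, so that \<^const>\<open>generate\<close> yields subgroups of
  \<^const>\<open>GL7\<close>: \<^const>\<open>A_mat\<close> is an involution.
\<close>

lemma UNIV_7: "(UNIV :: 7 set) = {1, 2, 3, 4, 5, 6, 7}"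
proof -
  have "card {1, 2, 3, 4, 5, 6, 7 :: 7} = CARD(7)"
    by simp
  then show ?thesis
    by (metis card_subset_eq finite subset_UNIV)
qed

lemma sum_7:
  "sum h (UNIV :: 7 set) = h 1 + h 2 + h 3 + h 4 + h 5 + h 6 + h 7"
  unfolding UNIV_7 by (simp add: add.assoc)

lemma A_mat_involution: "A_mat ** A_mat = mat 1"
proof -
  have all7: "(\<forall>i::7. P i) \<longleftrightarrow> P 1 \<and> P 2 \<and> P 3 \<and> P 4 \<and> P 5 \<and> P 6 \<and> P 7" for P
    using UNIV_7 by (metis UNIV_I empty_iff insert_iff)
  show ?thesis
    unfolding vec_eq_iff all7 matrix_matrix_mult_def mat_def
    by (simp add: sum_7 A_mat_def)
qed

lemma perm_mat_invertible:
  assumes "bij \<sigma>" shows "invertible (perm_mat \<sigma>)"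
proof -
  have "perm_mat \<sigma> ** perm_mat \<tau> = perm_mat (\<sigma> \<circ> \<tau>)" for \<sigma> \<tau>
    by (simp add: perm_mat_def matrix_matrix_mult_def vec_eq_iff if_distrib [of "(*) _"]
        mult_delta_right cong: if_cong)
  moreover have "perm_mat id = mat 1"
    by (simp add: perm_mat_def mat_def vec_eq_iff)
  ultimately show ?thesis
    using assms unfolding invertible_def
    by (metis bij_is_inj bij_is_surj inv_o_cancel surj_iff)
qed

lemma generators_subset_GL7: "insert A_mat Sigma_gens \<subseteq> carrier GL7"
  using A_mat_involution
  by (auto simp: Sigma_gens_def GL7_def invertible_def [of A_mat]
      intro!: perm_mat_invertible permutation_bijective permutation_of_cycle simp del: cycle_of_list.simps)

definition F43 ::
    "complex \<Rightarrow> complex \<Rightarrow> complex \<Rightarrow> complex \<Rightarrow> complex \<Rightarrow> complex \<Rightarrow> complex \<Rightarrow> complex" where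
  "F43 a1 a2 a3 a4 b1 b2 b3 =
    (\<Sum>n. pochhammer a1 n * pochhammer a2 n * pochhammer a3 n * pochhammer a4 n /
          (fact n * pochhammer b1 n * pochhammer b2 n * pochhammer b3 n))"

text \<open>
  \<^const>\<open>rGamma\<close> is the entire function \<open>1 / \<Gamma>\<close>. On the hyperplane \<open>e + f + g - a - b - c - d = 1\<close>
  both series in the next definition are balanced (their terms are \<open>O(n\<^sup>-\<^sup>2)\<close>), hence they
  converge as soon as no denominator parameter is a nonpositive integer.
\<close>

definition L :: "complex ^ 7 \<Rightarrow> complex" where
  "L x =
    (let a = x $ 1; b = x $ 2; c = x $ 3; d = x $ 4; e = x $ 5; f = x $ 6; g = x $ 7 in
      F43 a b c d e f g / sin (of_real pi * e)
        * (rGamma e * rGamma f * rGamma g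
           * rGamma (1 + a - e) * rGamma (1 + b - e) * rGamma (1 + c - e) * rGamma (1 + d - e))
      - F43 (1 + a - e) (1 + b - e) (1 + c - e) (1 + d - e) (1 + f - e) (1 + g - e) (2 - e)
          / sin (of_real pi * e)
        * (rGamma a * rGamma b * rGamma c * rGamma d
           * rGamma (1 + f - e) * rGamma (1 + g - e) * rGamma (2 - e)))"

definition L_defined :: "complex ^ 7 \<Rightarrow> bool" where
  "L_defined x \<longleftrightarrow>
    (let e = x $ 5; f = x $ 6; g = x $ 7 in
      e \<notin> \<int> \<and> f \<notin> \<int>\<^sub>\<le>\<^sub>0 \<and> g \<notin> \<int>\<^sub>\<le>\<^sub>0 \<and> 1 + f - e \<notin> \<int>\<^sub>\<le>\<^sub>0 \<and> 1 + g - e \<notin> \<int>\<^sub>\<le>\<^sub>0)"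

end

theory Submission
  imports
    Defs
    "HOL-Complex_Analysis.Conformal_Mappings"
    "HOL-Real_Asymp.Real_Asymp"
begin

text \<open>
  Group part. The fifth row of a matrix in \<open>G_L\<close> lies in an explicit set of 40 rows, which splits
  into six \<open>\<Sigma>\<close>-orbits. The group also permutes the sixteen affine forms \<open>x\<close>, \<open>1 + x - e\<close>, \<open>f - x\<close>,
  \<open>g - x\<close> with \<open>x\<close> among \<open>a, b, c, d\<close>; this forces an element whose fifth row is \<open>(0,0,0,0,1,0,0)\<close> to be
  a permutation matrix in \<open>\<Sigma>\<close>. Hence two elements have the same fifth row iff they lie in the same
  right coset of \<open>\<Sigma>\<close>, and the double cosets correspond to the six orbits.

  Analytic part. Put \<open>C = 1 + a + b - e\<close>. In a suitable range of real parameters, \<open>L\<close> is a multiple of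
  \<open>\<integral>\<^sub>0\<^sup>1 t\<^bsup>c-1\<^esup> (1-t)\<^bsup>C-1\<^esup> \<^sub>2F\<^sub>1(f-d, g-d; C; 1-t) \<^sub>2F\<^sub>1(a, b; C; 1-t) dt\<close>: expand the second factor by the
  connection formula at \<open>t = 0\<close>, integrate termwise and use Gauss's summation. Interchanging the two
  \<open>\<^sub>2F\<^sub>1\<close>'s gives the invariance under the third representative, first for real parameters and then, by
  analytic continuation, for all complex ones. This element and \<open>\<Sigma>\<close> generate \<open>G_L\<close>.
\<close>

section \<open>The Gauss hypergeometric series\<close>

text \<open>The fifth row of a matrix is the linear form that produces the new \<open>e\<close>, and
  \<open>\<Sigma>\<close> is exactly the part of the group that leaves \<open>e\<close> alone. Left
  multiplication by \<open>\<Sigma>\<close> does not change this row and right multiplication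
  permutes its entries; this is why double cosets become orbits of rows. Modulo the equation of the
  hyperplane the rows minus 1 are the 40 roots of a system of type D5, the sixteen forms correspond
  to the weights of a half-spin representation, and 40 * 48 = 1920 is the order of the Weyl group.

  On the analytic side, dividing by Gamma functions removes every singularity except integral
  \<open>e\<close>. The positive parameter range makes all integrands nonnegative, so monotone
  convergence is available throughout, and the connection formula is arranged without minus signs
  for the same reason. Invariances cannot simply be composed, because the intermediate point may
  have an integral fifth coordinate; each composition is continued anew. Along a curve only
  countably many points are lost, so a connected domain remains.\<close>

lemma sums_if_suminf_ennreal:
  fixes f :: "nat \<Rightarrow> real"
  assumes "\<And>n. f n \<ge> 0" "x \<ge> 0" "(\<Sum>n. ennreal (f n)) = ennreal x"
  shows "f sums x"
proof -
  have s: "summable f"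
    using assms by (intro summable_suminf_not_top) auto
  then have "ennreal (suminf f) = ennreal x"
    using assms suminf_ennreal2 by metis
  then have "suminf f = x"
    using assms s suminf_nonneg by (subst (asm) ennreal_inj) auto
  with s show ?thesis by auto
qed

text \<open>Monotone convergence: since all terms are nonnegative, sum and integral may be exchanged
  in \<open>ennreal\<close> before anything is known to be integrable. In the uses
  \<open>g t\<close> is \<open>t\<close> or \<open>1 - t\<close>.\<close>

lemma nn_integral_powser:
  fixes k :: "nat \<Rightarrow> real" and w g :: "real \<Rightarrow> real"
  assumes k: "\<And>n. k n \<ge> 0" and w: "w \<in> borel_measurable borel" "\<And>t. 0 < t \<Longrightarrow> t < 1 \<Longrightarrow> 0 \<le> w t"
    and g: "g \<in> borel_measurable borel" "\<And>t. 0 < t \<Longrightarrow> t < 1 \<Longrightarrow> 0 \<le> g t"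
    and sm: "\<And>t. 0 < t \<Longrightarrow> t < 1 \<Longrightarrow> summable (\<lambda>n. k n * g t ^ n)"
  shows "(\<integral>\<^sup>+t. ennreal (indicator {0<..<1} t * (w t * (\<Sum>n. k n * g t ^ n))) \<partial>lborel)
    = (\<Sum>n. ennreal (k n) * (\<integral>\<^sup>+t. ennreal (indicator {0<..<1} t * (w t * g t ^ n)) \<partial>lborel))"
proof -
  have "ennreal (indicator {0<..<1} t * (w t * (\<Sum>n. k n * g t ^ n)))
      = (\<Sum>n. ennreal (k n) * ennreal (indicator {0<..<1} t * (w t * g t ^ n)))" for t :: real
  proof (cases "0 < t \<and> t < 1")
    case True
    have "(\<Sum>n. ennreal (k n) * ennreal (indicator {0<..<1} t * (w t * g t ^ n)))
        = (\<Sum>n. ennreal (w t * (k n * g t ^ n)))"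
      using True k w g by (simp add: ennreal_mult' [symmetric] mult_ac)
    also have "\<dots> = ennreal (\<Sum>n. w t * (k n * g t ^ n))"
      using True k w g sm by (intro suminf_ennreal2 summable_mult) auto
    also have "(\<Sum>n. w t * (k n * g t ^ n)) = w t * (\<Sum>n. k n * g t ^ n)"
      using True sm by (intro suminf_mult) auto
    finally show ?thesis using True by simp
  qed auto
  then show ?thesis
    using w(1) g(1) by (simp add: nn_integral_suminf nn_integral_cmult)
qed

lemma nn_integral_Beta:
  assumes "a > 0" "b > (0::real)"
  shows "(\<integral>\<^sup>+t. ennreal (indicator {0<..<1} t * (t powr (a - 1) * (1 - t) powr (b - 1))) \<partial>lborel)
    = ennreal (Beta a b)"
  using nn_integral_has_integral_lebesgue[of "{0<..<1}" "\<lambda>t. t powr (a - 1) * (1 - t) powr (b - 1)" "Beta a b"]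
    has_integral_Beta_real[OF assms]
  by (simp add: has_integral_Icc_iff_Ioo)

lemma Beta_shift:
  fixes x y :: real
  assumes "x > 0" "y > 0"
  shows "Beta (x + of_nat n) y = Beta x y * pochhammer x n / pochhammer (x + y) n"
proof -
  have *: "z \<notin> \<int>\<^sub>\<le>\<^sub>0" if "z > 0" for z :: real using that by (auto elim!: nonpos_Ints_cases)
  have "pochhammer x n = Gamma (x + of_nat n) / Gamma x"
    "pochhammer (x + y) n = Gamma (x + y + of_nat n) / Gamma (x + y)"
    using assms * by (simp_all add: pochhammer_Gamma)
  moreover have "Gamma x > 0" "Gamma (x + y) > 0" "Gamma (x + y + of_nat n) > 0"
    using assms by (auto intro!: Gamma_real_pos add_pos_nonneg)
  ultimately show ?thesis by (simp add: Beta_def add_ac)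
qed

lemma powr_neg_binomial:
  fixes a t :: real
  assumes "\<bar>t\<bar> < 1"
  shows "(\<lambda>n. pochhammer a n / fact n * t ^ n) sums (1 - t) powr (-a)"
proof -
  have "(\<lambda>n. ((-a) gchoose n) * (-t) ^ n) sums (1 + (-t)) powr (-a)"
    using assms by (intro gen_binomial_real) auto
  moreover have "((-a) gchoose n) * (-t) ^ n = pochhammer a n / fact n * t ^ n" for n
  proof -
    have "(-1) ^ n * (-t) ^ n = t ^ n" by (simp flip: power_mult_distrib)
    then show ?thesis unfolding gbinomial_pochhammer by (simp add: field_simps)
  qed
  ultimately show ?thesis by simp
qed

text \<open>Euler's integral at argument 1. The factors
  \<open>pochhammer b n / pochhammer c n\<close> are normalised Beta integrals of
  \<open>t ^ n\<close>; summing the binomial series under the integral leaves another Beta integral,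
  which converges because \<open>c > a + b\<close>.\<close>

theorem Gauss_summation:
  fixes a b c :: real
  assumes "a > 0" "b > 0" "c > a + b"
  shows "(\<lambda>n. pochhammer a n * pochhammer b n / (pochhammer c n * fact n)) sums
    (Gamma c * Gamma (c - a - b) / (Gamma (c - a) * Gamma (c - b)))"
proof -
  define B where "B = Beta b (c - b)"
  have G: "Gamma b > 0" "Gamma (c - b) > 0" "Gamma c > 0" "Gamma (c - a) > 0" "Gamma (c - a - b) > 0"
    using assms by (auto intro!: Gamma_real_pos)
  have B: "B > 0" unfolding B_def Beta_def using G by simp
  have "(\<integral>\<^sup>+t. ennreal (indicator {0<..<1} t * ((t powr (b - 1) * (1 - t) powr (c - b - 1)) * (\<Sum>n. pochhammer a n / fact n * t ^ n))) \<partial>lborel)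
    = (\<Sum>n. ennreal (pochhammer a n / fact n) * (\<integral>\<^sup>+t. ennreal (indicator {0<..<1} t * ((t powr (b - 1) * (1 - t) powr (c - b - 1)) * t ^ n)) \<partial>lborel))"
    using assms powr_neg_binomial[of _ a, THEN sums_summable]
    by (intro nn_integral_powser) (auto intro!: pochhammer_nonneg divide_nonneg_pos)
  also have "(\<integral>\<^sup>+t. ennreal (indicator {0<..<1} t * ((t powr (b - 1) * (1 - t) powr (c - b - 1)) * (\<Sum>n. pochhammer a n / fact n * t ^ n))) \<partial>lborel)
     = (\<integral>\<^sup>+t. ennreal (indicator {0<..<1} t * (t powr (b - 1) * (1 - t) powr (c - a - b - 1))) \<partial>lborel)"
  proof (intro nn_integral_cong arg_cong[where f = ennreal])
    fix t :: real
    show "indicator {0<..<1} t * ((t powr (b - 1) * (1 - t) powr (c - b - 1)) * (\<Sum>n. pochhammer a n / fact n * t ^ n))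
      = indicator {0<..<1} t * (t powr (b - 1) * (1 - t) powr (c - a - b - 1))"
      using powr_neg_binomial[of t a, THEN sums_unique, symmetric]
      by (auto simp: indicator_def mult.assoc simp flip: powr_add) (simp add: algebra_simps)
  qed
  also have "\<dots> = ennreal (Beta b (c - a - b))"
    using assms by (intro nn_integral_Beta) auto
  also have "(\<lambda>n. \<integral>\<^sup>+t. ennreal (indicator {0<..<1} t * ((t powr (b - 1) * (1 - t) powr (c - b - 1)) * t ^ n)) \<partial>lborel)
      = (\<lambda>n. ennreal (B * pochhammer b n / pochhammer c n))"
  proof
    fix n
    have "(\<integral>\<^sup>+t. ennreal (indicator {0<..<1} t * ((t powr (b - 1) * (1 - t) powr (c - b - 1)) * t ^ n)) \<partial>lborel)
        = (\<integral>\<^sup>+t. ennreal (indicator {0<..<1} t * (t powr (b + real n - 1) * (1 - t) powr (c - b - 1))) \<partial>lborel)"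
      by (intro nn_integral_cong arg_cong[where f = ennreal])
         (auto simp: indicator_def powr_realpow[symmetric] powr_add[symmetric] algebra_simps)
    also have "\<dots> = ennreal (Beta (b + real n) (c - b))"
      using assms by (intro nn_integral_Beta) auto
    finally show "(\<integral>\<^sup>+t. ennreal (indicator {0<..<1} t * ((t powr (b - 1) * (1 - t) powr (c - b - 1)) * t ^ n)) \<partial>lborel)
      = ennreal (B * pochhammer b n / pochhammer c n)" using assms by (simp add: Beta_shift B_def)
  qed
  finally have "(\<Sum>n. ennreal (pochhammer a n / fact n * (B * pochhammer b n / pochhammer c n))) = ennreal (Beta b (c - a - b))"
    using assms by (subst ennreal_mult') (auto intro!: divide_nonneg_pos pochhammer_nonneg)
  then have "(\<lambda>n. pochhammer a n / fact n * (B * pochhammer b n / pochhammer c n)) sums Beta b (c - a - b)"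
    using assms G B by (intro sums_if_suminf_ennreal) (auto intro!: mult_nonneg_nonneg divide_nonneg_nonneg pochhammer_nonneg simp: Beta_def less_imp_le)
  then have "(\<lambda>n. inverse B * (pochhammer a n / fact n * (B * pochhammer b n / pochhammer c n))) sums (inverse B * Beta b (c - a - b))"
    by (rule sums_mult)
  moreover have "inverse B * (pochhammer a n / fact n * (B * pochhammer b n / pochhammer c n)) = pochhammer a n * pochhammer b n / (pochhammer c n * fact n)" for n
    using B by (simp add: field_simps)
  moreover have "inverse B * Beta b (c - a - b) = Gamma c * Gamma (c - a - b) / (Gamma (c - a) * Gamma (c - b))"
    using G by (simp add: B_def Beta_def field_simps)
  ultimately show ?thesis by simp
qed

section \<open>The series 2F1, its differential equation and its moments\<close>

definition hyp_coeff :: "real \<Rightarrow> real \<Rightarrow> real \<Rightarrow> nat \<Rightarrow> real" where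
  "hyp_coeff a b c n = pochhammer a n * pochhammer b n / (pochhammer c n * fact n)"

definition F21 :: "real \<Rightarrow> real \<Rightarrow> real \<Rightarrow> real \<Rightarrow> real" where
  "F21 a b c z = (\<Sum>n. hyp_coeff a b c n * z ^ n)"

lemma hyp_coeff_0 [simp]: "hyp_coeff a b c 0 = 1"
  by (simp add: hyp_coeff_def)

lemma hyp_coeff_pos: "a > 0 \<Longrightarrow> b > 0 \<Longrightarrow> c > 0 \<Longrightarrow> hyp_coeff a b c n > 0"
  by (auto simp: hyp_coeff_def intro!: divide_pos_pos mult_pos_pos pochhammer_pos)

lemma hyp_coeff_Suc:
  assumes "c > 0"
  shows "real (Suc n) * hyp_coeff a b c (Suc n) = (a + n) * (b + n) / (c + n) * hyp_coeff a b c n"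
proof -
  have "pochhammer c n > 0" "c + n > 0" using assms by (auto intro!: pochhammer_pos)
  then show ?thesis
    by (simp add: hyp_coeff_def pochhammer_Suc mult_ac del: of_nat_Suc)
qed

lemma hyp_coeff_shift:
  assumes "c > 0"
  shows "real (Suc n) * hyp_coeff a b c (Suc n) = a * b / c * hyp_coeff (a + 1) (b + 1) (c + 1) n"
proof -
  have "pochhammer (c + 1) n > 0" using assms by (auto intro!: pochhammer_pos)
  then show ?thesis
    using assms by (simp add: hyp_coeff_def pochhammer_rec del: of_nat_Suc)
qed

lemma conv_radius_hyp_coeff:
  assumes "a > 0" "b > 0" "c > 0"
  shows "conv_radius (hyp_coeff a b c) = 1"
proof (rule conv_radius_ratio_limit_nonzero[where c = 1])
  have "norm (hyp_coeff a b c n) / norm (hyp_coeff a b c (Suc n)) = real (Suc n) * (c + n) / ((a + n) * (b + n))" for n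
  proof -
    have p: "hyp_coeff a b c n > 0" "hyp_coeff a b c (Suc n) > 0" using assms hyp_coeff_pos by auto
    have "real (Suc n) * (c + n) * hyp_coeff a b c (Suc n) = (a + n) * (b + n) * hyp_coeff a b c n"
      using hyp_coeff_Suc[OF assms(3), of n a b] assms by (simp add: field_simps del: of_nat_Suc)
    moreover have "a + n > 0" "b + n > 0" using assms by auto
    ultimately have "hyp_coeff a b c n / hyp_coeff a b c (Suc n) = real (Suc n) * (c + n) / ((a + n) * (b + n))"
      using p by (subst frac_eq_eq) (auto simp: mult_ac simp del: of_nat_Suc)
    then show ?thesis using p by simp
  qed
  moreover have "(\<lambda>n. real (Suc n) * (c + n) / ((a + n) * (b + n))) \<longlonglongrightarrow> 1" by real_asymp
  ultimately show "(\<lambda>n. norm (hyp_coeff a b c n) / norm (hyp_coeff a b c (Suc n))) \<longlonglongrightarrow> 1" by simp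
qed (auto simp: one_ereal_def)

lemma summable_F21:
  assumes "a > 0" "b > 0" "c > 0" "\<bar>z\<bar> < 1"
  shows "summable (\<lambda>n. hyp_coeff a b c n * z ^ n)"
  using assms by (intro summable_in_conv_radius) (auto simp: conv_radius_hyp_coeff one_ereal_def)

lemma F21_sums:
  assumes "a > 0" "b > 0" "c > 0" "\<bar>z\<bar> < 1"
  shows "(\<lambda>n. hyp_coeff a b c n * z ^ n) sums F21 a b c z"
  unfolding F21_def using summable_F21[OF assms] by auto

lemma F21_0 [simp]: "F21 a b c 0 = 1"
  unfolding F21_def using powser_zero[of "hyp_coeff a b c"] by simp

lemma F21_nonneg: "a > 0 \<Longrightarrow> b > 0 \<Longrightarrow> c > 0 \<Longrightarrow> 0 \<le> z \<Longrightarrow> z < 1 \<Longrightarrow> F21 a b c z \<ge> 0"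
  unfolding F21_def using summable_F21[of a b c z] hyp_coeff_pos[of a b c]
  by (intro suminf_nonneg) (auto intro!: mult_nonneg_nonneg simp: less_imp_le)

lemma F21_deriv:
  assumes "a > 0" "b > 0" "c > 0" "\<bar>z\<bar> < 1"
  shows "(F21 a b c has_field_derivative a * b / c * F21 (a + 1) (b + 1) (c + 1) z) (at z)"
proof -
  have "((\<lambda>z. \<Sum>n. hyp_coeff a b c n * z ^ n) has_field_derivative (\<Sum>n. diffs (hyp_coeff a b c) n * z ^ n)) (at z)"
    using assms by (intro termdiffs_strong'[where K = 1] summable_F21) auto
  also have "(\<lambda>n. diffs (hyp_coeff a b c) n * z ^ n) = (\<lambda>n. a * b / c * (hyp_coeff (a + 1) (b + 1) (c + 1) n * z ^ n))"
    using hyp_coeff_shift[OF assms(3), of _ a b] by (auto simp: diffs_def fun_eq_iff simp del: of_nat_Suc)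
  also have "(\<Sum>n. a * b / c * (hyp_coeff (a + 1) (b + 1) (c + 1) n * z ^ n)) = a * b / c * F21 (a + 1) (b + 1) (c + 1) z"
    unfolding F21_def using assms by (intro suminf_mult summable_F21) auto
  finally show ?thesis by (simp add: F21_def[abs_def])
qed

lemma F21_isCont: "a > 0 \<Longrightarrow> b > 0 \<Longrightarrow> c > 0 \<Longrightarrow> \<bar>z\<bar> < 1 \<Longrightarrow> isCont (F21 a b c) z"
  using F21_deriv DERIV_isCont by blast

text \<open>Comparison of coefficients. \<open>h1\<close> and \<open>h2\<close> are the coefficients
  of the first and second derivative, whose sums \<open>F1\<close> and \<open>F2\<close> are
  multiples of 2F1's with raised parameters. After shifting, all that is left is
  \<open>(c + n) * h1 n = (a + n) * (b + n) * h n\<close>.\<close>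

lemma F21_ODE:
  assumes "a > 0" "b > 0" "c > 0" "\<bar>z\<bar> < 1"
  defines "F1 \<equiv> a * b / c * F21 (a + 1) (b + 1) (c + 1) z"
    and "F2 \<equiv> a * b / c * ((a + 1) * (b + 1) / (c + 1) * F21 (a + 2) (b + 2) (c + 2) z)"
  shows "z * (1 - z) * F2 + (c - (a + b + 1) * z) * F1 - a * b * F21 a b c z = 0"
proof -
  define h where "h = hyp_coeff a b c"
  define h1 where "h1 n = real (Suc n) * h (Suc n)" for n
  define h2 where "h2 n = real (Suc n) * h1 (Suc n)" for n
  have h1: "h1 n = a * b / c * hyp_coeff (a + 1) (b + 1) (c + 1) n" for n
    unfolding h1_def h_def by (rule hyp_coeff_shift[OF assms(3)])
  have h2: "h2 n = a * b / c * ((a + 1) * (b + 1) / (c + 1) * hyp_coeff (a + 2) (b + 2) (c + 2) n)" for n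
    using hyp_coeff_shift[of "c + 1" n "a + 1" "b + 1"] assms(3)
    by (simp add: h2_def h1 mult.left_commute add.assoc del: of_nat_Suc)
  have S0: "(\<lambda>n. h n * z ^ n) sums F21 a b c z" unfolding h_def using assms by (intro F21_sums)
  have S1: "(\<lambda>n. h1 n * z ^ n) sums F1" unfolding h1 F1_def mult.assoc using assms by (intro sums_mult F21_sums) auto
  have S2: "(\<lambda>n. h2 n * z ^ n) sums F2" unfolding h2 F2_def mult.assoc using assms by (intro sums_mult F21_sums) auto
  \<comment> \<open>Multiplication by \<open>z\<close> shifts the coefficients by one, with 0
    entering at the front.\<close>
  have T: "(\<lambda>n. (case n of 0 \<Rightarrow> 0 | Suc m \<Rightarrow> g m) * z ^ n) sums (z * G)" if "(\<lambda>n. g n * z ^ n) sums G" for g G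
  proof -
    have "(\<lambda>n. z * (g n * z ^ n)) sums (z * G)" using that by (rule sums_mult)
    then have "(\<lambda>n. (case Suc n of 0 \<Rightarrow> 0 | Suc m \<Rightarrow> g m) * z ^ Suc n) sums (z * G)" by (simp add: mult_ac)
    then show ?thesis by (subst (asm) sums_Suc_iff) simp
  qed
  have "(\<lambda>n. (case n of 0 \<Rightarrow> 0 | Suc m \<Rightarrow> h2 m) * z ^ n
       - (case n of 0 \<Rightarrow> 0 | Suc m \<Rightarrow> (case m of 0 \<Rightarrow> 0 | Suc k \<Rightarrow> h2 k)) * z ^ n
       + c * (h1 n * z ^ n) - (a + b + 1) * ((case n of 0 \<Rightarrow> 0 | Suc m \<Rightarrow> h1 m) * z ^ n) - a * b * (h n * z ^ n))
     sums (z * F2 - z * (z * F2) + c * F1 - (a + b + 1) * (z * F1) - a * b * F21 a b c z)"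
    by (intro sums_add sums_diff sums_mult T S0 S1 S2)
  moreover have "(case n of 0 \<Rightarrow> 0 | Suc m \<Rightarrow> h2 m) * z ^ n
       - (case n of 0 \<Rightarrow> 0 | Suc m \<Rightarrow> (case m of 0 \<Rightarrow> 0 | Suc k \<Rightarrow> h2 k)) * z ^ n
       + c * (h1 n * z ^ n) - (a + b + 1) * ((case n of 0 \<Rightarrow> 0 | Suc m \<Rightarrow> h1 m) * z ^ n) - a * b * (h n * z ^ n) = 0" for n
  proof -
    have r: "(c + real n) * h1 n = (a + n) * (b + n) * h n" for n
      using hyp_coeff_Suc[OF assms(3), of n a b] assms(3) unfolding h1_def h_def by (simp add: field_simps del: of_nat_Suc)
    have e1: "(case n of 0 \<Rightarrow> 0 | Suc m \<Rightarrow> h2 m) = n * h1 n" by (cases n) (auto simp: h2_def)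
    have e2: "(case n of 0 \<Rightarrow> 0 | Suc m \<Rightarrow> h1 m) = n * h n" by (cases n) (auto simp: h1_def)
    have e3: "(case n of 0 \<Rightarrow> 0 | Suc m \<Rightarrow> (case m of 0 \<Rightarrow> 0 | Suc k \<Rightarrow> h2 k)) = n * (real n - 1) * h n"
      by (cases n; cases "n - 1") (auto simp: h2_def h1_def)
    have "n * h1 n - n * (real n - 1) * h n + c * h1 n - (a + b + 1) * (n * h n) - a * b * h n = 0"
      using r[of n] by (simp add: algebra_simps)
    then have "(n * h1 n - n * (real n - 1) * h n + c * h1 n - (a + b + 1) * (n * h n) - a * b * h n) * z ^ n = 0" by simp
    then show ?thesis unfolding e1 e2 e3 by (simp add: algebra_simps)
  qed
  ultimately have "z * F2 - z * (z * F2) + c * F1 - (a + b + 1) * (z * F1) - a * b * F21 a b c z = 0"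
    by (simp add: sums_iff)
  then show ?thesis by (simp add: algebra_simps)
qed

text \<open>Expanding in powers of \<open>1 - t\<close>, each term is a Beta integral whose
  \<open>pochhammer c n\<close> cancels the one in the denominator of \<open>hyp_coeff\<close>. This
  leaves a 2F1 at 1 with lower parameter \<open>c + s\<close>, to which Gauss's theorem applies;
  \<open>c + s - p - q > 0\<close> is its convergence condition.\<close>

lemma nn_integral_F21_moment:
  assumes "p > 0" "q > 0" "c > 0" "s > 0" "c + s - p - q > 0"
  shows "(\<integral>\<^sup>+t. ennreal (indicator {0<..<1} t * (t powr (s - 1) * (1 - t) powr (c - 1) * F21 p q c (1 - t))) \<partial>lborel)
    = ennreal (Gamma c * Gamma s * Gamma (c + s - p - q) / (Gamma (c + s - p) * Gamma (c + s - q)))"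
proof -
  define B where "B = Beta c s"
  have G: "Gamma c > 0" "Gamma s > 0" "Gamma (c + s) > 0" "Gamma (c + s - p - q) > 0"
     "Gamma (c + s - p) > 0" "Gamma (c + s - q) > 0"
    using assms by (auto intro!: Gamma_real_pos)
  have B: "B > 0" unfolding B_def Beta_def using G by simp
  have "(\<integral>\<^sup>+t. ennreal (indicator {0<..<1} t * (t powr (s - 1) * (1 - t) powr (c - 1) * F21 p q c (1 - t))) \<partial>lborel)
    = (\<Sum>n. ennreal (hyp_coeff p q c n) * (\<integral>\<^sup>+t. ennreal (indicator {0<..<1} t * (t powr (s - 1) * (1 - t) powr (c - 1) * (1 - t) ^ n)) \<partial>lborel))"
    unfolding F21_def using assms
    by (intro nn_integral_powser) (auto intro!: hyp_coeff_pos[THEN less_imp_le] summable_F21)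
  also have "(\<lambda>n. \<integral>\<^sup>+t. ennreal (indicator {0<..<1} t * (t powr (s - 1) * (1 - t) powr (c - 1) * (1 - t) ^ n)) \<partial>lborel)
      = (\<lambda>n. ennreal (B * pochhammer c n / pochhammer (c + s) n))"
  proof
    fix n
    have "(\<integral>\<^sup>+t. ennreal (indicator {0<..<1} t * (t powr (s - 1) * (1 - t) powr (c - 1) * (1 - t) ^ n)) \<partial>lborel)
        = (\<integral>\<^sup>+t. ennreal (indicator {0<..<1} t * (t powr (s - 1) * (1 - t) powr (c + real n - 1))) \<partial>lborel)"
      by (intro nn_integral_cong arg_cong[where f = ennreal])
         (auto simp: indicator_def powr_realpow[symmetric] powr_add[symmetric] algebra_simps)
    also have "\<dots> = ennreal (Beta s (c + real n))"
      using assms by (intro nn_integral_Beta) auto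
    also have "Beta s (c + real n) = B * pochhammer c n / pochhammer (c + s) n"
      using assms by (subst Beta_commute) (simp add: Beta_shift B_def)
    finally show "(\<integral>\<^sup>+t. ennreal (indicator {0<..<1} t * (t powr (s - 1) * (1 - t) powr (c - 1) * (1 - t) ^ n)) \<partial>lborel)
      = ennreal (B * pochhammer c n / pochhammer (c + s) n)" .
  qed
  also have "(\<lambda>n. ennreal (hyp_coeff p q c n) * ennreal (B * pochhammer c n / pochhammer (c + s) n)) = (\<lambda>n. ennreal (B * hyp_coeff p q (c + s) n))"
  proof
    fix n
    have "pochhammer c n > 0" "pochhammer (c + s) n > 0" using assms by (auto intro!: pochhammer_pos)
    then have "hyp_coeff p q c n * (B * pochhammer c n / pochhammer (c + s) n) = B * hyp_coeff p q (c + s) n"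
      by (simp add: hyp_coeff_def field_simps)
    then show "ennreal (hyp_coeff p q c n) * ennreal (B * pochhammer c n / pochhammer (c + s) n) = ennreal (B * hyp_coeff p q (c + s) n)"
      using hyp_coeff_pos[of p q c n] assms by (simp flip: ennreal_mult')
  qed
  also have "(\<Sum>n. ennreal (B * hyp_coeff p q (c + s) n)) = ennreal (B * (Gamma (c + s) * Gamma (c + s - p - q) / (Gamma (c + s - p) * Gamma (c + s - q))))"
    using Gauss_summation[of p q "c + s", folded hyp_coeff_def] B assms hyp_coeff_pos[of p q "c + s"]
    by (intro suminf_ennreal_eq sums_mult) (auto simp: less_imp_le)
  also have "B * (Gamma (c + s) * Gamma (c + s - p - q) / (Gamma (c + s - p) * Gamma (c + s - q)))
      = Gamma c * Gamma s * Gamma (c + s - p - q) / (Gamma (c + s - p) * Gamma (c + s - q))"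
    using G by (simp add: B_def Beta_def)
  finally show ?thesis .
qed

section \<open>Boundary behaviour of 2F1 at 1\<close>

lemma powser_continuous_nonneg:
  fixes k :: "nat \<Rightarrow> real"
  assumes k: "\<And>n. k n \<ge> 0" and s: "summable k"
  shows "continuous_on {0..1} (\<lambda>z. \<Sum>n. k n * z ^ n)"
proof (rule uniform_limit_theorem)
  show "uniform_limit {0..1} (\<lambda>n z. \<Sum>i<n. k i * z ^ i) (\<lambda>z. \<Sum>n. k n * z ^ n) sequentially"
    using k s by (intro Weierstrass_m_test[where M = k]) (auto simp: abs_mult power_le_one mult_left_le)
qed (auto intro!: always_eventually continuous_intros)

text \<open>An Abelian theorem: asymptotically proportional coefficients give proportional growth at
  the boundary. All but finitely many \<open>f n\<close> are within \<open>e / 2 * g n\<close> of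
  \<open>l * g n\<close>, and since \<open>G\<close> is unbounded the fixed contribution
  \<open>K\<close> of the others disappears in the quotient.\<close>

lemma abelian_comparison:
  fixes f g :: "nat \<Rightarrow> real"
  assumes g: "\<And>n. g n > 0" and lim: "(\<lambda>n. f n / g n) \<longlonglongrightarrow> l"
    and sf: "\<And>z. 0 < z \<Longrightarrow> z < 1 \<Longrightarrow> summable (\<lambda>n. f n * z ^ n)"
    and sg: "\<And>z. 0 < z \<Longrightarrow> z < 1 \<Longrightarrow> (\<lambda>n. g n * z ^ n) sums G z"
    and G: "filterlim G at_top (at_left 1)"
  shows "((\<lambda>z. (\<Sum>n. f n * z ^ n) / G z) \<longlongrightarrow> l) (at_left 1)"
proof (rule tendstoI)
  fix e :: real assume e: "e > 0"
  from lim[THEN tendstoD, of "e / 2"] e obtain N where N: "\<And>n. n \<ge> N \<Longrightarrow> dist (f n / g n) l < e / 2"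
    by (auto simp: eventually_sequentially)
  define h where "h n = f n - l * g n" for n
  have h: "\<bar>h n\<bar> \<le> e / 2 * g n" if "n \<ge> N" for n
  proof -
    have "h n = (f n / g n - l) * g n"
      using g[of n] by (simp add: h_def left_diff_distrib)
    then have "\<bar>h n\<bar> = \<bar>f n / g n - l\<bar> * g n"
      using g[of n] by (simp add: abs_mult)
    also have "\<dots> \<le> e / 2 * g n"
      using N[OF that] g[of n] by (intro mult_right_mono) (auto simp: dist_real_def)
    finally show ?thesis .
  qed
  define K where "K = (\<Sum>n<N. \<bar>h n\<bar>)"
  have bd: "\<bar>(\<Sum>n. f n * z ^ n) - l * G z\<bar> \<le> K + e / 2 * G z" if z: "0 < z" "z < 1" for z
  proof -
    have s1: "(\<lambda>n. h n * z ^ n) sums ((\<Sum>n. f n * z ^ n) - l * G z)"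
      unfolding h_def using sums_diff[OF summable_sums[OF sf[OF z]] sums_mult[OF sg[OF z], of l]] by (simp add: algebra_simps)
    have s2: "(\<lambda>n. (if n \<in> {..<N} then \<bar>h n\<bar> else 0) + e / 2 * (g n * z ^ n)) sums (K + e / 2 * G z)"
      unfolding K_def by (intro sums_add sums_If_finite_set sums_mult sg z) auto
    have le: "\<bar>h n * z ^ n\<bar> \<le> (if n \<in> {..<N} then \<bar>h n\<bar> else 0) + e / 2 * (g n * z ^ n)" for n
    proof (cases "n < N")
      case True
      have "\<bar>h n * z ^ n\<bar> \<le> \<bar>h n\<bar>" using z by (simp add: abs_mult mult_left_le power_le_one)
      moreover have "0 \<le> e / 2 * (g n * z ^ n)" using e g[of n] z by simp
      ultimately show ?thesis using True by simp
    next
      case False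
      then have "\<bar>h n\<bar> * z ^ n \<le> e / 2 * g n * z ^ n" using h z by (intro mult_right_mono) auto
      with False z show ?thesis by (simp add: abs_mult mult_ac)
    qed
    have "\<bar>(\<Sum>n. h n * z ^ n)\<bar> \<le> (\<Sum>n. (if n \<in> {..<N} then \<bar>h n\<bar> else 0) + e / 2 * (g n * z ^ n))"
      using norm_suminf_le[of "\<lambda>n. h n * z ^ n", OF _ sums_summable[OF s2]] le by simp
    then show ?thesis using s1 s2 by (simp add: sums_iff)
  qed
  have "eventually (\<lambda>z. z > 0) (at_left (1::real))" "eventually (\<lambda>z. z < 1) (at_left (1::real))"
    by (auto intro!: eventually_at_leftI[of 0])
  \<comment> \<open>The threshold \<open>2 * K / e\<close> gives \<open>K < e / 2 * G z\<close>, so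
    the two parts of the error add up to less than \<open>e * G z\<close>.\<close>
  moreover have "eventually (\<lambda>z. G z > 2 * K / e) (at_left 1)" "eventually (\<lambda>z. G z > 0) (at_left 1)"
    using G by (auto simp: filterlim_at_top_dense)
  ultimately show "eventually (\<lambda>z. dist ((\<Sum>n. f n * z ^ n) / G z) l < e) (at_left 1)"
  proof eventually_elim
    case (elim z)
    have "(\<Sum>n. f n * z ^ n) / G z - l = ((\<Sum>n. f n * z ^ n) - l * G z) / G z"
      using elim by (simp add: diff_divide_distrib)
    then have "dist ((\<Sum>n. f n * z ^ n) / G z) l = \<bar>(\<Sum>n. f n * z ^ n) - l * G z\<bar> / G z"
      using elim by (simp add: dist_real_def)
    also have "\<dots> \<le> (K + e / 2 * G z) / G z"
      using elim bd[of z] by (intro divide_right_mono) auto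
    also have "\<dots> < e" using elim e by (simp add: field_simps)
    finally show ?case .
  qed
qed

lemma F21_at_left_1_convergent:
  assumes "a > 0" "b > 0" "c > a + b"
  shows "(F21 a b c \<longlongrightarrow> Gamma c * Gamma (c - a - b) / (Gamma (c - a) * Gamma (c - b))) (at_left 1)"
proof -
  have s: "hyp_coeff a b c sums (Gamma c * Gamma (c - a - b) / (Gamma (c - a) * Gamma (c - b)))"
    using Gauss_summation[OF assms] by (simp add: hyp_coeff_def[abs_def])
  have "continuous_on {0..1} (F21 a b c)"
    unfolding F21_def[abs_def] using assms s hyp_coeff_pos[of a b c]
    by (intro powser_continuous_nonneg) (auto simp: less_imp_le sums_iff)
  then have "(F21 a b c \<longlongrightarrow> F21 a b c 1) (at 1 within {0..1})"
    by (simp add: continuous_on)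
  moreover have "F21 a b c 1 = Gamma c * Gamma (c - a - b) / (Gamma (c - a) * Gamma (c - b))"
    using s by (simp add: F21_def sums_iff)
  ultimately show ?thesis by (simp add: at_within_Icc_at_left)
qed

text \<open>The comparison function is \<open>(1 - z) powr (-d)\<close> with
  \<open>d = a + b - c\<close>, whose coefficients \<open>pochhammer d n / fact n\<close> grow at
  the same rate as those of \<open>F21\<close>. The ratio of the coefficients converges by the
  product limit for 1/Gamma.\<close>

lemma F21_at_left_1_divergent:
  assumes "a > 0" "b > 0" "c > 0" "c < a + b"
  shows "((\<lambda>z. (1 - z) powr (a + b - c) * F21 a b c z) \<longlongrightarrow> Gamma c * Gamma (a + b - c) / (Gamma a * Gamma b)) (at_left 1)"
proof -
  define d where "d = a + b - c"
  have d: "d > 0" using assms by (simp add: d_def)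
  define g where "g n = pochhammer d n / fact n" for n
  have gp: "g n > 0" for n unfolding g_def using d by (auto intro!: divide_pos_pos pochhammer_pos)
  have "((\<lambda>z. (\<Sum>n. hyp_coeff a b c n * z ^ n) / (1 - z) powr (-d)) \<longlongrightarrow> Gamma c * Gamma d / (Gamma a * Gamma b)) (at_left 1)"
  proof (rule abelian_comparison[OF gp])
    have nz: "rGamma x \<noteq> 0" if "x > 0" for x :: real
      using that Gamma_real_pos[OF that] by (auto simp: Gamma_def)
    have "(\<lambda>n. rGamma_series a n * rGamma_series b n / (rGamma_series c n * rGamma_series d n))
        \<longlonglongrightarrow> rGamma a * rGamma b / (rGamma c * rGamma d)"
      using nz assms d by (intro tendsto_intros) auto
    also have "rGamma a * rGamma b / (rGamma c * rGamma d) = Gamma c * Gamma d / (Gamma a * Gamma b)"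
      by (simp add: Gamma_def field_simps)
    finally have "(\<lambda>n. rGamma_series a n * rGamma_series b n / (rGamma_series c n * rGamma_series d n))
        \<longlonglongrightarrow> Gamma c * Gamma d / (Gamma a * Gamma b)" .
    moreover have "rGamma_series a n * rGamma_series b n / (rGamma_series c n * rGamma_series d n)
        = hyp_coeff a b c (Suc n) / g (Suc n)" for n
    proof -
      \<comment> \<open>The powers of \<open>n\<close> cancel because \<open>a + b = c + d\<close>.
        The shifted index arises because \<open>rGamma_series\<close> at \<open>n\<close> contains a
        Pochhammer symbol of length \<open>Suc n\<close>.\<close>
      have e: "exp (a * ln (real n)) * exp (b * ln (real n)) = exp (c * ln (real n)) * exp (d * ln (real n))"
        by (simp flip: exp_add distrib_right add: d_def)
      have p: "pochhammer c (Suc n) > 0" "pochhammer d (Suc n) > 0" using assms d by (auto intro!: pochhammer_pos)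
      have "rGamma_series a n * rGamma_series b n / (rGamma_series c n * rGamma_series d n)
        = (pochhammer a (Suc n) * pochhammer b (Suc n)) / (pochhammer c (Suc n) * pochhammer d (Suc n))
          * ((exp (c * ln (real n)) * exp (d * ln (real n))) / (exp (a * ln (real n)) * exp (b * ln (real n))))"
        by (simp add: rGamma_series_def divide_simps del: fact_Suc exp_add)
      also have "\<dots> = hyp_coeff a b c (Suc n) / g (Suc n)"
        unfolding e using p by (simp add: hyp_coeff_def g_def divide_simps del: fact_Suc)
      finally show ?thesis .
    qed
    ultimately have "(\<lambda>n. hyp_coeff a b c (Suc n) / g (Suc n)) \<longlonglongrightarrow> Gamma c * Gamma d / (Gamma a * Gamma b)" by simp
    then show "(\<lambda>n. hyp_coeff a b c n / g n) \<longlonglongrightarrow> Gamma c * Gamma d / (Gamma a * Gamma b)"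
      by (rule LIMSEQ_imp_Suc)
    show "filterlim (\<lambda>z. (1 - z) powr (-d)) at_top (at_left 1)" using d by real_asymp
    show "(\<lambda>n. g n * z ^ n) sums (1 - z) powr (-d)" if "0 < z" "z < 1" for z
      using powr_neg_binomial[of z d] that by (simp add: g_def)
  qed (use assms in \<open>auto intro!: summable_F21\<close>)
  moreover have "(\<Sum>n. hyp_coeff a b c n * z ^ n) / (1 - z) powr (-d) = (1 - z) powr d * F21 a b c z" for z
    by (simp add: F21_def powr_minus divide_inverse mult.commute)
  ultimately show ?thesis by (simp add: d_def)
qed

section \<open>Wronskians and the connection formula between 0 and 1\<close>

text \<open>The first derivative is an argument because limits of it at 0 will be taken; the second
  derivative enters only through the equation. The exponents of this equation at 0 are 0 and
  \<open>1 - e\<close>.\<close>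

definition hyp_solution :: "real \<Rightarrow> real \<Rightarrow> real \<Rightarrow> (real \<Rightarrow> real) \<Rightarrow> (real \<Rightarrow> real) \<Rightarrow> bool" where
  "hyp_solution a b e u u' \<longleftrightarrow>
    (\<forall>y. 0 < y \<and> y < 1 \<longrightarrow> (u has_field_derivative u' y) (at y) \<and>
      (\<exists>u''. (u' has_field_derivative u'') (at y) \<and>
        y * (1 - y) * u'' + (e - (a + b + 1) * y) * u' y - a * b * u y = 0))"

text \<open>Abel's identity: the weight \<open>y powr e * (1 - y) powr C\<close> is the integrating
  factor that makes the Wronskian constant on \<open>(0, 1)\<close>. The constant is read off at 0,
  where the weight \<open>y powr e\<close> tames the derivatives.\<close>

lemma hyp_solution_wronskian:
  fixes a b e :: real
  assumes u: "hyp_solution a b e u u'" and v: "hyp_solution a b e v v'"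
    and u0: "(u \<longlongrightarrow> u0) (at_right 0)" and v0: "(v \<longlongrightarrow> v0) (at_right 0)"
    and u1: "((\<lambda>y. y powr e * u' y) \<longlongrightarrow> u1) (at_right 0)" and v1: "((\<lambda>y. y powr e * v' y) \<longlongrightarrow> v1) (at_right 0)"
    and y: "0 < y" "y < 1"
  shows "y powr e * (1 - y) powr (1 + a + b - e) * (u y * v' y - u' y * v y) = u0 * v1 - u1 * v0"
proof -
  define C where "C = 1 + a + b - e"
  define W where "W y = y powr e * (1 - y) powr C * (u y * v' y - u' y * v y)" for y
  have D: "(W has_field_derivative 0) (at y)" if y: "0 < y" "y < 1" for y
  proof -
    from u y obtain u2 where U: "(u has_field_derivative u' y) (at y)" "(u' has_field_derivative u2) (at y)"
        "y * (1 - y) * u2 + (e - (a + b + 1) * y) * u' y - a * b * u y = 0"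
      unfolding hyp_solution_def by blast
    from v y obtain v2 where V: "(v has_field_derivative v' y) (at y)" "(v' has_field_derivative v2) (at y)"
        "y * (1 - y) * v2 + (e - (a + b + 1) * y) * v' y - a * b * v y = 0"
      unfolding hyp_solution_def by blast
    define r where "r = y powr e * (1 - y) powr C"
    have p1: "((\<lambda>y. y powr e) has_field_derivative (e / y * y powr e)) (at y)"
      using y by (auto intro!: derivative_eq_intros simp: powr_diff)
    have p2: "((\<lambda>y. (1 - y) powr C) has_field_derivative (- C / (1 - y) * (1 - y) powr C)) (at y)"
      using y by (auto intro!: derivative_eq_intros simp: powr_diff)
    have "(W has_field_derivative ((e / y * y powr e) * (1 - y) powr C + (- C / (1 - y) * (1 - y) powr C) * y powr e) * (u y * v' y - u' y * v y)
        + ((u' y * v' y + v2 * u y) - (u2 * v y + v' y * u' y)) * (y powr e * (1 - y) powr C)) (at y)"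
      unfolding W_def by (intro DERIV_mult DERIV_diff p1 p2 U V)
    also have "((e / y * y powr e) * (1 - y) powr C + (- C / (1 - y) * (1 - y) powr C) * y powr e) * (u y * v' y - u' y * v y)
        + ((u' y * v' y + v2 * u y) - (u2 * v y + v' y * u' y)) * (y powr e * (1 - y) powr C)
        = r / (y * (1 - y)) * ((e * (1 - y) - C * y) * (u y * v' y - u' y * v y) + y * (1 - y) * (v2 * u y - u2 * v y))"
      using y by (simp add: r_def field_simps)
    also have "(e * (1 - y) - C * y) * (u y * v' y - u' y * v y) + y * (1 - y) * (v2 * u y - u2 * v y) = 0"
      using U(3) V(3) unfolding C_def by algebra
    finally show ?thesis by simp
  qed
  have const: "W z = W y" if "0 < z" "z < 1" for z
    using has_field_derivative_zero_constant[of "{0<..<1}" W] D that y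
    by (metis DERIV_subset convex_real_interval(8) greaterThanLessThan_iff has_field_derivative_at_within)
  have "((\<lambda>y. (1 - y) powr C * (u y * (y powr e * v' y) - (y powr e * u' y) * v y)) \<longlongrightarrow> (1 - 0) powr C * (u0 * v1 - u1 * v0)) (at_right 0)"
    by (intro tendsto_intros u0 v0 u1 v1) auto
  moreover have "eventually (\<lambda>z. (1 - z) powr C * (u z * (z powr e * v' z) - (z powr e * u' z) * v z) = W y) (at_right 0)"
    using const by (intro eventually_at_rightI[of 0 1]) (auto simp: W_def algebra_simps)
  ultimately have "((\<lambda>_. W y) \<longlongrightarrow> u0 * v1 - u1 * v0) (at_right (0::real))"
    by (subst (asm) tendsto_cong) auto
  then show ?thesis by (simp add: W_def C_def tendsto_const_iff)
qed

lemma F21_tendsto_0: 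
  assumes "a > 0" "b > 0" "c > 0"
  shows "(F21 a b c \<longlongrightarrow> 1) (at_right 0)"
  using F21_isCont[OF assms, of 0] by (auto simp: isCont_def intro: filterlim_mono_eventually tendsto_within_subset[of _ _ _ UNIV])

text \<open>Three solutions of one second-order equation are linearly dependent, and the
  coefficients are the pairwise Wronskians, all known from limits at 0. The terms are distributed
  over the two sides so that every coefficient is positive, which suits integration in
  \<open>ennreal\<close>.\<close>

theorem F21_connection:
  assumes ab: "a > 0" "b > 0" and e: "0 < e" "e < 1" and y: "0 < y" "y < 1"
  defines "C \<equiv> 1 + a + b - e"
  shows "F21 a b C (1 - y) + Gamma C * Gamma e / ((1 - e) * Gamma a * Gamma b) * (y powr (1 - e) * F21 (1 + a - e) (1 + b - e) (2 - e) y)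
    = Gamma C * Gamma (1 - e) / (Gamma (1 + a - e) * Gamma (1 + b - e)) * F21 a b e y"
proof -
  \<comment> \<open>\<open>H\<close> is the solution regular at 1; \<open>R\<close> and
    \<open>S\<close> are the solutions with exponents 0 and \<open>1 - e\<close> at 0.\<close>
  define H where "H y = F21 a b C (1 - y)" for y
  define H1 where "H1 y = - (a * b / C * F21 (a + 1) (b + 1) (C + 1) (1 - y))" for y
  define R where "R = F21 a b e"
  define R1 where "R1 y = a * b / e * F21 (a + 1) (b + 1) (e + 1) y" for y
  define A where "A = 1 + a - e"
  define B where "B = 1 + b - e"
  define E where "E = 2 - e"
  define G where "G = F21 A B E"
  define G1 where "G1 y = A * B / E * F21 (A + 1) (B + 1) (E + 1) y" for y
  define G2 where "G2 y = A * B / E * ((A + 1) * (B + 1) / (E + 1) * F21 (A + 2) (B + 2) (E + 2) y)" for y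
  define S where "S y = y powr (1 - e) * G y" for y
  define S1 where "S1 y = y powr (-e) * ((1 - e) * G y + y * G1 y)" for y
  have pos: "A > 0" "B > 0" "E > 0" "C > 0" using ab e by (auto simp: A_def B_def E_def C_def)
  have solR: "hyp_solution a b e R R1"
    unfolding hyp_solution_def
  proof (intro allI impI conjI exI)
    fix y :: real assume y: "0 < y \<and> y < 1"
    show "(R has_field_derivative R1 y) (at y)" unfolding R_def R1_def using ab e y by (intro F21_deriv) auto
    show "(R1 has_field_derivative a * b / e * ((a + 1) * (b + 1) / (e + 1) * F21 (a + 2) (b + 2) (e + 2) y)) (at y)"
      unfolding R1_def using F21_deriv[of "a+1" "b+1" "e+1" y] ab e y by (intro DERIV_cmult) (auto simp: add.assoc)
    show "y * (1 - y) * (a * b / e * ((a + 1) * (b + 1) / (e + 1) * F21 (a + 2) (b + 2) (e + 2) y)) + (e - (a + b + 1) * y) * R1 y - a * b * R y = 0"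
      unfolding R_def R1_def using ab e y by (intro F21_ODE) auto
  qed
  have solH: "hyp_solution a b e H H1"
    unfolding hyp_solution_def
  proof (intro allI impI conjI exI)
    fix y :: real assume y: "0 < y \<and> y < 1"
    have *: "((\<lambda>y. f (1 - y)) has_field_derivative - f') (at y)" if "(f has_field_derivative f') (at (1 - y))" for f f'
      
    proof -
      have "((\<lambda>y. 1 - y) has_field_derivative -1) (at y)" by (auto intro!: derivative_eq_intros)
      from DERIV_chain2[of f f' "\<lambda>y. 1 - y" y "-1" UNIV, OF that this] show ?thesis by simp
    qed
    show "(H has_field_derivative H1 y) (at y)" unfolding H_def H1_def using ab pos y by (intro * F21_deriv) auto
    have "((\<lambda>y. F21 (a + 1) (b + 1) (C + 1) (1 - y)) has_field_derivative - ((a + 1) * (b + 1) / (C + 1) * F21 (a + 2) (b + 2) (C + 2) (1 - y))) (at y)"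
      using F21_deriv[of "a+1" "b+1" "C+1" "1 - y"] ab pos y by (intro *) (auto simp: add.assoc)
    from DERIV_minus[OF DERIV_cmult[OF this, of "a * b / C"]] show "(H1 has_field_derivative a * b / C * ((a + 1) * (b + 1) / (C + 1) * F21 (a + 2) (b + 2) (C + 2) (1 - y))) (at y)"
      unfolding H1_def by simp
    have "(1 - y) * (1 - (1 - y)) * (a * b / C * ((a + 1) * (b + 1) / (C + 1) * F21 (a + 2) (b + 2) (C + 2) (1 - y)))
       + (C - (a + b + 1) * (1 - y)) * (a * b / C * F21 (a + 1) (b + 1) (C + 1) (1 - y)) - a * b * F21 a b C (1 - y) = 0"
      using ab pos y by (intro F21_ODE) auto
    \<comment> \<open>The equation is symmetric under \<open>y\<close> to \<open>1 - y\<close> with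
      \<open>e\<close> and \<open>C\<close> interchanged; the sign appearing here is absorbed by the
      minus sign in \<open>H1\<close>.\<close>
    moreover have "C - (a + b + 1) * (1 - y) = - (e - (a + b + 1) * y)" by (simp add: C_def algebra_simps)
    ultimately show "y * (1 - y) * (a * b / C * ((a + 1) * (b + 1) / (C + 1) * F21 (a + 2) (b + 2) (C + 2) (1 - y))) + (e - (a + b + 1) * y) * H1 y - a * b * H y = 0"
      unfolding H_def H1_def by (simp only: minus_mult_minus minus_mult_commute diff_diff_eq2 mult.commute[of "1 - y"] add_diff_cancel_left' flip: minus_mult_left)
  qed
  have dG: "(G has_field_derivative G1 y) (at y)" "(G1 has_field_derivative G2 y) (at y)"
     "y * (1 - y) * G2 y + (E - (A + B + 1) * y) * G1 y - A * B * G y = 0" if "0 \<le> y" "y < 1" for y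
  proof -
    show "(G has_field_derivative G1 y) (at y)" unfolding G_def G1_def using pos that by (intro F21_deriv) auto
    show "(G1 has_field_derivative G2 y) (at y)"
      unfolding G1_def G2_def using F21_deriv[of "A+1" "B+1" "E+1" y] pos that by (intro DERIV_cmult) (auto simp: add.assoc)
    show "y * (1 - y) * G2 y + (E - (A + B + 1) * y) * G1 y - A * B * G y = 0"
      unfolding G_def G1_def G2_def using pos that by (intro F21_ODE) auto
  qed
  have solS: "hyp_solution a b e S S1"
    unfolding hyp_solution_def
  proof (intro allI impI conjI exI)
    fix y :: real assume y: "0 < y \<and> y < 1"
    define r where "r = y powr (-e)"
    define r1 where "r1 = y powr (- e - 1)"
    have r: "y powr (1 - e) = y * r" "y powr (-e) = y * r1" using y by (auto simp: r_def r1_def powr_diff powr_minus_divide)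
    have p1: "((\<lambda>y. y powr (1 - e)) has_field_derivative (1 - e) * y powr (-e)) (at y)"
      using y by (auto intro!: derivative_eq_intros)
    have p2: "((\<lambda>y. y powr (- e)) has_field_derivative (- e) * r1) (at y)"
      using y by (auto intro!: derivative_eq_intros simp: r1_def)
    show "(S has_field_derivative S1 y) (at y)"
      unfolding S_def S1_def
      by (rule DERIV_cong[OF DERIV_mult[OF p1 dG(1)]]) (use y r in \<open>auto simp: r_def algebra_simps\<close>)
    show "(S1 has_field_derivative r1 * (- e * (1 - e) * G y + 2 * (1 - e) * y * G1 y + y^2 * G2 y)) (at y)"
      unfolding S1_def
      by (rule DERIV_cong[OF DERIV_mult[OF p2 DERIV_add[OF DERIV_cmult[OF dG(1)] DERIV_mult[OF DERIV_ident dG(2)]]]])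
         (use y r in \<open>auto simp: power2_eq_square algebra_simps\<close>)
    show "y * (1 - y) * (r1 * (- e * (1 - e) * G y + 2 * (1 - e) * y * G1 y + y^2 * G2 y)) + (e - (a + b + 1) * y) * S1 y - a * b * S y = 0"
    proof -
      have S: "S y = y * (y * r1) * G y" "S1 y = y * r1 * ((1 - e) * G y + y * G1 y)"
        using r by (auto simp: S_def S1_def r_def)
      have "y * (1 - y) * G2 y + (E - (A + B + 1) * y) * G1 y - A * B * G y = 0" using y by (intro dG) auto
      then show ?thesis unfolding S A_def B_def E_def by algebra
    qed
  qed
  \<comment> \<open>\<open>\<alpha>\<close> is the value of \<open>H\<close> at 0 given by Gauss's
    theorem, and \<open>- \<kappa>\<close> is the limit of \<open>y powr e * H1 y\<close>: the
    derivative of \<open>H\<close> is a multiple of a 2F1 of the divergent kind, with exponent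
    exactly \<open>e\<close>.\<close>
  define \<alpha> where "\<alpha> = Gamma C * Gamma (1 - e) / (Gamma (1 + a - e) * Gamma (1 + b - e))"
  define \<kappa> where "\<kappa> = Gamma C * Gamma e / (Gamma a * Gamma b)"
  have fl: "filterlim (\<lambda>y. 1 - y) (at_left 1) (at_right (0::real))" by real_asymp
  have limH: "(H \<longlongrightarrow> \<alpha>) (at_right 0)"
    using filterlim_compose[OF F21_at_left_1_convergent[of a b C] fl] ab e
    by (simp add: H_def[abs_def] \<alpha>_def C_def algebra_simps)
  have limH1: "((\<lambda>y. y powr e * H1 y) \<longlongrightarrow> - \<kappa>) (at_right 0)"
  proof -
    have "((\<lambda>y. (1 - (1 - y)) powr ((a + 1) + (b + 1) - (C + 1)) * F21 (a + 1) (b + 1) (C + 1) (1 - y)) \<longlongrightarrow>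
        Gamma (C + 1) * Gamma ((a + 1) + (b + 1) - (C + 1)) / (Gamma (a + 1) * Gamma (b + 1))) (at_right 0)"
      using ab e pos by (intro filterlim_compose[OF F21_at_left_1_divergent fl]) (auto simp: C_def)
    moreover have "(a + 1) + (b + 1) - (C + 1) = e" by (simp add: C_def)
    ultimately have "((\<lambda>y. y powr e * F21 (a + 1) (b + 1) (C + 1) (1 - y)) \<longlongrightarrow>
        Gamma (C + 1) * Gamma e / (Gamma (a + 1) * Gamma (b + 1))) (at_right 0)" by simp
    then have "((\<lambda>y. - (a * b / C) * (y powr e * F21 (a + 1) (b + 1) (C + 1) (1 - y))) \<longlongrightarrow>
        - (a * b / C) * (Gamma (C + 1) * Gamma e / (Gamma (a + 1) * Gamma (b + 1)))) (at_right 0)"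
      by (rule tendsto_mult_left)
    moreover have "- (a * b / C) * (Gamma (C + 1) * Gamma e / (Gamma (a + 1) * Gamma (b + 1))) = - \<kappa>"
    proof -
      have "Gamma (x + 1) = x * Gamma x" if "x > 0" for x :: real
        using that by (intro Gamma_plus1) (auto elim!: nonpos_Ints_cases)
      then show ?thesis using ab pos by (simp add: \<kappa>_def)
    qed
    ultimately show ?thesis by (simp add: H1_def mult_ac)
  qed
  have limR: "(R \<longlongrightarrow> 1) (at_right 0)" unfolding R_def using ab e by (intro F21_tendsto_0) auto
  have pe: "((\<lambda>y. y powr x) \<longlongrightarrow> 0) (at_right 0)" if "x > 0" for x :: real using that by real_asymp
  have limR1: "((\<lambda>y. y powr e * R1 y) \<longlongrightarrow> 0) (at_right 0)"
    using tendsto_mult[OF pe[of e] tendsto_mult_left[OF F21_tendsto_0[of "a + 1" "b + 1" "e + 1"], of "a * b / e"]] ab e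
    by (simp add: R1_def[abs_def])
  have limG: "(G \<longlongrightarrow> 1) (at_right 0)" unfolding G_def using pos by (intro F21_tendsto_0) auto
  have limG1: "(G1 \<longlongrightarrow> A * B / E) (at_right 0)" unfolding G1_def using pos by (auto intro!: tendsto_eq_intros F21_tendsto_0)
  have limS: "(S \<longlongrightarrow> 0) (at_right 0)"
    using tendsto_mult[OF pe[of "1 - e"] limG] e by (simp add: S_def[abs_def])
  have "((\<lambda>y. (1 - e) * G y + y * G1 y) \<longlongrightarrow> 1 - e) (at_right 0)"
    by (auto intro!: tendsto_eq_intros limG limG1)
  moreover have "eventually (\<lambda>y. (1 - e) * G y + y * G1 y = y powr e * S1 y) (at_right 0)"
    by (intro eventually_at_rightI[of 0 1]) (auto simp: S1_def powr_minus)
  ultimately have limS1: "((\<lambda>y. y powr e * S1 y) \<longlongrightarrow> 1 - e) (at_right 0)"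
    by (rule Lim_transform_eventually)
  define w where "w = y powr e * (1 - y) powr (1 + a + b - e)"
  have w: "w \<noteq> 0" using y by (simp add: w_def)
  have "w * (R y * S1 y - R1 y * S y) = 1 * (1 - e) - 0 * 0"
    unfolding w_def by (intro hyp_solution_wronskian solR solS limR limR1 limS limS1 y)
  moreover have "w * (H y * S1 y - H1 y * S y) = \<alpha> * (1 - e) - (- \<kappa>) * 0"
    unfolding w_def by (intro hyp_solution_wronskian solH solS limH limH1 limS limS1 y)
  moreover have "w * (H y * R1 y - H1 y * R y) = \<alpha> * 0 - (- \<kappa>) * 1"
    unfolding w_def by (intro hyp_solution_wronskian solH solR limH limH1 limR limR1 y)
  \<comment> \<open>Expanding a determinant with a repeated row: \<open>H * (R * S1 - R1 * S) - R *
    (H * S1 - H1 * S) + S * (H * R1 - H1 * R) = 0\<close>, into which the three Wronskians are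
    inserted.\<close>
  ultimately have "(1 - e) * H y - \<alpha> * (1 - e) * R y + \<kappa> * S y = 0" by algebra
  then have "H y + \<kappa> / (1 - e) * S y = \<alpha> * R y" using e by (simp add: field_simps)
  then show ?thesis
    by (simp add: H_def R_def S_def \<alpha>_def \<kappa>_def G_def A_def B_def E_def mult.assoc divide_divide_eq_left mult.commute mult.left_commute)
qed

section \<open>The regularised balanced series\<close>

text \<open>First-order expansions with quadratic error can be multiplied. The three error terms
  cost \<open>3 * K^2\<close>, \<open>2 * K^2\<close> and \<open>K^2\<close>, whence the new
  constant \<open>6 * K^2\<close>, which also bounds the new linear coefficient, so that the lemma
  can be iterated.\<close>

lemma linear_approx_mult:
  fixes P Q p q :: complex and x K :: real
  assumes P: "norm (P - 1 - p * x) \<le> K * x^2" and Q: "norm (Q - 1 - q * x) \<le> K * x^2"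
    and p: "norm p \<le> K" and q: "norm q \<le> K" and x: "0 \<le> x" "x \<le> 1" and K: "1 \<le> K"
  shows "norm (P * Q - 1 - (p + q) * x) \<le> 6 * K^2 * x^2" "norm (p + q) \<le> 6 * K^2"
proof -
  have K2: "K \<le> K^2" using K by (simp add: power2_eq_square)
  have x2: "x^2 \<le> 1" using x by (simp add: power_le_one)
  have nQ: "norm Q \<le> 3 * K"
  proof -
    have "norm Q \<le> norm (Q - 1 - q * x) + norm (1 + q * x)"
      by (metis add_diff_cancel_left' diff_diff_eq norm_triangle_sub add.commute)
    also have "norm (1 + q * x) \<le> 1 + norm q * x"
      using x by (metis norm_triangle_ineq norm_one norm_mult norm_of_real abs_of_nonneg)
    also have "norm q * x \<le> K * 1" using q x K by (intro mult_mono) auto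
    also have "norm (Q - 1 - q * x) \<le> K * 1" using Q K x2 by (smt (verit) mult_left_le)
    finally show ?thesis using K by simp
  qed
  have "P * Q - 1 - (p + q) * x = (P - 1 - p * x) * Q + (1 + p * x) * (Q - 1 - q * x) + p * q * x^2"
    by (simp add: algebra_simps power2_eq_square)
  also have "norm \<dots> \<le> norm (P - 1 - p * x) * norm Q + norm (1 + p * x) * norm (Q - 1 - q * x) + norm p * norm q * x^2"
    by (intro norm_triangle_le add_mono) (auto simp: norm_mult norm_power)
  also have "norm (P - 1 - p * x) * norm Q \<le> (K * x^2) * (3 * K)" using P nQ K by (intro mult_mono) auto
  also have "norm (1 + p * x) * norm (Q - 1 - q * x) \<le> (2 * K) * (K * x^2)"
  proof (intro mult_mono Q)
    have "norm (1 + p * x) \<le> 1 + norm p * x"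
      using x by (metis norm_triangle_ineq norm_one norm_mult norm_of_real abs_of_nonneg)
    also have "norm p * x \<le> K * 1" using p x K by (intro mult_mono) auto
    finally show "norm (1 + p * x) \<le> 2 * K" using K by simp
  qed (use K in auto)
  also have "norm p * norm q * x^2 \<le> K * K * x^2" using p q K by (intro mult_mono) auto
  finally show "norm (P * Q - 1 - (p + q) * x) \<le> 6 * K^2 * x^2" by (simp add: power2_eq_square)
  show "norm (p + q) \<le> 6 * K^2" using norm_triangle_ineq[of p q] p q K2 K by linarith
qed

definition balanced :: "complex \<Rightarrow> complex \<Rightarrow> complex \<Rightarrow> complex \<Rightarrow> complex \<Rightarrow> complex \<Rightarrow> complex \<Rightarrow> bool" where
  "balanced a b c d e f g \<longleftrightarrow> e + f + g - a - b - c - d = 1"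

text \<open>With \<open>x = 1 / n\<close> the ratio of consecutive terms is \<open>Nu / De\<close>,
  two products of four linear factors. Balance makes their linear coefficients differ by exactly 2,
  so the ratio is \<open>1 - 2 / n\<close> up to a quadratic error; giving up a quarter of the 2
  absorbs that error. It matters that \<open>N\<close> depends only on \<open>M\<close>: this is the
  source of local uniformity.\<close>

lemma balanced_ratio_bound:
  fixes M :: real
  assumes M: "M \<ge> 1"
  obtains N :: nat where "N \<ge> 1"
    "\<And>n a b c d e f g. n \<ge> N \<Longrightarrow> balanced a b c d e f g \<Longrightarrow>
      norm a \<le> M \<Longrightarrow> norm b \<le> M \<Longrightarrow> norm c \<le> M \<Longrightarrow> norm d \<le> M \<Longrightarrow> norm e \<le> M \<Longrightarrow> norm f \<le> M \<Longrightarrow> norm g \<le> M \<Longrightarrow>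
      norm ((a + of_nat n) * (b + of_nat n) * (c + of_nat n) * (d + of_nat n)) \<le>
        (1 - 3 / (2 * real n)) * norm (of_nat (Suc n) * (e + of_nat n) * (f + of_nat n) * (g + of_nat n)) \<and>
      of_nat (Suc n) * (e + of_nat n) * (f + of_nat n) * (g + of_nat n) \<noteq> 0"
proof -
  define K where "K = M + 2"
  define K2 where "K2 = 6 * K^2"
  define K3 where "K3 = 6 * K2^2"
  define K4 where "K4 = 6 * K3^2"
  have sq: "1 \<le> x \<Longrightarrow> 1 \<le> 6 * x^2 \<and> x \<le> 6 * x^2" for x :: real using self_le_power[of x 2] by simp
  have K: "1 \<le> K" "1 \<le> K2" "1 \<le> K3" "1 \<le> K4" "K \<le> K2" "K2 \<le> K3" "K3 \<le> K4"
  proof -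
    show k: "1 \<le> K" using M by (simp add: K_def)
    show k2: "1 \<le> K2" using sq[OF k] by (simp add: K2_def)
    show k3: "1 \<le> K3" using sq[OF k2] by (simp add: K3_def)
    show k4: "1 \<le> K4" using sq[OF k3] by (simp add: K4_def)
    show "K \<le> K2" using sq[OF k] by (simp add: K2_def)
    show "K2 \<le> K3" using sq[OF k2] by (simp add: K3_def)
    show "K3 \<le> K4" using sq[OF k3] by (simp add: K4_def)
  qed
  \<comment> \<open>From here on \<open>8 * K4 * x \<le> 1\<close>. This forces
    \<open>norm De \<ge> 1 / 2\<close>, and then the error \<open>2 * K4 * x^2\<close> is at most
    \<open>x / 4\<close>, hence at most \<open>(x / 2) * norm De\<close>.\<close>
  define N where "N = Suc (nat \<lceil>8 * K4\<rceil>)"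
  show ?thesis
  proof (rule that[of N])
    show "N \<ge> 1" by (simp add: N_def)
    fix n :: nat and a b c d e f g :: complex
    assume n: "n \<ge> N" and bal: "balanced a b c d e f g"
      and nm: "norm a \<le> M" "norm b \<le> M" "norm c \<le> M" "norm d \<le> M" "norm e \<le> M" "norm f \<le> M" "norm g \<le> M"
    define x where "x = 1 / real n"
    have n8: "real n \<ge> 8 * K4" using n unfolding N_def by linarith
    then have n0: "n > 0" "real n > 0" using K(4) by (auto intro: gr0I)
    have x: "0 < x" "x \<le> 1" using n0 n8 K(4) by (auto simp: x_def field_simps)
    have xK: "8 * K4 * x \<le> 1" using n8 n0 by (simp add: x_def field_simps)
    have lin: "norm ((1 + p * x) - 1 - p * x) \<le> K * x^2" for p :: complex using K by simp
    have Ks: "norm p \<le> M \<Longrightarrow> norm p \<le> K" for p :: complex by (simp add: K_def)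
    have one: "norm (1 :: complex) \<le> K" "norm (-2 :: complex) \<le> K3" using K M by (simp_all add: K_def)
    note lm = linear_approx_mult[OF _ _ _ _ less_imp_le[OF x(1)] x(2)]
    define Nu where "Nu = ((1 + a * x) * (1 + b * x)) * ((1 + c * x) * (1 + d * x))"
    define De where "De = ((1 + 1 * x) * (1 + e * x)) * ((1 + f * x) * (1 + g * x))"
    have ab: "norm ((1 + a * x) * (1 + b * x) - 1 - (a + b) * x) \<le> K2 * x^2" "norm (a + b) \<le> K2"
      unfolding K2_def by (fact lm[OF lin lin Ks[OF nm(1)] Ks[OF nm(2)] K(1)])+
    have cd: "norm ((1 + c * x) * (1 + d * x) - 1 - (c + d) * x) \<le> K2 * x^2" "norm (c + d) \<le> K2"
      unfolding K2_def by (fact lm[OF lin lin Ks[OF nm(3)] Ks[OF nm(4)] K(1)])+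
    have ie: "norm ((1 + 1 * x) * (1 + e * x) - 1 - (1 + e) * x) \<le> K2 * x^2" "norm (1 + e) \<le> K2"
      unfolding K2_def using lm[OF lin lin one(1) Ks[OF nm(5)] K(1)] by simp_all
    have fg: "norm ((1 + f * x) * (1 + g * x) - 1 - (f + g) * x) \<le> K2 * x^2" "norm (f + g) \<le> K2"
      unfolding K2_def by (fact lm[OF lin lin Ks[OF nm(6)] Ks[OF nm(7)] K(1)])+
    have Nu: "norm (Nu - 1 - ((a + b) + (c + d)) * x) \<le> K3 * x^2"
      unfolding K3_def Nu_def by (fact lm[OF ab(1) cd(1) ab(2) cd(2) K(2)])
    have De: "norm (De - 1 - ((1 + e) + (f + g)) * x) \<le> K3 * x^2" "norm ((1 + e) + (f + g)) \<le> K3"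
      unfolding K3_def De_def by (fact lm[OF ie(1) fg(1) ie(2) fg(2) K(2)])+
    \<comment> \<open>Multiplying \<open>De\<close> by \<open>1 - 2 * x\<close> gives it the same
      linear coefficient as \<open>Nu\<close>, so only quadratic errors remain to be
      compared.\<close>
    have "norm ((1 + (-2) * x) * De - 1 - ((-2) + ((1 + e) + (f + g))) * x) \<le> K4 * x^2"
      unfolding K4_def using K by (intro lm(1) De one) auto
    moreover have "(-2) + ((1 + e) + (f + g)) = (a + b) + (c + d)"
      using bal by (simp add: balanced_def algebra_simps)
    ultimately have De': "norm ((1 + (-2) * x) * De - 1 - ((a + b) + (c + d)) * x) \<le> K4 * x^2" by simp
    have "norm Nu \<le> norm ((1 + (-2) * x) * De) + norm (Nu - (1 + (-2) * x) * De)"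
      using norm_triangle_sub by blast
    also have "norm (Nu - (1 + (-2) * x) * De) \<le> K4 * x^2 + K4 * x^2"
    proof -
      have "Nu - (1 + (-2) * x) * De = (Nu - 1 - ((a + b) + (c + d)) * x) - ((1 + (-2) * x) * De - 1 - ((a + b) + (c + d)) * x)"
        by simp
      then have "norm (Nu - (1 + (-2) * x) * De) \<le> norm (Nu - 1 - ((a + b) + (c + d)) * x) + norm ((1 + (-2) * x) * De - 1 - ((a + b) + (c + d)) * x)"
        by (metis norm_triangle_ineq4)
      moreover have "K3 * x^2 \<le> K4 * x^2" using K by (intro mult_right_mono) auto
      ultimately show ?thesis using Nu De' by linarith
    qed
    also have "norm ((1 + (-2) * x) * De) = (1 - 2 * x) * norm De"
    proof -
      have "1 * x \<le> K4 * x" using K(4) x by (intro mult_right_mono) auto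
      with xK x have "2 * x \<le> 1" by linarith
      then have "\<bar>1 + (-2) * x\<bar> = 1 - 2 * x" by simp
      then show ?thesis by (simp only: norm_mult norm_of_real)
    qed
    finally have 1: "norm Nu \<le> (1 - 2 * x) * norm De + 2 * K4 * x^2" by simp
    have De_half: "norm De \<ge> 1 / 2"
    proof -
      have x1: "x^2 \<le> x" using x by (simp add: power2_eq_square mult_left_le)
      have "norm (1 :: complex) \<le> norm De + norm (De - 1)" by (metis norm_triangle_sub norm_minus_commute)
      also have "norm (De - 1) \<le> norm (De - 1 - ((1 + e) + (f + g)) * x) + norm (((1 + e) + (f + g)) * x)"
        by (metis add.commute norm_triangle_sub)
      also have "norm (((1 + e) + (f + g)) * x) = norm ((1 + e) + (f + g)) * x" using x by (simp add: norm_mult)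
      also have "\<dots> \<le> K3 * x" using De x by (intro mult_right_mono) auto
      also have "norm (De - 1 - ((1 + e) + (f + g)) * x) \<le> K3 * x"
        using De(1) mult_left_mono[OF x1, of K3] K by linarith
      also have "norm De + (K3 * x + K3 * x) \<le> norm De + 2 * (K4 * x)" using mult_right_mono[OF K(7), of x] x by simp
      finally show ?thesis using xK by simp
    qed
    have "2 * K4 * x^2 \<le> (x / 2) * norm De"
    proof -
      have "2 * K4 * x^2 = (8 * K4 * x) * (x / 4)" by (simp add: power2_eq_square)
      also have "\<dots> \<le> 1 * (x / 4)" using xK x by (intro mult_right_mono) auto
      also have "\<dots> \<le> (x / 2) * norm De" using De_half x by (simp add: field_simps)
      finally show ?thesis .
    qed
    with 1 have 2: "norm Nu \<le> (1 - 3 / 2 * x) * norm De" by (simp add: algebra_simps)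
    have sc: "p + of_nat n = of_nat n * (1 + p * x)" for p :: complex using n0 by (simp add: x_def field_simps)
    have Nn: "(a + of_nat n) * (b + of_nat n) * (c + of_nat n) * (d + of_nat n) = of_nat n ^ 4 * Nu"
      unfolding sc Nu_def by (simp add: power4_eq_xxxx)
    have Dn: "of_nat (Suc n) * (e + of_nat n) * (f + of_nat n) * (g + of_nat n) = of_nat n ^ 4 * De"
      using sc[of 1] unfolding of_nat_Suc sc[of e] sc[of f] sc[of g] De_def by (simp add: power4_eq_xxxx)
    have "norm (of_nat n ^ 4 * Nu) \<le> (1 - 3 / (2 * real n)) * norm (of_nat n ^ 4 * De)"
      using mult_left_mono[OF 2, of "real n ^ 4"] by (simp add: norm_mult norm_power x_def mult_ac)
    moreover have "of_nat n ^ 4 * De \<noteq> 0" using De_half n0 by auto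
    ultimately show "norm ((a + of_nat n) * (b + of_nat n) * (c + of_nat n) * (d + of_nat n)) \<le>
        (1 - 3 / (2 * real n)) * norm (of_nat (Suc n) * (e + of_nat n) * (f + of_nat n) * (g + of_nat n)) \<and>
      of_nat (Suc n) * (e + of_nat n) * (f + of_nat n) * (g + of_nat n) \<noteq> 0"
      unfolding Nn Dn by simp
  qed
qed

text \<open>The regularised series \<open>F43 a b c d e f g * (rGamma e * rGamma f * rGamma g)\<close>, which makes sense for all parameters.\<close>

definition F43r_term :: "complex \<Rightarrow> complex \<Rightarrow> complex \<Rightarrow> complex \<Rightarrow> complex \<Rightarrow> complex \<Rightarrow> complex \<Rightarrow> nat \<Rightarrow> complex" where
  "F43r_term a b c d e f g n = pochhammer a n * pochhammer b n * pochhammer c n * pochhammer d n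
     * (rGamma (e + of_nat n) * rGamma (f + of_nat n) * rGamma (g + of_nat n)) / fact n"

definition F43r :: "complex \<Rightarrow> complex \<Rightarrow> complex \<Rightarrow> complex \<Rightarrow> complex \<Rightarrow> complex \<Rightarrow> complex \<Rightarrow> complex" where
  "F43r a b c d e f g = (\<Sum>n. F43r_term a b c d e f g n)"

text \<open>The recurrence is kept free of division because \<open>e + n\<close>,
  \<open>f + n\<close> or \<open>g + n\<close> may vanish; in this form it follows from the
  functional equation of 1/Gamma, valid everywhere.\<close>

lemma F43r_term_Suc:
  "F43r_term a b c d e f g (Suc n) * (of_nat (Suc n) * (e + of_nat n) * (f + of_nat n) * (g + of_nat n))
    = (a + of_nat n) * (b + of_nat n) * (c + of_nat n) * (d + of_nat n) * F43r_term a b c d e f g n"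
proof -
  have r: "rGamma (z + of_nat n) = (z + of_nat n) * rGamma (z + of_nat (Suc n))" for z :: complex
    using rGamma_plus1[of "z + of_nat n"] by (simp add: add_ac)
  have "fact (Suc n) = of_nat (Suc n) * (fact n :: complex)" by simp
  then show ?thesis
    unfolding F43r_term_def r pochhammer_Suc by (simp add: divide_simps del: of_nat_Suc fact_Suc)
qed

text \<open>The ratio bound \<open>1 - 3 / (2 * n)\<close> lies eventually below
  \<open>(n / (n + 1)) powr (5/4)\<close>, and the product of these powers telescopes. The exponent
  5/4 is just a number strictly between 1, needed for summability, and 3/2.\<close>

lemma F43r_term_bound:
  fixes M :: real
  assumes M: "M \<ge> 1"
  obtains N :: nat where "N \<ge> 1"
    "\<And>n a b c d e f g. n \<ge> N \<Longrightarrow> balanced a b c d e f g \<Longrightarrow>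
      norm a \<le> M \<Longrightarrow> norm b \<le> M \<Longrightarrow> norm c \<le> M \<Longrightarrow> norm d \<le> M \<Longrightarrow> norm e \<le> M \<Longrightarrow> norm f \<le> M \<Longrightarrow> norm g \<le> M \<Longrightarrow>
      norm (F43r_term a b c d e f g n) \<le> norm (F43r_term a b c d e f g N) * real N powr (5/4) * real n powr (-5/4)"
proof -
  obtain N0 where N0: "N0 \<ge> 1"
    "\<And>n a b c d e f g. n \<ge> N0 \<Longrightarrow> balanced a b c d e f g \<Longrightarrow>
      norm a \<le> M \<Longrightarrow> norm b \<le> M \<Longrightarrow> norm c \<le> M \<Longrightarrow> norm d \<le> M \<Longrightarrow> norm e \<le> M \<Longrightarrow> norm f \<le> M \<Longrightarrow> norm g \<le> M \<Longrightarrow>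
      norm ((a + of_nat n) * (b + of_nat n) * (c + of_nat n) * (d + of_nat n)) \<le>
        (1 - 3 / (2 * real n)) * norm (of_nat (Suc n) * (e + of_nat n) * (f + of_nat n) * (g + of_nat n)) \<and>
      of_nat (Suc n) * (e + of_nat n) * (f + of_nat n) * (g + of_nat n) \<noteq> 0"
    by (rule balanced_ratio_bound[OF M]) blast
  have "eventually (\<lambda>n. 1 - 3 / (2 * real n) \<le> (real n / real (Suc n)) powr (5/4)) sequentially"
    unfolding of_nat_Suc by real_asymp
  then obtain N1 where N1: "\<And>n. n \<ge> N1 \<Longrightarrow> 1 - 3 / (2 * real n) \<le> (real n / real (Suc n)) powr (5/4)"
    by (auto simp: eventually_sequentially)
  define N where "N = max N0 N1"
  show ?thesis
  proof (rule that[of N])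
    show "N \<ge> 1" using N0 by (simp add: N_def)
    fix n a b c d e f g
    assume n: "n \<ge> N" and as: "balanced a b c d e f g"
       "norm a \<le> M" "norm b \<le> M" "norm c \<le> M" "norm d \<le> M" "norm e \<le> M" "norm f \<le> M" "norm g \<le> M"
    define t where "t = F43r_term a b c d e f g"
    show "norm (F43r_term a b c d e f g n) \<le> norm (F43r_term a b c d e f g N) * real N powr (5/4) * real n powr (-5/4)"
      unfolding t_def[symmetric] using n
    proof (induction n rule: dec_induct)
      case base
      show ?case using \<open>N \<ge> 1\<close> by (simp flip: powr_add add: mult.assoc)
    next
      case (step n)
      define D where "D = of_nat (Suc n) * (e + of_nat n) * (f + of_nat n) * (g + of_nat n)"
      have n0: "n \<ge> N0" "n \<ge> N1" "real n > 0" using step \<open>N \<ge> 1\<close> by (auto simp: N_def)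
      have D: "norm ((a + of_nat n) * (b + of_nat n) * (c + of_nat n) * (d + of_nat n)) \<le> (1 - 3 / (2 * real n)) * norm D" "D \<noteq> 0"
        unfolding D_def using N0(2)[OF n0(1) as] by auto
      have "norm (t (Suc n)) * norm D = norm ((a + of_nat n) * (b + of_nat n) * (c + of_nat n) * (d + of_nat n)) * norm (t n)"
        unfolding t_def D_def norm_mult[symmetric] F43r_term_Suc ..
      also have "\<dots> \<le> (1 - 3 / (2 * real n)) * norm D * norm (t n)"
        by (intro mult_right_mono D) auto
      finally have "norm (t (Suc n)) \<le> (1 - 3 / (2 * real n)) * norm (t n)"
        using D(2) by (simp add: mult_ac)
      also have "\<dots> \<le> (real n / real (Suc n)) powr (5/4) * norm (t n)"
        by (intro mult_right_mono N1 n0) auto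
      also have "\<dots> \<le> (real n / real (Suc n)) powr (5/4) * (norm (t N) * real N powr (5/4) * real n powr (-5/4))"
        using step by (intro mult_left_mono) auto
      also have "\<dots> = norm (t N) * real N powr (5/4) * real (Suc n) powr (-5/4)"
        using n0 by (simp add: powr_divide powr_minus field_simps flip: powr_add del: of_nat_Suc)
      finally show ?case .
    qed
  qed
qed

lemma F43r_summable:
  assumes "balanced a b c d e f g"
  shows "summable (F43r_term a b c d e f g)"
proof -
  define M where "M = 1 + norm a + norm b + norm c + norm d + norm e + norm f + norm g"
  have M: "M \<ge> 1" unfolding M_def by (smt (verit) norm_ge_zero)
  obtain N where N: "\<And>n a b c d e f g. n \<ge> N \<Longrightarrow> balanced a b c d e f g \<Longrightarrow>
      norm a \<le> M \<Longrightarrow> norm b \<le> M \<Longrightarrow> norm c \<le> M \<Longrightarrow> norm d \<le> M \<Longrightarrow> norm e \<le> M \<Longrightarrow> norm f \<le> M \<Longrightarrow> norm g \<le> M \<Longrightarrow>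
      norm (F43r_term a b c d e f g n) \<le> norm (F43r_term a b c d e f g N) * real N powr (5/4) * real n powr (-5/4)"
    by (rule F43r_term_bound[OF M]) blast
  show ?thesis
  proof (rule summable_comparison_test)
    show "\<exists>N'. \<forall>n\<ge>N'. norm (F43r_term a b c d e f g n) \<le> norm (F43r_term a b c d e f g N) * real N powr (5/4) * real n powr (-5/4)"
      using N assms unfolding M_def by (intro exI[of _ N] allI impI N) (auto simp: M_def add_increasing add_increasing2)
    show "summable (\<lambda>n. norm (F43r_term a b c d e f g N) * real N powr (5/4) * real n powr (-5/4))"
      by (intro summable_mult) (simp add: summable_real_powr_iff)
  qed
qed

lemma F43r_term_holomorphic [holomorphic_intros]:
  assumes "a holomorphic_on S" "b holomorphic_on S" "c holomorphic_on S" "d holomorphic_on S"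
    "e holomorphic_on S" "f holomorphic_on S" "g holomorphic_on S"
  shows "(\<lambda>s. F43r_term (a s) (b s) (c s) (d s) (e s) (f s) (g s) n) holomorphic_on S"
  unfolding F43r_term_def by (intro holomorphic_intros assms) auto

text \<open>On a closed disc the seven parameter functions are bounded by a common \<open>M\<close>,
  so one \<open>N\<close> serves for the whole disc and the tail is dominated by a multiple of
  \<open>n powr (-5/4)\<close>. The partial sums thus converge locally uniformly. One complex
  variable suffices since continuation proceeds along curves.\<close>

lemma F43r_holomorphic:
  assumes S: "open S"
    and hol: "a holomorphic_on S" "b holomorphic_on S" "c holomorphic_on S" "d holomorphic_on S"
    "e holomorphic_on S" "f holomorphic_on S" "g holomorphic_on S"
    and bal: "\<And>s. s \<in> S \<Longrightarrow> balanced (a s) (b s) (c s) (d s) (e s) (f s) (g s)"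
  shows "(\<lambda>s. F43r (a s) (b s) (c s) (d s) (e s) (f s) (g s)) holomorphic_on S"
proof (rule holomorphic_uniform_sequence[OF S])
  show "(\<lambda>s. \<Sum>i<n. F43r_term (a s) (b s) (c s) (d s) (e s) (f s) (g s) i) holomorphic_on S" for n
    by (intro holomorphic_intros hol)
next
  fix x assume "x \<in> S"
  then obtain r where r: "r > 0" "cball x r \<subseteq> S" using S open_contains_cball by blast
  have bd: "\<exists>M. \<forall>s\<in>cball x r. norm (h s) \<le> M" if "h holomorphic_on S" for h :: "complex \<Rightarrow> complex"
  proof -
    have "continuous_on (cball x r) h" using that r(2) holomorphic_on_imp_continuous_on continuous_on_subset by blast
    then have "bounded (h ` cball x r)" using compact_continuous_image compact_imp_bounded compact_cball by blast
    then show ?thesis by (auto simp: bounded_iff)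
  qed
  obtain Ma where Ma: "\<And>s. s \<in> cball x r \<Longrightarrow> norm (a s) \<le> Ma" using bd[OF hol(1)] by blast
  obtain Mb where Mb: "\<And>s. s \<in> cball x r \<Longrightarrow> norm (b s) \<le> Mb" using bd[OF hol(2)] by blast
  obtain Mc where Mc: "\<And>s. s \<in> cball x r \<Longrightarrow> norm (c s) \<le> Mc" using bd[OF hol(3)] by blast
  obtain Md where Md: "\<And>s. s \<in> cball x r \<Longrightarrow> norm (d s) \<le> Md" using bd[OF hol(4)] by blast
  obtain Me where Me: "\<And>s. s \<in> cball x r \<Longrightarrow> norm (e s) \<le> Me" using bd[OF hol(5)] by blast
  obtain Mf where Mf: "\<And>s. s \<in> cball x r \<Longrightarrow> norm (f s) \<le> Mf" using bd[OF hol(6)] by blast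
  obtain Mg where Mg: "\<And>s. s \<in> cball x r \<Longrightarrow> norm (g s) \<le> Mg" using bd[OF hol(7)] by blast
  note MM = Ma Mb Mc Md Me Mf Mg
  define M where "M = Max {1, Ma, Mb, Mc, Md, Me, Mf, Mg}"
  have M: "M \<ge> 1" "Ma \<le> M" "Mb \<le> M" "Mc \<le> M" "Md \<le> M" "Me \<le> M" "Mf \<le> M" "Mg \<le> M"
    unfolding M_def by (rule Max_ge; simp)+
  obtain N where N: "\<And>n a b c d e f g. n \<ge> N \<Longrightarrow> balanced a b c d e f g \<Longrightarrow>
      norm a \<le> M \<Longrightarrow> norm b \<le> M \<Longrightarrow> norm c \<le> M \<Longrightarrow> norm d \<le> M \<Longrightarrow> norm e \<le> M \<Longrightarrow> norm f \<le> M \<Longrightarrow> norm g \<le> M \<Longrightarrow>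
      norm (F43r_term a b c d e f g n) \<le> norm (F43r_term a b c d e f g N) * real N powr (5/4) * real n powr (-5/4)"
    by (rule F43r_term_bound[OF M(1)]) blast
  obtain B where B: "\<And>s. s \<in> cball x r \<Longrightarrow> norm (F43r_term (a s) (b s) (c s) (d s) (e s) (f s) (g s) N) \<le> B"
    using bd[OF F43r_term_holomorphic[OF hol]] by blast
  have "uniform_limit (cball x r) (\<lambda>n s. \<Sum>i<n. F43r_term (a s) (b s) (c s) (d s) (e s) (f s) (g s) i)
     (\<lambda>s. \<Sum>i. F43r_term (a s) (b s) (c s) (d s) (e s) (f s) (g s) i) sequentially"
  proof (rule Weierstrass_m_test_ev)
    show "\<forall>\<^sub>F n in sequentially. \<forall>s\<in>cball x r. norm (F43r_term (a s) (b s) (c s) (d s) (e s) (f s) (g s) n) \<le> B * real N powr (5/4) * real n powr (-5/4)"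
      unfolding eventually_sequentially
    proof (intro exI[of _ N] allI impI ballI)
      fix n s assume n: "n \<ge> N" and s: "s \<in> cball x r"
      have "norm (F43r_term (a s) (b s) (c s) (d s) (e s) (f s) (g s) n)
         \<le> norm (F43r_term (a s) (b s) (c s) (d s) (e s) (f s) (g s) N) * real N powr (5/4) * real n powr (-5/4)"
        using MM[OF s] M r s by (intro N n bal) auto
      also have "\<dots> \<le> B * real N powr (5/4) * real n powr (-5/4)"
        using B[OF s] by (intro mult_right_mono) auto
      finally show "norm (F43r_term (a s) (b s) (c s) (d s) (e s) (f s) (g s) n) \<le> B * real N powr (5/4) * real n powr (-5/4)" .
    qed
    show "summable (\<lambda>n. B * real N powr (5/4) * real n powr (-5/4))"
      by (intro summable_mult) (simp add: summable_real_powr_iff)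
  qed
  then show "\<exists>r>0. cball x r \<subseteq> S \<and> uniform_limit (cball x r) (\<lambda>n s. \<Sum>i<n. F43r_term (a s) (b s) (c s) (d s) (e s) (f s) (g s) i)
     (\<lambda>s. F43r (a s) (b s) (c s) (d s) (e s) (f s) (g s)) sequentially"
    using r unfolding F43r_def by blast
qed

section \<open>The integral representation\<close>

definition F43_real :: "real \<Rightarrow> real \<Rightarrow> real \<Rightarrow> real \<Rightarrow> real \<Rightarrow> real \<Rightarrow> real \<Rightarrow> real" where
  "F43_real a b c d e f g =
    (\<Sum>n. pochhammer a n * pochhammer b n * pochhammer c n * pochhammer d n /
          (fact n * pochhammer e n * pochhammer f n * pochhammer g n))"

lemma F43r_of_real:
  fixes a b c d e f g :: real
  assumes pos: "e > 0" "f > 0" "g > 0" and bal: "e + f + g - a - b - c - d = 1"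
  shows "F43r a b c d e f g = of_real (rGamma e * rGamma f * rGamma g * F43_real a b c d e f g)"
    and "summable (\<lambda>n. pochhammer a n * pochhammer b n * pochhammer c n * pochhammer d n /
          (fact n * pochhammer e n * pochhammer f n * pochhammer g n))"
proof -
  define t where "t n = pochhammer a n * pochhammer b n * pochhammer c n * pochhammer d n /
          (fact n * pochhammer e n * pochhammer f n * pochhammer g n)" for n
  define r where "r = rGamma e * rGamma f * rGamma g"
  have nz: "rGamma x \<noteq> 0" if "x > 0" for x :: real
    using that Gamma_real_pos[OF that] by (auto simp: Gamma_def)
  have r: "r \<noteq> 0" unfolding r_def using pos nz by auto
  have rg: "rGamma (x + of_nat n) = rGamma x / pochhammer x n" if "x > 0" for x :: real and n
    using pochhammer_rGamma[of x n] pochhammer_pos[OF that, of n] by (simp add: field_simps)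
  have rgc: "rGamma (complex_of_real x + of_nat n) = of_real (rGamma (x + of_nat n))" for x n
    using rGamma_complex_of_real[of "x + of_nat n"] by simp
  have T: "F43r_term a b c d e f g n = of_real (r * t n)" for n
  proof -
    have "F43r_term a b c d e f g n = of_real (pochhammer a n * pochhammer b n * pochhammer c n * pochhammer d n
     * (rGamma (e + of_nat n) * rGamma (f + of_nat n) * rGamma (g + of_nat n)) / fact n)"
      unfolding F43r_term_def by (simp add: pochhammer_of_real rgc)
    also have "pochhammer a n * pochhammer b n * pochhammer c n * pochhammer d n
     * (rGamma (e + of_nat n) * rGamma (f + of_nat n) * rGamma (g + of_nat n)) / fact n = r * t n"
      using pos by (simp add: rg r_def t_def mult_ac)
    finally show ?thesis .
  qed
  have "balanced a b c d e f g"
    unfolding balanced_def using arg_cong[OF bal, of complex_of_real] by simp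
  then have "summable (\<lambda>n. complex_of_real (r * t n))"
    using F43r_summable[of a b c d e f g] unfolding T[abs_def] by simp
  then have s: "summable (\<lambda>n. r * t n)" by (simp only: summable_complex_of_real)
  then show "summable t" using r by (simp add: summable_cmult_iff)
  have "F43r a b c d e f g = of_real (\<Sum>n. r * t n)"
    unfolding F43r_def T[abs_def] using s by (simp only: suminf_of_real)
  also have "(\<Sum>n. r * t n) = r * F43_real a b c d e f g"
    unfolding F43_real_def t_def[symmetric] using \<open>summable t\<close> by (rule suminf_mult)
  finally show "F43r a b c d e f g = of_real (r * F43_real a b c d e f g)" .
qed

text \<open>Expanding the second factor in powers of \<open>t\<close> raises \<open>s\<close> by
  \<open>n\<close> in the moment formula, and the resulting Gamma quotients are the Pochhammer
  symbols of a 4F3. The condition \<open>E + C - A - B = 1\<close> says that this 4F3 is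
  balanced.\<close>

lemma nn_integral_F21_product:
  fixes p q C A B E s :: real
  assumes pos: "p > 0" "q > 0" "C > 0" "A > 0" "B > 0" "E > 0" "s > 0"
    and s1: "C + s - p - q > 0" and bal: "E + C - A - B = 1"
  shows "(\<integral>\<^sup>+t. ennreal (indicator {0<..<1} t * (t powr (s - 1) * (1 - t) powr (C - 1) * F21 p q C (1 - t) * F21 A B E t)) \<partial>lborel)
    = ennreal (Gamma C * Gamma s * Gamma (C + s - p - q) / (Gamma (C + s - p) * Gamma (C + s - q))
        * F43_real A B s (C + s - p - q) E (C + s - p) (C + s - q))"
proof -
  define d where "d = C + s - p - q"
  define f where "f = C + s - p"
  define g where "g = C + s - q"
  have pos': "d > 0" "f > 0" "g > 0" using s1 pos by (auto simp: d_def f_def g_def)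
  define K where "K = Gamma C * Gamma s * Gamma d / (Gamma f * Gamma g)"
  have K: "K \<ge> 0" unfolding K_def using pos pos' by (intro divide_nonneg_nonneg mult_nonneg_nonneg) (auto intro!: Gamma_real_pos less_imp_le)
  define t where "t n = pochhammer A n * pochhammer B n * pochhammer s n * pochhammer d n /
          (fact n * pochhammer E n * pochhammer f n * pochhammer g n)" for n
  have G: "Gamma (x + real n) = Gamma x * pochhammer x n" if "x > 0" for x :: real and n
  proof -
    have "x \<notin> \<int>\<^sub>\<le>\<^sub>0" using that by (auto elim!: nonpos_Ints_cases)
    moreover have "Gamma x > 0" using that by (rule Gamma_real_pos)
    ultimately show ?thesis by (simp add: pochhammer_Gamma)
  qed
  have t0: "t n \<ge> 0" for n
    unfolding t_def using pos pos' by (intro divide_nonneg_nonneg mult_nonneg_nonneg pochhammer_nonneg) auto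
  define w where "w t = t powr (s - 1) * (1 - t) powr (C - 1) * F21 p q C (1 - t)" for t
  have mF: "(\<lambda>t. F21 p q C (1 - t)) \<in> borel_measurable borel"
    unfolding F21_def by measurable
  have mw: "w \<in> borel_measurable borel" unfolding w_def using mF by measurable
  have w0: "w t \<ge> 0" if "0 < t" "t < 1" for t
    unfolding w_def using that pos by (intro mult_nonneg_nonneg F21_nonneg) auto
  have "(\<integral>\<^sup>+t. ennreal (indicator {0<..<1} t * (w t * F21 A B E t)) \<partial>lborel)
    = (\<Sum>n. ennreal (hyp_coeff A B E n) * (\<integral>\<^sup>+t. ennreal (indicator {0<..<1} t * (w t * t ^ n)) \<partial>lborel))"
    unfolding F21_def[of A B E] using pos w0 mw
    by (intro nn_integral_powser) (auto intro!: hyp_coeff_pos[THEN less_imp_le] summable_F21)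
  also have "(\<lambda>n. \<integral>\<^sup>+t. ennreal (indicator {0<..<1} t * (w t * t ^ n)) \<partial>lborel)
     = (\<lambda>n. ennreal (Gamma C * Gamma (s + real n) * Gamma (d + real n) / (Gamma (f + real n) * Gamma (g + real n))))"
  proof
    fix n
    have "(\<integral>\<^sup>+t. ennreal (indicator {0<..<1} t * (w t * t ^ n)) \<partial>lborel)
      = (\<integral>\<^sup>+t. ennreal (indicator {0<..<1} t * (t powr ((s + n) - 1) * (1 - t) powr (C - 1) * F21 p q C (1 - t))) \<partial>lborel)"
      by (intro nn_integral_cong arg_cong[where f = ennreal])
         (auto simp: indicator_def w_def powr_realpow[symmetric] powr_diff powr_add)
    also have "\<dots> = ennreal (Gamma C * Gamma (s + n) * Gamma (C + (s + n) - p - q) / (Gamma (C + (s + n) - p) * Gamma (C + (s + n) - q)))"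
      using pos s1 by (intro nn_integral_F21_moment) auto
    also have "\<dots> = ennreal (Gamma C * Gamma (s + n) * Gamma (d + n) / (Gamma (f + n) * Gamma (g + n)))"
      by (simp add: d_def f_def g_def algebra_simps)
    finally show "(\<integral>\<^sup>+t. ennreal (indicator {0<..<1} t * (w t * t ^ n)) \<partial>lborel)
       = ennreal (Gamma C * Gamma (s + real n) * Gamma (d + real n) / (Gamma (f + real n) * Gamma (g + real n)))" .
  qed
  also have "(\<lambda>n. ennreal (hyp_coeff A B E n) * ennreal (Gamma C * Gamma (s + real n) * Gamma (d + real n) / (Gamma (f + real n) * Gamma (g + real n))))
     = (\<lambda>n. ennreal (K * t n))"
  proof
    fix n
    have "hyp_coeff A B E n * (Gamma C * Gamma (s + real n) * Gamma (d + real n) / (Gamma (f + real n) * Gamma (g + real n))) = K * t n"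
      using pos pos' by (simp add: G K_def t_def hyp_coeff_def mult_ac)
    then show "ennreal (hyp_coeff A B E n) * ennreal (Gamma C * Gamma (s + real n) * Gamma (d + real n) / (Gamma (f + real n) * Gamma (g + real n))) = ennreal (K * t n)"
      using hyp_coeff_pos[of A B E n] pos by (simp flip: ennreal_mult')
  qed
  also have "(\<Sum>n. ennreal (K * t n)) = ennreal (K * F43_real A B s d E f g)"
  proof (intro suminf_ennreal_eq sums_mult)
    show "t sums F43_real A B s d E f g"
      unfolding F43_real_def t_def[abs_def]
      using F43r_of_real(2)[of E f g A B s d] pos pos' bal by (intro summable_sums) (auto simp: d_def f_def g_def)
    show "K * t n \<ge> 0" for n using K t0 by simp
  qed
  finally show ?thesis by (simp add: w_def K_def d_def f_def g_def)
qed

text \<open>\<open>L\<close> with the Gamma factors of the lower parameters absorbed into the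
  regularised series, so that only integral \<open>e\<close> remains singular.\<close>

definition Lr :: "complex \<Rightarrow> complex \<Rightarrow> complex \<Rightarrow> complex \<Rightarrow> complex \<Rightarrow> complex \<Rightarrow> complex \<Rightarrow> complex" where
  "Lr a b c d e f g =
    (F43r a b c d e f g * (rGamma (1 + a - e) * rGamma (1 + b - e) * rGamma (1 + c - e) * rGamma (1 + d - e))
     - F43r (1 + a - e) (1 + b - e) (1 + c - e) (1 + d - e) (2 - e) (1 + f - e) (1 + g - e)
       * (rGamma a * rGamma b * rGamma c * rGamma d)) / sin (of_real pi * e)"

text \<open>Bookkeeping of Gamma values with opaque names: \<open>Gx\<close> stands for Gamma of the
  parameter \<open>x\<close>, \<open>Hx\<close> for Gamma of \<open>1 + x - e\<close>, except that
  \<open>He\<close> is the value at \<open>1 - e\<close>; \<open>u\<close> is \<open>1 - e\<close>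
  and \<open>k\<close> is \<open>pi\<close>.\<close>

lemma Lr_integral_aux:
  assumes "Ga \<noteq> 0" "Gb \<noteq> 0" "Gc \<noteq> 0" "Gd \<noteq> 0" "Ge \<noteq> 0" "Gf \<noteq> 0" "Gg \<noteq> 0" "GC \<noteq> 0"
    "Ha \<noteq> 0" "Hb \<noteq> 0" "Hc \<noteq> 0" "Hd \<noteq> 0" "He \<noteq> 0" "Hf \<noteq> 0" "Hg \<noteq> 0" "u \<noteq> 0" "k \<noteq> (0::real)"
  shows "(1 / Ge * (1 / Gf) * (1 / Gg) * s1 * (1 / Ha * (1 / Hb) * (1 / Hc) * (1 / Hd))
     - 1 / (u * He) * (1 / Hf) * (1 / Hg) * s2 * (1 / Ga * (1 / Gb) * (1 / Gc) * (1 / Gd))) * (Ge * He / k)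
   = (GC * He / (Ha * Hb) * (GC * Gc * Gd / (Gf * Gg) * s1) - GC * Ge / (u * Ga * Gb) * (GC * Hc * Hd / (Hf * Hg) * s2))
     / (k * GC^2 * Gc * Gd * Hc * Hd)"
proof -
  have "1 / Ge * (1 / Gf) * (1 / Gg) * s1 * (1 / Ha * (1 / Hb) * (1 / Hc) * (1 / Hd)) * (Ge * He / k)
    = GC * He / (Ha * Hb) * (GC * Gc * Gd / (Gf * Gg) * s1) / (k * GC^2 * Gc * Gd * Hc * Hd)"
    using assms by (simp add: power2_eq_square divide_simps)
  moreover have "1 / (u * He) * (1 / Hf) * (1 / Hg) * s2 * (1 / Ga * (1 / Gb) * (1 / Gc) * (1 / Gd)) * (Ge * He / k)
    = GC * Ge / (u * Ga * Gb) * (GC * Hc * Hd / (Hf * Hg) * s2) / (k * GC^2 * Gc * Gd * Hc * Hd)"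
    using assms by (simp add: power2_eq_square divide_simps)
  ultimately show ?thesis by (simp only: left_diff_distrib diff_divide_distrib)
qed

text \<open>The two terms of the connection formula match the two series in \<open>L\<close>: the
  factor \<open>t powr (1 - e)\<close> moves the exponent parameter \<open>c\<close> to
  \<open>1 + c - e\<close> and thus produces the series with parameters
  \<open>1 + x - e\<close>.\<close>

lemma Lr_integral:
  fixes a b c d e f g :: real
  assumes bal: "e + f + g - a - b - c - d = 1"
    and pos: "a > 0" "b > 0" "c > 0" "f > d" "g > d" and e: "0 < e" "e < 1" and dc: "c < d" and C0: "1 + a + b - e > 0"
  defines "C \<equiv> 1 + a + b - e"
  shows "Lr a b c d e f g = of_real (enn2real (\<integral>\<^sup>+t. ennreal (indicator {0<..<1} t *
      (t powr (c - 1) * (1 - t) powr (C - 1) * F21 (f - d) (g - d) C (1 - t) * F21 a b C (1 - t))) \<partial>lborel)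
      / (pi * Gamma C ^ 2 * Gamma c * Gamma d * Gamma (1 + c - e) * Gamma (1 + d - e)))"
proof -
  define p where "p = f - d"
  define q where "q = g - d"
  define \<alpha> where "\<alpha> = Gamma C * Gamma (1 - e) / (Gamma (1 + a - e) * Gamma (1 + b - e))"
  define \<kappa> where "\<kappa> = Gamma C * Gamma e / ((1 - e) * Gamma a * Gamma b)"
  define w where "w t = t powr (c - 1) * (1 - t) powr (C - 1) * F21 p q C (1 - t)" for t
  define I1 where "I1 = Gamma C * Gamma c * Gamma d / (Gamma f * Gamma g) * F43_real a b c d e f g"
  define I2 where "I2 = Gamma C * Gamma (1 + c - e) * Gamma (1 + d - e) / (Gamma (1 + f - e) * Gamma (1 + g - e))
     * F43_real (1 + a - e) (1 + b - e) (1 + c - e) (1 + d - e) (2 - e) (1 + f - e) (1 + g - e)"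
  define J where "J = (\<integral>\<^sup>+t. ennreal (indicator {0<..<1} t * (w t * F21 a b C (1 - t))) \<partial>lborel)"
  have pos': "C > 0" "d > 0" "f > 0" "g > 0" "p > 0" "q > 0" "1 + a - e > 0" "1 + b - e > 0" "1 + c - e > 0" "1 + d - e > 0"
     "1 + f - e > 0" "1 + g - e > 0" "2 - e > 0" "1 - e > 0"
    using pos e dc C0 by (auto simp: C_def p_def q_def)
  have Gp: "Gamma x > 0" if "x > 0" for x :: real using that by (rule Gamma_real_pos)
  note Gs = pos'[THEN Gp] pos(1-3)[THEN Gp] e(1)[THEN Gp]
  have w0: "w t \<ge> 0" if "0 < t" "t < 1" for t
    unfolding w_def using that pos' by (intro mult_nonneg_nonneg F21_nonneg) auto
  have F0: "F21 x y z t \<ge> 0" if "x > 0" "y > 0" "z > 0" "0 < t" "t < 1" for x y z t using that by (intro F21_nonneg) auto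
  have mF: "(\<lambda>t. F21 x y z (1 - t)) \<in> borel_measurable borel" "F21 x y z \<in> borel_measurable borel" for x y z
    unfolding F21_def[abs_def] by measurable
  have mw: "w \<in> borel_measurable borel" unfolding w_def using mF by measurable
  have m: "(\<lambda>t. indicator {0<..<1} t * (w t * F21 a b C (1 - t))) \<in> borel_measurable borel"
     "(\<lambda>t. indicator {0<..<1} t * (w t * (t powr (1 - e) * F21 (1 + a - e) (1 + b - e) (2 - e) t))) \<in> borel_measurable borel"
     "(\<lambda>t. indicator {0<..<1} t * (w t * F21 a b e t)) \<in> borel_measurable borel"
    using mF mw by measurable
  have E1: "(\<integral>\<^sup>+t. ennreal (indicator {0<..<1} t * (w t * F21 a b e t)) \<partial>lborel) = ennreal I1"
  proof -
    \<comment> \<open>Balance turns \<open>C + c - p\<close> into \<open>g\<close>, not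
      \<open>f\<close>, so the last two lower parameters come out interchanged.\<close>
    have eqs: "g - q = d" "C + c - p = g" "C + c - q = f"
      using bal by (auto simp: p_def q_def C_def)
    have "F43_real a b c d e g f = F43_real a b c d e f g" by (simp add: F43_real_def mult_ac)
    moreover have "(\<integral>\<^sup>+t. ennreal (indicator {0<..<1} t * (w t * F21 a b e t)) \<partial>lborel)
      = ennreal (Gamma C * Gamma c * Gamma d / (Gamma g * Gamma f) * F43_real a b c d e g f)"
      unfolding w_def
      by (rule nn_integral_F21_product[of p q C a b e c, unfolded eqs]) (use pos pos' e in \<open>auto simp: C_def\<close>)
    ultimately show ?thesis by (simp add: I1_def mult.commute)
  qed
  have E2: "(\<integral>\<^sup>+t. ennreal (indicator {0<..<1} t * (w t * (t powr (1 - e) * F21 (1 + a - e) (1 + b - e) (2 - e) t))) \<partial>lborel) = ennreal I2"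
  proof -
    have "(\<integral>\<^sup>+t. ennreal (indicator {0<..<1} t * (w t * (t powr (1 - e) * F21 (1 + a - e) (1 + b - e) (2 - e) t))) \<partial>lborel)
      = (\<integral>\<^sup>+t. ennreal (indicator {0<..<1} t * (t powr ((1 + c - e) - 1) * (1 - t) powr (C - 1) * F21 p q C (1 - t) * F21 (1 + a - e) (1 + b - e) (2 - e) t)) \<partial>lborel)"
      by (intro nn_integral_cong arg_cong[where f = ennreal])
         (auto simp: indicator_def w_def powr_diff powr_add mult_ac)
    also have "\<dots> = ennreal (Gamma C * Gamma (1 + c - e) * Gamma (C + (1 + c - e) - p - q) / (Gamma (C + (1 + c - e) - p) * Gamma (C + (1 + c - e) - q))
        * F43_real (1 + a - e) (1 + b - e) (1 + c - e) (C + (1 + c - e) - p - q) (2 - e) (C + (1 + c - e) - p) (C + (1 + c - e) - q))"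
      using pos pos' e dc bal by (intro nn_integral_F21_product) (auto simp: p_def q_def C_def)
    also have "\<dots> = ennreal I2"
    proof -
      have eqs: "1 + g - e - q = 1 + d - e" "C + (1 + c - e) - p = 1 + g - e" "C + (1 + c - e) - q = 1 + f - e"
        using bal by (auto simp: p_def q_def C_def)
      have "F43_real (1 + a - e) (1 + b - e) (1 + c - e) (1 + d - e) (2 - e) (1 + g - e) (1 + f - e)
         = F43_real (1 + a - e) (1 + b - e) (1 + c - e) (1 + d - e) (2 - e) (1 + f - e) (1 + g - e)"
        by (simp add: F43_real_def mult_ac)
      then show ?thesis unfolding eqs I2_def by (simp add: mult.commute)
    qed
    finally show ?thesis .
  qed
  have \<kappa>0: "\<kappa> \<ge> 0" and \<alpha>0: "\<alpha> \<ge> 0" unfolding \<kappa>_def \<alpha>_def using Gs e by (auto intro!: divide_nonneg_nonneg mult_nonneg_nonneg)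
  have I0: "I1 \<ge> 0" "I2 \<ge> 0"
  proof -
    have "F43_real A B X D E F G \<ge> 0" if "A > 0" "B > 0" "X > 0" "D > 0" "E > 0" "F > 0" "G > 0" "E + F + G - A - B - X - D = 1" for A B X D E F G
      unfolding F43_real_def using that F43r_of_real(2)[of E F G A B X D]
      by (intro suminf_nonneg) (auto intro!: divide_nonneg_nonneg mult_nonneg_nonneg pochhammer_nonneg)
    then show "I1 \<ge> 0" "I2 \<ge> 0" unfolding I1_def I2_def using Gs pos pos' e bal
      by (auto intro!: mult_nonneg_nonneg divide_nonneg_nonneg)
  qed
  \<comment> \<open>Stated as a sum, because subtraction in \<open>ennreal\<close> is not safe while
    \<open>J\<close> could still be infinite. The finite right-hand side then yields finiteness of
    \<open>J\<close>.\<close>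
  have "J + ennreal \<kappa> * ennreal I2 = ennreal \<alpha> * ennreal I1"
  proof -
    have "J + ennreal \<kappa> * ennreal I2 = (\<integral>\<^sup>+t. ennreal (indicator {0<..<1} t * (w t * F21 a b C (1 - t)))
       + ennreal \<kappa> * ennreal (indicator {0<..<1} t * (w t * (t powr (1 - e) * F21 (1 + a - e) (1 + b - e) (2 - e) t))) \<partial>lborel)"
      unfolding J_def E2[symmetric] using m by (subst nn_integral_add) (auto simp: nn_integral_cmult)
    also have "\<dots> = (\<integral>\<^sup>+t. ennreal \<alpha> * ennreal (indicator {0<..<1} t * (w t * F21 a b e t)) \<partial>lborel)"
    proof (intro nn_integral_cong)
      fix t :: real
      show "ennreal (indicator {0<..<1} t * (w t * F21 a b C (1 - t)))
       + ennreal \<kappa> * ennreal (indicator {0<..<1} t * (w t * (t powr (1 - e) * F21 (1 + a - e) (1 + b - e) (2 - e) t)))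
       = ennreal \<alpha> * ennreal (indicator {0<..<1} t * (w t * F21 a b e t))"
      proof (cases "0 < t \<and> t < 1")
        case True
        have "w t * F21 a b C (1 - t) + \<kappa> * (w t * (t powr (1 - e) * F21 (1 + a - e) (1 + b - e) (2 - e) t)) = \<alpha> * (w t * F21 a b e t)"
          using arg_cong[OF F21_connection[of a b e t], of "\<lambda>x. w t * x"] pos e True
          unfolding \<alpha>_def \<kappa>_def C_def by (simp add: algebra_simps)
        moreover have "ennreal (w t * F21 a b C (1 - t)) + ennreal \<kappa> * ennreal (w t * (t powr (1 - e) * F21 (1 + a - e) (1 + b - e) (2 - e) t))
           = ennreal (w t * F21 a b C (1 - t) + \<kappa> * (w t * (t powr (1 - e) * F21 (1 + a - e) (1 + b - e) (2 - e) t)))"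
          using \<kappa>0 w0 F0 True pos pos' by (simp add: ennreal_plus ennreal_mult')
        ultimately show ?thesis using True \<alpha>0 by (simp add: ennreal_mult')
      qed auto
    qed
    also have "\<dots> = ennreal \<alpha> * ennreal I1"
      unfolding E1[symmetric] using m by (subst nn_integral_cmult) auto
    finally show ?thesis .
  qed
  then have JJ: "J + ennreal (\<kappa> * I2) = ennreal (\<alpha> * I1)" using \<kappa>0 \<alpha>0 I0 by (simp add: ennreal_mult')
  then have "J \<noteq> top_class.top" by (metis ennreal_add_eq_top ennreal_neq_top)
  then have "J = ennreal (enn2real J)" by (simp add: less_top)
  with JJ have "ennreal (enn2real J + \<kappa> * I2) = ennreal (\<alpha> * I1)" using \<kappa>0 I0 by (simp add: ennreal_plus)
  then have J: "enn2real J = \<alpha> * I1 - \<kappa> * I2"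
    using \<kappa>0 \<alpha>0 I0 by (subst (asm) ennreal_inj) auto
  define s1 where "s1 = F43_real a b c d e f g"
  define s2 where "s2 = F43_real (1 + a - e) (1 + b - e) (1 + c - e) (1 + d - e) (2 - e) (1 + f - e) (1 + g - e)"
  have R1: "F43r a b c d e f g = of_real (rGamma e * rGamma f * rGamma g * s1)"
    unfolding s1_def using pos pos' e bal by (intro F43r_of_real) auto
  have R2: "F43r (1 + of_real a - of_real e) (1 + of_real b - of_real e) (1 + of_real c - of_real e) (1 + of_real d - of_real e) (2 - of_real e) (1 + of_real f - of_real e) (1 + of_real g - of_real e)
     = of_real (rGamma (2 - e) * rGamma (1 + f - e) * rGamma (1 + g - e) * s2)"
    using F43r_of_real(1)[of "2 - e" "1 + f - e" "1 + g - e" "1 + a - e" "1 + b - e" "1 + c - e" "1 + d - e"] pos' bal by (simp add: s2_def)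
  have rg: "rGamma (1 + complex_of_real x - of_real e) = of_real (rGamma (1 + x - e))" for x
    by (simp flip: rGamma_complex_of_real)
  have sn: "sin (complex_of_real pi * of_real e) = of_real (sin (pi * e))"
    by (simp only: sin_of_real flip: of_real_mult)
  have "Lr a b c d e f g = of_real ((rGamma e * rGamma f * rGamma g * s1 * (rGamma (1 + a - e) * rGamma (1 + b - e) * rGamma (1 + c - e) * rGamma (1 + d - e))
     - rGamma (2 - e) * rGamma (1 + f - e) * rGamma (1 + g - e) * s2 * (rGamma a * rGamma b * rGamma c * rGamma d)) / sin (pi * e))"
    unfolding Lr_def R1 R2 rg sn rGamma_complex_of_real by simp
  also have "(rGamma e * rGamma f * rGamma g * s1 * (rGamma (1 + a - e) * rGamma (1 + b - e) * rGamma (1 + c - e) * rGamma (1 + d - e))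
     - rGamma (2 - e) * rGamma (1 + f - e) * rGamma (1 + g - e) * s2 * (rGamma a * rGamma b * rGamma c * rGamma d)) / sin (pi * e)
     = enn2real J / (pi * Gamma C ^ 2 * Gamma c * Gamma d * Gamma (1 + c - e) * Gamma (1 + d - e))"
  proof -
    have "Gamma (1 - complex_of_real e) = of_real (Gamma (1 - e))"
      using Gamma_complex_of_real[of "1 - e"] by simp
    then have "complex_of_real (Gamma e * Gamma (1 - e)) = of_real (pi / sin (pi * e))"
      using Gamma_reflection_complex[of "of_real e"] by (simp add: sn Gamma_complex_of_real)
    then have "Gamma e * Gamma (1 - e) = pi / sin (pi * e)"
      by (simp only: of_real_eq_iff)
    \<comment> \<open>The reflection formula replaces the sine by
      \<open>Gamma e * Gamma (1 - e)\<close>; this is where the factor \<open>pi\<close> comes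
      from.\<close>
    then have sn: "1 / sin (pi * e) = Gamma e * Gamma (1 - e) / pi"
      by simp
    have G2: "Gamma (2 - e) = (1 - e) * Gamma (1 - e)"
      using Gamma_plus1[of "1 - e"] pos'(14) by (force elim!: nonpos_Ints_cases simp: add.commute)
    have rG: "rGamma x = 1 / Gamma x" for x :: real by (simp add: rGamma_inverse_Gamma divide_inverse)
    have *: "X / sin (pi * e) = X * (Gamma e * Gamma (1 - e) / pi)" for X using sn by (simp add: divide_inverse)
    have nz: "Gamma C \<noteq> 0" "Gamma a \<noteq> 0" "Gamma b \<noteq> 0" "Gamma c \<noteq> 0" "Gamma d \<noteq> 0" "Gamma e \<noteq> 0" "Gamma f \<noteq> 0" "Gamma g \<noteq> 0"
      "Gamma (1 + a - e) \<noteq> 0" "Gamma (1 + b - e) \<noteq> 0" "Gamma (1 + c - e) \<noteq> 0" "Gamma (1 + d - e) \<noteq> 0"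
      "Gamma (1 + f - e) \<noteq> 0" "Gamma (1 + g - e) \<noteq> 0" "Gamma (1 - e) \<noteq> 0"
      by (fact Gs[THEN less_imp_neq, THEN not_sym])+
    have nz': "1 - e \<noteq> 0" "pi \<noteq> 0" using e by auto
    show ?thesis
      unfolding * J \<alpha>_def \<kappa>_def I1_def I2_def s1_def[symmetric] s2_def[symmetric] rG G2
      by (intro Lr_integral_aux nz nz')
  qed
  finally show ?thesis unfolding J_def w_def p_def q_def by (simp add: mult.assoc)
qed

text \<open>The new parameters are those for which \<open>f - d, g - d\<close> and
  \<open>a, b\<close> change places in the integrand while \<open>c\<close> and \<open>C\<close>
  stay; this forces \<open>e\<close> to become \<open>1 + c - d\<close>. The four remaining Gamma
  factors are only permuted. The bounds on \<open>d\<close> say that the new \<open>e\<close> again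
  lies strictly between 0 and 1.\<close>

lemma Lr_swap_real:
  fixes a b c d e f g :: real
  assumes bal: "e + f + g - a - b - c - d = 1"
    and pos: "a > 0" "b > 0" "c > 0" "f > d" "g > d" and e: "0 < e" "e < 1" and dc: "c < d" "d < c + 1"
  shows "Lr a b c d e f g = Lr (f - d) (g - d) c (1 + c - e) (1 + c - d) (1 + a + c - e) (1 + b + c - e)"
proof -
  have C: "1 + (f - d) + (g - d) - (1 + c - d) = 1 + a + b - e" using bal by simp
  have [simp]: "1 + c - (1 + c - d) = d" "1 + (1 + c - e) - (1 + c - d) = 1 + d - e"
     "1 + a + c - e - (1 + c - e) = a" "1 + b + c - e - (1 + c - e) = b" by auto
  have "Lr (complex_of_real (f - d)) (complex_of_real (g - d)) c (complex_of_real (1 + c - e)) (complex_of_real (1 + c - d)) (complex_of_real (1 + a + c - e)) (complex_of_real (1 + b + c - e)) =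
    of_real (enn2real (\<integral>\<^sup>+t. ennreal (indicator {0<..<1} t *
      (t powr (c - 1) * (1 - t) powr (1 + a + b - e - 1) * F21 a b (1 + a + b - e) (1 - t) * F21 (f - d) (g - d) (1 + a + b - e) (1 - t))) \<partial>lborel)
      / (pi * Gamma (1 + a + b - e) ^ 2 * Gamma c * Gamma (1 + c - e) * Gamma d * Gamma (1 + d - e)))"
    using Lr_integral[of "1 + c - d" "1 + a + c - e" "1 + b + c - e" "f - d" "g - d" c "1 + c - e", unfolded C] assms by (simp add: add_diff_eq)
  moreover have "Lr a b c d e f g = of_real (enn2real (\<integral>\<^sup>+t. ennreal (indicator {0<..<1} t *
      (t powr (c - 1) * (1 - t) powr (1 + a + b - e - 1) * F21 (f - d) (g - d) (1 + a + b - e) (1 - t) * F21 a b (1 + a + b - e) (1 - t))) \<partial>lborel)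
      / (pi * Gamma (1 + a + b - e) ^ 2 * Gamma c * Gamma d * Gamma (1 + c - e) * Gamma (1 + d - e)))"
    using assms by (intro Lr_integral) auto
  ultimately show ?thesis by (simp add: mult_ac)
qed

section \<open>The action on fifth rows\<close>

lemma forall_7: "(\<forall>i::7. P i) \<longleftrightarrow> P 1 \<and> P 2 \<and> P 3 \<and> P 4 \<and> P 5 \<and> P 6 \<and> P 7"
  using UNIV_7 by (metis UNIV_I empty_iff insert_iff)

lemma vector_7_eq_iff:
  "(vector [a, b, c, d, e, f, g] :: 'a::zero ^ 7) = vector [a', b', c', d', e', f', g'] \<longleftrightarrow>
    a = a' \<and> b = b' \<and> c = c' \<and> d = d' \<and> e = e' \<and> f = f' \<and> g = g'"
  unfolding vec_eq_iff forall_7 by simp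

lemma vector_7_cases:
  fixes x :: "'a::zero ^ 7"
  obtains a b c d e f g where "x = vector [a, b, c, d, e, f, g]"
proof -
  have "x = vector [x $ 1, x $ 2, x $ 3, x $ 4, x $ 5, x $ 6, x $ 7]"
    unfolding vec_eq_iff forall_7 by simp
  then show ?thesis using that by blast
qed

lemma row_mult: "(M ** N) $ i = (M $ i) v* N" for M N :: "'a::comm_semiring_1 ^ 'n ^ 'n"
  by (simp add: vec_eq_iff matrix_matrix_mult_def vector_matrix_mult_def mult.commute)

lemma perm_mat_mult: "perm_mat \<sigma> ** perm_mat \<tau> = perm_mat (\<sigma> \<circ> \<tau>)"
  by (simp add: perm_mat_def matrix_matrix_mult_def vec_eq_iff if_distrib [of "(*) _"]
      mult_delta_right cong: if_cong)

lemma perm_mat_id: "perm_mat id = mat 1"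
  by (simp add: perm_mat_def mat_def vec_eq_iff)

lemma row_perm_mat: "(x v* perm_mat \<sigma>) $ j = x $ \<sigma> j"
  by (simp add: vector_matrix_mult_def perm_mat_def if_distrib [of "(*) _"] cong: if_cong)

lemma inj_perm_mat: "perm_mat \<sigma> = perm_mat \<tau> \<Longrightarrow> \<sigma> = \<tau>"
proof
  fix j assume "perm_mat \<sigma> = perm_mat \<tau>"
  then have "perm_mat \<sigma> $ \<sigma> j $ j = perm_mat \<tau> $ \<sigma> j $ j" by simp
  then show "\<sigma> j = \<tau> j" by (simp add: perm_mat_def split: if_splits)
qed

lemma row_actions:
  "vector [a, b, c, d, e, f, g] v* cyc_mat [1, 2] = vector [b, a, c, d, e, f, g]"
  "vector [a, b, c, d, e, f, g] v* cyc_mat [2, 3] = vector [a, c, b, d, e, f, g]"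
  "vector [a, b, c, d, e, f, g] v* cyc_mat [3, 4] = vector [a, b, d, c, e, f, g]"
  "vector [a, b, c, d, e, f, g] v* cyc_mat [6, 7] = vector [a, b, c, d, e, g, f]"
  "vector [a, b, c, d, e, f, g] v* cyc_mat [1, 2, 3] = vector [b, c, a, d, e, f, g]"
  "vector [a, b, c, d, e, f, g] v* A_mat = vector [a, b, - c - e - f, - d - e - f, e, f, c + d + e + f + g]"
proof -
  show "vector [a, b, c, d, e, f, g] v* A_mat = vector [a, b, - c - e - f, - d - e - f, e, f, c + d + e + f + g]"
    unfolding vec_eq_iff forall_7 by (simp add: vector_matrix_mult_def sum_7 A_mat_def)
qed (unfold vec_eq_iff forall_7 row_perm_mat, simp_all add: transpose_def)

text \<open>Acting on columns instead of rows reverses the direction of the 3-cycle; the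
  transpositions look the same on both sides.\<close>

lemma vector_actions:
  "cyc_mat [1, 2] *v vector [a, b, c, d, e, f, g] = vector [b, a, c, d, e, f, g]"
  "cyc_mat [2, 3] *v vector [a, b, c, d, e, f, g] = vector [a, c, b, d, e, f, g]"
  "cyc_mat [3, 4] *v vector [a, b, c, d, e, f, g] = vector [a, b, d, c, e, f, g]"
  "cyc_mat [6, 7] *v vector [a, b, c, d, e, f, g] = vector [a, b, c, d, e, g, f]"
  "cyc_mat [1, 2, 3] *v vector [a, b, c, d, e, f, g] = vector [c, a, b, d, e, f, g]"
  "A_mat *v vector [a, b, c, d, e, f, g] = vector [a, b, g - c, g - d, e + g - c - d, f + g - c - d, g]"
proof -
  show "A_mat *v vector [a, b, c, d, e, f, g] = vector [a, b, g - c, g - d, e + g - c - d, f + g - c - d, g]"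
    unfolding vec_eq_iff forall_7 by (simp add: matrix_vector_mult_def sum_7 A_mat_def)
qed (unfold vec_eq_iff forall_7, simp_all add: matrix_vector_mult_def sum_7 perm_mat_def transpose_def)

lemma gens_involution: "h \<in> insert A_mat Sigma_gens \<Longrightarrow> h ** h = mat 1"
proof -
  have "h ** h = mat 1" if "\<And>x. h *v (h *v x) = x" for h :: "complex ^ 7 ^ 7"
    using that by (metis matrix_eq matrix_vector_mul_assoc matrix_vector_mul_lid)
  moreover have "h *v (h *v x) = x" if "h \<in> Sigma_gens" for x :: "complex ^ 7" and h
    using that by (cases x rule: vector_7_cases) (auto simp: Sigma_gens_def vector_actions simp del: cycle_of_list.simps)
  ultimately show "h \<in> insert A_mat Sigma_gens \<Longrightarrow> h ** h = mat 1"
    using A_mat_involution by blast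
qed

lemma inv_gens: "h \<in> insert A_mat Sigma_gens \<Longrightarrow> inv\<^bsub>GL7\<^esub> h = h"
  using generators_subset_GL7 gens_involution
  by (intro group.inv_equality[OF group_GL7]) (auto simp: GL7_def)

lemma subgroup_G_L: "subgroup G_L GL7"
  unfolding G_L_def by (rule group.generate_is_subgroup[OF group_GL7 generators_subset_GL7])

lemma subgroup_Sigma: "subgroup Sigma_grp GL7"
  unfolding Sigma_grp_def using generators_subset_GL7
  by (intro group.generate_is_subgroup[OF group_GL7]) auto

lemma Sigma_subset_G_L: "Sigma_grp \<subseteq> G_L"
  unfolding Sigma_grp_def G_L_def by (intro group.mono_generate[OF group_GL7]) auto

lemma G_L_mult: "M \<in> G_L \<Longrightarrow> N \<in> G_L \<Longrightarrow> M ** N \<in> G_L"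
  using subgroup.m_closed[OF subgroup_G_L] by (simp add: GL7_def)

lemma Sigma_mult: "M \<in> Sigma_grp \<Longrightarrow> N \<in> Sigma_grp \<Longrightarrow> M ** N \<in> Sigma_grp"
  using subgroup.m_closed[OF subgroup_Sigma] by (simp add: GL7_def)

lemma subgroup_inverse:
  assumes "subgroup H GL7" "M \<in> H"
  obtains N where "N \<in> H" "M ** N = mat 1" "N ** M = mat 1"
proof (rule that)
  have M: "M \<in> carrier GL7" using subgroup.subset[OF assms(1)] assms(2) by auto
  show "inv\<^bsub>GL7\<^esub> M \<in> H" by (rule subgroup.m_inv_closed[OF assms])
  show "M ** (inv\<^bsub>GL7\<^esub> M) = mat 1" "(inv\<^bsub>GL7\<^esub> M) ** M = mat 1"
    using group.r_inv[OF group_GL7 M] group.l_inv[OF group_GL7 M] by (simp_all add: GL7_def)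
qed

lemma one_in_Sigma: "mat 1 \<in> Sigma_grp"
  using subgroup.one_closed[OF subgroup_Sigma] by (simp add: GL7_def)

text \<open>All generators are involutions, so the inverse case of \<open>generate\<close> is the
  generator case.\<close>

lemma generate_induct_involutions:
  assumes M: "M \<in> generate GL7 S" and S: "S \<subseteq> insert A_mat Sigma_gens"
    and "P (mat 1)" "\<And>h. h \<in> S \<Longrightarrow> P h"
    and "\<And>M N. M \<in> generate GL7 S \<Longrightarrow> N \<in> generate GL7 S \<Longrightarrow> P M \<Longrightarrow> P N \<Longrightarrow> P (M ** N)"
  shows "P M"
  using M
proof induction
  case (inv h)
  then show ?case using inv_gens assms S by (metis subsetD)
qed (use assms in \<open>auto simp: GL7_def\<close>)

lemma row_closed_generate:
  assumes "M \<in> generate GL7 S" "S \<subseteq> insert A_mat Sigma_gens"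
    and "\<And>x h. x \<in> T \<Longrightarrow> h \<in> S \<Longrightarrow> x v* h \<in> T"
  shows "\<forall>x\<in>T. x v* M \<in> T"
  using assms(1,2)
  by (rule generate_induct_involutions) (use assms(3) in \<open>auto simp flip: vector_matrix_mul_assoc\<close>)

section \<open>Orbits of the fifth rows under \<open>\<Sigma>\<close>\<close>

lemma Sigma_orbitI:
  assumes "row_orb \<subseteq> {x v* \<tau> | \<tau>. \<tau> \<in> Sigma_grp}" "x \<in> row_orb"
    and "\<And>y h. y \<in> row_orb \<Longrightarrow> h \<in> Sigma_gens \<Longrightarrow> y v* h \<in> row_orb"
  shows "{x v* \<tau> | \<tau>. \<tau> \<in> Sigma_grp} = row_orb"
  using assms row_closed_generate[of _ Sigma_gens row_orb] unfolding Sigma_grp_def by blast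

lemma Sigma_orbit_base: "x \<in> {x v* \<tau> | \<tau>. \<tau> \<in> Sigma_grp}"
  using one_in_Sigma by (auto intro!: exI[of _ "mat 1"])

lemma Sigma_orbit_step:
  fixes x :: "complex ^ 7"
  defines "R \<equiv> {x v* \<tau> | \<tau>. \<tau> \<in> Sigma_grp}"
  assumes "vector [a, b, c, d, e, f, g] \<in> R"
  shows "vector [b, a, c, d, e, f, g] \<in> R" "vector [a, c, b, d, e, f, g] \<in> R"
    "vector [a, b, d, c, e, f, g] \<in> R" "vector [a, b, c, d, e, g, f] \<in> R"
proof -
  have *: "y v* h \<in> R" if "y \<in> R" "h \<in> Sigma_gens" for y h
  proof -
    from that obtain \<tau> where "\<tau> \<in> Sigma_grp" "y = x v* \<tau>" unfolding R_def by auto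
    moreover have "h \<in> Sigma_grp" unfolding Sigma_grp_def using that by (intro generate.incl)
    ultimately show ?thesis unfolding R_def using Sigma_mult by (auto simp: vector_matrix_mul_assoc)
  qed
  note g = row_actions(1-4)[of a b c d e f g, symmetric]
  show "vector [b, a, c, d, e, f, g] \<in> R" unfolding g by (intro *[OF assms(2)]) (simp add: Sigma_gens_def)
  show "vector [a, c, b, d, e, f, g] \<in> R" unfolding g by (intro *[OF assms(2)]) (simp add: Sigma_gens_def)
  show "vector [a, b, d, c, e, f, g] \<in> R" unfolding g by (intro *[OF assms(2)]) (simp add: Sigma_gens_def)
  show "vector [a, b, c, d, e, g, f] \<in> R" unfolding g by (intro *[OF assms(2)]) (simp add: Sigma_gens_def)
qed

text \<open>Each of the six lists starts with the fifth row of the representative in the same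
  position and continues breadth first along the generators.\<close>

definition row_orbit0 :: "(complex ^ 7) set" where
  "row_orbit0 = {vector [0, 0, 0, 0, 1, 0, 0]}"

definition row_orbit1 :: "(complex ^ 7) set" where
  "row_orbit1 = {vector [0, 0, -1, -1, 1, 0, 1],
     vector [0, -1, 0, -1, 1, 0, 1],
     vector [0, 0, -1, -1, 1, 1, 0],
     vector [-1, 0, 0, -1, 1, 0, 1],
     vector [0, -1, -1, 0, 1, 0, 1],
     vector [0, -1, 0, -1, 1, 1, 0],
     vector [-1, 0, -1, 0, 1, 0, 1],
     vector [-1, 0, 0, -1, 1, 1, 0],
     vector [0, -1, -1, 0, 1, 1, 0],
     vector [-1, -1, 0, 0, 1, 0, 1],
     vector [-1, 0, -1, 0, 1, 1, 0],
     vector [-1, -1, 0, 0, 1, 1, 0]}"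

definition row_orbit2 :: "(complex ^ 7) set" where
  "row_orbit2 = {vector [0, -1, -2, -1, 1, 1, 1],
     vector [-1, 0, -2, -1, 1, 1, 1],
     vector [0, -2, -1, -1, 1, 1, 1],
     vector [0, -1, -1, -2, 1, 1, 1],
     vector [-1, -2, 0, -1, 1, 1, 1],
     vector [-1, 0, -1, -2, 1, 1, 1],
     vector [-2, 0, -1, -1, 1, 1, 1],
     vector [-2, -1, 0, -1, 1, 1, 1],
     vector [-1, -2, -1, 0, 1, 1, 1],
     vector [-1, -1, 0, -2, 1, 1, 1],
     vector [-2, -1, -1, 0, 1, 1, 1],
     vector [-1, -1, -2, 0, 1, 1, 1]}"

definition row_orbit3 :: "(complex ^ 7) set" where
  "row_orbit3 = {vector [-1, -2, -2, -1, 1, 1, 2],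
     vector [-2, -1, -2, -1, 1, 1, 2],
     vector [-1, -2, -1, -2, 1, 1, 2],
     vector [-1, -2, -2, -1, 1, 2, 1],
     vector [-2, -2, -1, -1, 1, 1, 2],
     vector [-2, -1, -1, -2, 1, 1, 2],
     vector [-2, -1, -2, -1, 1, 2, 1],
     vector [-1, -1, -2, -2, 1, 1, 2],
     vector [-1, -2, -1, -2, 1, 2, 1],
     vector [-2, -2, -1, -1, 1, 2, 1],
     vector [-2, -1, -1, -2, 1, 2, 1],
     vector [-1, -1, -2, -2, 1, 2, 1]}"

definition row_orbit4 :: "(complex ^ 7) set" where
  "row_orbit4 = {vector [-1, -1, -1, -1, 1, 0, 2],
     vector [-1, -1, -1, -1, 1, 2, 0]}"

definition row_orbit5 :: "(complex ^ 7) set" where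
  "row_orbit5 = {vector [-2, -2, -2, -2, 1, 2, 2]}"

lemma row_orbit0:
  "{vector [0, 0, 0, 0, 1, 0, 0] v* \<tau> | \<tau>. \<tau> \<in> Sigma_grp} = row_orbit0" (is "?R = _")
proof (rule Sigma_orbitI)
  note r = Sigma_orbit_step[where x = "vector [0, 0, 0, 0, 1, 0, 0]"]
  note r12 = r(1) and r23 = r(2) and r34 = r(3) and r67 = r(4)
  have v0: "vector [0, 0, 0, 0, 1, 0, 0] \<in> ?R" by (rule Sigma_orbit_base)
  show "row_orbit0 \<subseteq> ?R"
    unfolding row_orbit0_def by (intro insert_subsetI empty_subsetI v0)
qed (auto simp: row_orbit0_def Sigma_gens_def row_actions vector_7_eq_iff simp del: cycle_of_list.simps)

text \<open>The facts \<open>v1\<close> to \<open>v11\<close> form a spanning tree of the orbit: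
  each row is one generator away from an earlier one. The converse inclusion is closure of the list
  under the generators.\<close>

lemma row_orbit1:
  "{vector [0, 0, -1, -1, 1, 0, 1] v* \<tau> | \<tau>. \<tau> \<in> Sigma_grp} = row_orbit1" (is "?R = _")
proof (rule Sigma_orbitI)
  note r = Sigma_orbit_step[where x = "vector [0, 0, -1, -1, 1, 0, 1]"]
  note r12 = r(1) and r23 = r(2) and r34 = r(3) and r67 = r(4)
  have v0: "vector [0, 0, -1, -1, 1, 0, 1] \<in> ?R" by (rule Sigma_orbit_base)
  note v1 = r23[OF v0]
    and v2 = r67[OF v0]
    and v3 = r12[OF v1]
    and v4 = r34[OF v1]
    and v5 = r67[OF v1]
    and v6 = r34[OF v3]
    and v7 = r67[OF v3]
    and v8 = r67[OF v4]
    and v9 = r23[OF v6]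
    and v10 = r67[OF v6]
    and v11 = r67[OF v9]
  show "row_orbit1 \<subseteq> ?R"
    unfolding row_orbit1_def by (intro insert_subsetI empty_subsetI v0 v1 v2 v3 v4 v5 v6 v7 v8 v9 v10 v11)
qed (auto simp: row_orbit1_def Sigma_gens_def row_actions vector_7_eq_iff simp del: cycle_of_list.simps)

lemma row_orbit2:
  "{vector [0, -1, -2, -1, 1, 1, 1] v* \<tau> | \<tau>. \<tau> \<in> Sigma_grp} = row_orbit2" (is "?R = _")
proof (rule Sigma_orbitI)
  note r = Sigma_orbit_step[where x = "vector [0, -1, -2, -1, 1, 1, 1]"]
  note r12 = r(1) and r23 = r(2) and r34 = r(3) and r67 = r(4)
  have v0: "vector [0, -1, -2, -1, 1, 1, 1] \<in> ?R" by (rule Sigma_orbit_base)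
  note v1 = r12[OF v0]
    and v2 = r23[OF v0]
    and v3 = r34[OF v0]
    and v4 = r23[OF v1]
    and v5 = r34[OF v1]
    and v6 = r12[OF v2]
    and v7 = r12[OF v4]
    and v8 = r34[OF v4]
    and v9 = r23[OF v5]
    and v10 = r34[OF v7]
    and v11 = r23[OF v8]
  show "row_orbit2 \<subseteq> ?R"
    unfolding row_orbit2_def by (intro insert_subsetI empty_subsetI v0 v1 v2 v3 v4 v5 v6 v7 v8 v9 v10 v11)
qed (auto simp: row_orbit2_def Sigma_gens_def row_actions vector_7_eq_iff simp del: cycle_of_list.simps)

lemma row_orbit3:
  "{vector [-1, -2, -2, -1, 1, 1, 2] v* \<tau> | \<tau>. \<tau> \<in> Sigma_grp} = row_orbit3" (is "?R = _")
proof (rule Sigma_orbitI)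
  note r = Sigma_orbit_step[where x = "vector [-1, -2, -2, -1, 1, 1, 2]"]
  note r12 = r(1) and r23 = r(2) and r34 = r(3) and r67 = r(4)
  have v0: "vector [-1, -2, -2, -1, 1, 1, 2] \<in> ?R" by (rule Sigma_orbit_base)
  note v1 = r12[OF v0]
    and v2 = r34[OF v0]
    and v3 = r67[OF v0]
    and v4 = r23[OF v1]
    and v5 = r34[OF v1]
    and v6 = r67[OF v1]
    and v7 = r23[OF v2]
    and v8 = r67[OF v2]
    and v9 = r67[OF v4]
    and v10 = r67[OF v5]
    and v11 = r67[OF v7]
  show "row_orbit3 \<subseteq> ?R"
    unfolding row_orbit3_def by (intro insert_subsetI empty_subsetI v0 v1 v2 v3 v4 v5 v6 v7 v8 v9 v10 v11)
qed (auto simp: row_orbit3_def Sigma_gens_def row_actions vector_7_eq_iff simp del: cycle_of_list.simps)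

lemma row_orbit4:
  "{vector [-1, -1, -1, -1, 1, 0, 2] v* \<tau> | \<tau>. \<tau> \<in> Sigma_grp} = row_orbit4" (is "?R = _")
proof (rule Sigma_orbitI)
  note r = Sigma_orbit_step[where x = "vector [-1, -1, -1, -1, 1, 0, 2]"]
  note r12 = r(1) and r23 = r(2) and r34 = r(3) and r67 = r(4)
  have v0: "vector [-1, -1, -1, -1, 1, 0, 2] \<in> ?R" by (rule Sigma_orbit_base)
  note v1 = r67[OF v0]
  show "row_orbit4 \<subseteq> ?R"
    unfolding row_orbit4_def by (intro insert_subsetI empty_subsetI v0 v1)
qed (auto simp: row_orbit4_def Sigma_gens_def row_actions vector_7_eq_iff simp del: cycle_of_list.simps)

lemma row_orbit5:
  "{vector [-2, -2, -2, -2, 1, 2, 2] v* \<tau> | \<tau>. \<tau> \<in> Sigma_grp} = row_orbit5" (is "?R = _")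
proof (rule Sigma_orbitI)
  note r = Sigma_orbit_step[where x = "vector [-2, -2, -2, -2, 1, 2, 2]"]
  note r12 = r(1) and r23 = r(2) and r34 = r(3) and r67 = r(4)
  have v0: "vector [-2, -2, -2, -2, 1, 2, 2] \<in> ?R" by (rule Sigma_orbit_base)
  show "row_orbit5 \<subseteq> ?R"
    unfolding row_orbit5_def by (intro insert_subsetI empty_subsetI v0)
qed (auto simp: row_orbit5_def Sigma_gens_def row_actions vector_7_eq_iff simp del: cycle_of_list.simps)

text \<open>Reduced by the equation of the hyperplane, the forms \<open>e' - 1\<close> are, up to
  sign, \<open>a + b + c + d - f - g\<close>, the \<open>x + y - f\<close> and
  \<open>x + y - g\<close>, the differences \<open>x - y\<close>, and \<open>f - g\<close>, with
  distinct \<open>x\<close>, \<open>y\<close> among \<open>a, b, c, d\<close>: the 40 roots of type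
  D5.\<close>

definition all_rows :: "(complex ^ 7) set" where
  "all_rows = row_orbit0 \<union> row_orbit1 \<union> row_orbit2 \<union> row_orbit3 \<union> row_orbit4 \<union> row_orbit5"

lemmas row_orbit_defs = row_orbit0_def row_orbit1_def row_orbit2_def row_orbit3_def row_orbit4_def row_orbit5_def
lemmas row_orbits = row_orbit0 row_orbit1 row_orbit2 row_orbit3 row_orbit4 row_orbit5

lemma row_5_one: "(mat 1 :: complex ^ 7 ^ 7) $ 5 = vector [0, 0, 0, 0, 1, 0, 0]"
  unfolding vec_eq_iff forall_7 by (simp add: mat_def)

lemma all_rows_A: "x \<in> all_rows \<Longrightarrow> x v* A_mat \<in> all_rows"
  unfolding all_rows_def row_orbit_defs
  by (elim UnE insertE emptyE; simp add: row_actions(6); simp add: vector_7_eq_iff)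

lemma all_rows_Sigma: "x \<in> all_rows \<Longrightarrow> \<tau> \<in> Sigma_grp \<Longrightarrow> x v* \<tau> \<in> all_rows"
  unfolding all_rows_def row_orbits[symmetric]
  by (auto simp: vector_matrix_mul_assoc intro: Sigma_mult)

lemma G_L_row_5: 
  assumes "M \<in> G_L"
  shows "M $ 5 \<in> all_rows"
proof -
  have "\<forall>x\<in>all_rows. x v* M \<in> all_rows"
    using assms unfolding G_L_def
  proof (rule row_closed_generate)
    fix x h assume "x \<in> all_rows" "h \<in> insert A_mat Sigma_gens"
    then show "x v* h \<in> all_rows"
      using all_rows_A all_rows_Sigma by (auto simp: Sigma_grp_def intro: generate.incl)
  qed auto
  moreover have "mat 1 $ 5 \<in> all_rows" by (simp add: row_5_one all_rows_def row_orbit0_def)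
  moreover have "M $ 5 = mat 1 $ 5 v* M" by (simp flip: row_mult)
  ultimately show ?thesis by simp
qed

text \<open>
  The rows of the sixteen parameters \<open>x\<close>, \<open>1 + x - e\<close>, \<open>f - x\<close> and \<open>g - x\<close> (where \<open>x\<close> is one of
  \<open>a, b, c, d\<close>), with the constant \<open>1\<close> expressed through the equation of the hyperplane.
\<close>

definition weights :: "(complex ^ 7) set" where
  "weights =
    {vector [1, 0, 0, 0, 0, 0, 0],
     vector [0, 1, 0, 0, 0, 0, 0],
     vector [0, 0, 1, 0, 0, 0, 0],
     vector [0, 0, 0, 1, 0, 0, 0],
     vector [0, -1, -1, -1, 0, 1, 1],
     vector [-1, 0, -1, -1, 0, 1, 1],
     vector [-1, -1, 0, -1, 0, 1, 1],
     vector [-1, -1, -1, 0, 0, 1, 1],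
     vector [-1, 0, 0, 0, 0, 1, 0],
     vector [0, -1, 0, 0, 0, 1, 0],
     vector [0, 0, -1, 0, 0, 1, 0],
     vector [0, 0, 0, -1, 0, 1, 0],
     vector [-1, 0, 0, 0, 0, 0, 1],
     vector [0, -1, 0, 0, 0, 0, 1],
     vector [0, 0, -1, 0, 0, 0, 1],
     vector [0, 0, 0, -1, 0, 0, 1]}"

text \<open>A finite check on generators; for example \<open>A_mat\<close> fixes \<open>a\<close>
  and \<open>b\<close> and sends \<open>c\<close>, \<open>d\<close> to \<open>g - c\<close>,
  \<open>g - d\<close>. These forms give access to the rows other than the fifth.\<close>

lemma G_L_weights: "M \<in> G_L \<Longrightarrow> x \<in> weights \<Longrightarrow> x v* M \<in> weights"
proof -
  have "x v* h \<in> weights" if "x \<in> weights" "h \<in> insert A_mat Sigma_gens" for x h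
    using that unfolding weights_def Sigma_gens_def
    by (elim insertE emptyE; simp add: row_actions del: cycle_of_list.simps; simp add: vector_7_eq_iff)
  then show "M \<in> G_L \<Longrightarrow> x \<in> weights \<Longrightarrow> x v* M \<in> weights"
    unfolding G_L_def using row_closed_generate[of M "insert A_mat Sigma_gens" weights] by auto
qed

text \<open>This row represents the constant 1 on the hyperplane. Its invariance lets affine forms
  such as \<open>1 + x - e\<close> be treated as linear ones.\<close>

lemma G_L_hyperplane: "M \<in> G_L \<Longrightarrow> vector [-1, -1, -1, -1, 1, 1, 1] v* M = vector [-1, -1, -1, -1, 1, 1, 1]"
proof -
  have "x v* h \<in> {vector [-1, -1, -1, -1, 1, 1, 1]}" if "x \<in> {vector [-1, -1, -1, -1, 1, 1, 1 :: complex]}" "h \<in> insert A_mat Sigma_gens" for x h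
    using that unfolding Sigma_gens_def
    by (elim insertE emptyE; simp add: row_actions del: cycle_of_list.simps)
  then show "M \<in> G_L \<Longrightarrow> vector [-1, -1, -1, -1, 1, 1, 1] v* M = vector [-1, -1, -1, -1, 1, 1, 1]"
    unfolding G_L_def using row_closed_generate[of M "insert A_mat Sigma_gens" "{vector [-1, -1, -1, -1, 1, 1, 1]}"] by auto
qed

lemma axis_7:
  "axis 1 1 = (vector [1, 0, 0, 0, 0, 0, 0] :: complex ^ 7)" "axis 2 1 = (vector [0, 1, 0, 0, 0, 0, 0] :: complex ^ 7)"
  "axis 3 1 = (vector [0, 0, 1, 0, 0, 0, 0] :: complex ^ 7)" "axis 4 1 = (vector [0, 0, 0, 1, 0, 0, 0] :: complex ^ 7)"
  "axis 5 1 = (vector [0, 0, 0, 0, 1, 0, 0] :: complex ^ 7)" "axis 6 1 = (vector [0, 0, 0, 0, 0, 1, 0] :: complex ^ 7)"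
  "axis 7 1 = (vector [0, 0, 0, 0, 0, 0, 1] :: complex ^ 7)"
  unfolding vec_eq_iff forall_7 by (simp_all add: axis_def)

lemma vector_7_add:
  "vector [a, b, c, d, e, f, g] + vector [a', b', c', d', e', f', g'] = (vector [a + a', b + b', c + c', d + d', e + e', f + f', g + g'] :: complex ^ 7)"
  "vector [a, b, c, d, e, f, g] - vector [a', b', c', d', e', f', g'] = (vector [a - a', b - b', c - c', d - d', e - e', f - f', g - g'] :: complex ^ 7)"
  unfolding vec_eq_iff forall_7 by simp_all

text \<open>Adding \<open>1 - e\<close> raises both the \<open>f\<close> and the \<open>g\<close>
  entry by 1. Throughout \<open>weights\<close> these entries are 0 or 1, so both must vanish in
  \<open>x\<close>.\<close>

lemma weights_pairs:
  assumes "x \<in> weights" "x + vector [-1, -1, -1, -1, 1, 1, 1] - axis 5 1 \<in> weights"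
  shows "x \<in> {axis 1 1, axis 2 1, axis 3 1, axis 4 1}"
  using assms unfolding weights_def axis_7
  by (elim insertE emptyE; simp add: vector_7_add; simp add: vector_7_eq_iff)

text \<open>A description of \<open>f\<close> and \<open>g\<close> in terms of the sixteen forms and
  the unordered set \<open>a, b, c, d\<close>; it locates rows 6 and 7 once the first four are
  known.\<close>

lemma weights_common:
  assumes "y - axis 1 1 \<in> weights" "y - axis 2 1 \<in> weights" "y - axis 3 1 \<in> weights" "y - axis 4 1 \<in> weights"
  shows "y \<in> {axis 6 1, axis 7 1}"
proof -
  have "\<forall>x\<in>weights. x + axis 1 1 - axis 2 1 \<in> weights \<and> x + axis 1 1 - axis 3 1 \<in> weights \<and> x + axis 1 1 - axis 4 1 \<in> weights
      \<longrightarrow> x + axis 1 1 \<in> {axis 6 1, axis 7 1}"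
    by (simp only: weights_def ball_simps axis_7 vector_7_add insert_iff empty_iff vector_7_eq_iff) simp
  from bspec[OF this assms(1)] assms(2-4) show ?thesis by simp
qed

lemma axis_weights: "i \<in> {1, 2, 3, 4} \<Longrightarrow> axis i 1 \<in> weights"
  "i \<in> {1, 2, 3, 4} \<Longrightarrow> axis i 1 + vector [-1, -1, -1, -1, 1, 1, 1] - axis 5 1 \<in> weights"
  "i \<in> {1, 2, 3, 4} \<Longrightarrow> axis 6 1 - axis i 1 \<in> weights"
  "i \<in> {1, 2, 3, 4} \<Longrightarrow> axis 7 1 - axis i 1 \<in> weights"
  by (elim insertE emptyE; simp add: weights_def axis_7 vector_7_add; simp add: vector_7_eq_iff)+

lemma row_axis: "axis i 1 v* M = M $ i" for M :: "complex ^ 7 ^ 7"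
  by (simp add: vec_eq_iff vector_matrix_mult_def axis_def if_distrib [of "\<lambda>y. y * _"] cong: if_cong)

lemma vector_matrix_left_distrib: "(x + y) v* M = x v* M + y v* M" "(x - y) v* M = x v* M - y v* M" for M :: "complex ^ 7 ^ 7"
  by (simp_all add: vec_eq_iff vector_matrix_mult_def algebra_simps sum.distrib sum_subtractf)

section \<open>\<open>\<Sigma>\<close> as a product of symmetric groups, and as the stabiliser of a
  row\<close>

definition Sigma_perms :: "(7 \<Rightarrow> 7) set" where
  "Sigma_perms = {\<sigma> \<circ> \<tau> | \<sigma> \<tau>. \<sigma> permutes {1, 2, 3, 4} \<and> \<tau> permutes {6, 7}}"

text \<open>The non-adjacent transpositions arise by conjugation,
  \<open>(i k) = (j k) (i j) (j k)\<close>.\<close>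

lemma perm_mat_transpose_Sigma:
  assumes "{i, j} \<subseteq> {1, 2, 3, 4} \<or> {i, j} = {6, 7}"
  shows "perm_mat (Transposition.transpose i j) \<in> Sigma_grp"
proof (cases "i = j")
  case True then show ?thesis using one_in_Sigma by (simp add: perm_mat_id)
next
  case False
  have g: "perm_mat (Transposition.transpose 1 2) \<in> Sigma_grp" "perm_mat (Transposition.transpose 2 3) \<in> Sigma_grp"
    "perm_mat (Transposition.transpose 3 4) \<in> Sigma_grp" "perm_mat (Transposition.transpose 6 7) \<in> Sigma_grp"
    unfolding Sigma_grp_def by (rule generate.incl; simp add: Sigma_gens_def)+
  have c: "perm_mat (Transposition.transpose i k) \<in> Sigma_grp"
    if "perm_mat (Transposition.transpose i j) \<in> Sigma_grp" "perm_mat (Transposition.transpose j k) \<in> Sigma_grp" "i \<noteq> k" "j \<noteq> k" "i \<noteq> j" for i j k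
  proof -
    have "Transposition.transpose i k = Transposition.transpose j k \<circ> Transposition.transpose i j \<circ> Transposition.transpose j k"
      using that(3-5) by (auto simp: fun_eq_iff Transposition.transpose_def)
    then show ?thesis using that by (simp add: Sigma_mult flip: perm_mat_mult)
  qed
  have h: "perm_mat (Transposition.transpose 1 3) \<in> Sigma_grp" "perm_mat (Transposition.transpose 2 4) \<in> Sigma_grp"
    using c[OF g(1) g(2)] c[OF g(2) g(3)] by auto
  have k: "perm_mat (Transposition.transpose 1 4) \<in> Sigma_grp" using c[OF h(1) g(3)] by auto
  show ?thesis using assms False g h k
    by (auto simp: doubleton_eq_iff transpose_commute)
qed

text \<open>Permutations are products of transpositions, which gives one inclusion. For the other,
  the product set is closed under composition because permutations of disjoint sets commute.\<close>

lemma Sigma_grp_eq: "Sigma_grp = perm_mat ` Sigma_perms"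
proof
  have one: "perm_mat p \<in> Sigma_grp" if "p permutes S" "\<And>i j. i \<in> S \<Longrightarrow> j \<in> S \<Longrightarrow> perm_mat (Transposition.transpose i j) \<in> Sigma_grp" for p S
    using that(1) finite
  proof (induction rule: permutes_induct)
    case id show ?case using one_in_Sigma perm_mat_id by (simp add: id_def)
  next
    case (swap a b p) then show ?case unfolding perm_mat_mult[symmetric] using that(2) Sigma_mult by blast
  qed
  have "perm_mat \<sigma> \<in> Sigma_grp" if "\<sigma> permutes {1, 2, 3, 4}" for \<sigma>
    by (rule one[OF that]) (rule perm_mat_transpose_Sigma, blast)
  moreover have "perm_mat \<sigma> \<in> Sigma_grp" if "\<sigma> permutes {6, 7}" for \<sigma>
    using that perm_mat_transpose_Sigma[of 6 7] one_in_Sigma by (auto simp: permutes_doubleton_iff perm_mat_id perm_mat_id[unfolded id_def])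
  ultimately show "perm_mat ` Sigma_perms \<subseteq> Sigma_grp"
    unfolding Sigma_perms_def using Sigma_mult[of "perm_mat _" "perm_mat _", unfolded perm_mat_mult] by blast
  have gens: "h \<in> perm_mat ` Sigma_perms" if "h \<in> Sigma_gens" for h
  proof -
    have "Transposition.transpose i j \<in> Sigma_perms" if "{i, j} \<subseteq> {1, 2, 3, 4} \<or> {i, j} = {6, 7}" for i j
    proof -
      have e: "Transposition.transpose i j = Transposition.transpose i j \<circ> id" "Transposition.transpose i j = id \<circ> Transposition.transpose i j" by auto
      from that show ?thesis
      proof
        assume "{i, j} \<subseteq> {1, 2, 3, 4}"
        then have "Transposition.transpose i j permutes {1, 2, 3, 4}" by (intro permutes_swap_id) auto
        then show ?thesis unfolding Sigma_perms_def using e(1) permutes_id by blast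
      next
        assume "{i, j} = {6, 7}"
        then have "Transposition.transpose i j permutes {6, 7}" by (intro permutes_swap_id) auto
        then show ?thesis unfolding Sigma_perms_def using e(2) permutes_id by blast
      qed
    qed
    then show ?thesis using that by (auto simp: Sigma_gens_def)
  qed
  have comp: "p \<circ> q \<in> Sigma_perms" if "p \<in> Sigma_perms" "q \<in> Sigma_perms" for p q
  proof -
    from that obtain p1 p2 q1 q2 where pq: "p = p1 \<circ> p2" "q = q1 \<circ> q2" "p1 permutes {1, 2, 3, 4}" "p2 permutes {6, 7}"
      "q1 permutes {1, 2, 3, 4}" "q2 permutes {6, 7}" unfolding Sigma_perms_def by blast
    have "p2 (q1 x) = q1 (p2 x)" for x
    proof -
      have "x \<in> {1, 2, 3, 4} \<or> x \<in> {6, 7} \<or> x = 5" using UNIV_7 by (metis UNIV_I insert_iff)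
      moreover have "x \<in> {1, 2, 3, 4} \<Longrightarrow> q1 x \<notin> {6, 7}" using permutes_in_image[OF pq(5), of x] by auto
      moreover have "x \<in> {6, 7} \<Longrightarrow> p2 x \<notin> {1, 2, 3, 4}" using permutes_in_image[OF pq(4), of x] by auto
      moreover have "x \<in> {1, 2, 3, 4} \<Longrightarrow> x \<notin> {6, 7}" "(5 :: 7) \<notin> {1, 2, 3, 4}" "(5 :: 7) \<notin> {6, 7}" by auto
      ultimately show ?thesis using permutes_not_in[OF pq(5)] permutes_not_in[OF pq(4)]
        by metis
    qed
    then have "p2 \<circ> q1 = q1 \<circ> p2" by auto
    then have "p \<circ> q = (p1 \<circ> q1) \<circ> (p2 \<circ> q2)" unfolding pq by (metis comp_assoc)
    moreover have "(p1 \<circ> q1) permutes {1, 2, 3, 4}" "(p2 \<circ> q2) permutes {6, 7}" using pq by (auto intro: permutes_compose)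
    ultimately show ?thesis unfolding Sigma_perms_def by blast
  qed
  show "Sigma_grp \<subseteq> perm_mat ` Sigma_perms"
  proof
    fix M assume "M \<in> Sigma_grp"
    then show "M \<in> perm_mat ` Sigma_perms"
      unfolding Sigma_grp_def
    proof (rule generate_induct_involutions)
      have "id = id \<circ> (id :: 7 \<Rightarrow> 7)" by simp
      then have "id \<in> Sigma_perms" unfolding Sigma_perms_def using permutes_id by blast
      then show "mat 1 \<in> perm_mat ` Sigma_perms" by (metis imageI perm_mat_id)
      show "M ** N \<in> perm_mat ` Sigma_perms" if "M \<in> perm_mat ` Sigma_perms" "N \<in> perm_mat ` Sigma_perms" for M N
        using that comp perm_mat_mult by (metis (no_types, lifting) image_iff)
    qed (use gens in auto)
  qed
qed

lemma card_Sigma_grp: "card Sigma_grp = 48"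
proof -
  define A where "A = {p :: 7 \<Rightarrow> 7. p permutes {1, 2, 3, 4}}"
  define B where "B = {p :: 7 \<Rightarrow> 7. p permutes {6, 7}}"
  have inj: "inj_on (\<lambda>(p, q). p \<circ> q) (A \<times> B)"
  proof (rule inj_onI, clarsimp)
    fix p q p' q' assume pq: "p \<in> A" "q \<in> B" "p' \<in> A" "q' \<in> B" "p \<circ> q = p' \<circ> q'"
    have 1: "q x = x" "q' x = x" if "x \<notin> {6, 7}" for x using pq that unfolding B_def by (auto dest: permutes_not_in)
    have 2: "p x = x" "p' x = x" if "x \<notin> {1, 2, 3, 4}" for x using pq that unfolding A_def by (auto dest: permutes_not_in)
    have p: "p x = p' x" for x
    proof (cases "x \<in> {1, 2, 3, 4}")
      case True then have "x \<notin> {6, 7}" by auto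
      then show ?thesis using 1 fun_cong[OF pq(5), of x] by simp
    qed (use 2 in simp)
    then have "p = p'" by auto
    moreover have "inj p" using pq(1) unfolding A_def by (auto intro: permutes_inj)
    ultimately have "q = q'" using pq(5) by (metis fun.inj_map_strong inj_eq comp_apply ext)
    with \<open>p = p'\<close> show "p = p' \<and> q = q'" by simp
  qed
  have "Sigma_perms = (\<lambda>(p, q). p \<circ> q) ` (A \<times> B)" unfolding Sigma_perms_def A_def B_def by auto
  then have "card Sigma_perms = card A * card B" using card_image[OF inj] by (simp add: card_cartesian_product)
  also have "card A = fact 4" unfolding A_def by (rule card_permutations) auto
  also have "card B = fact 2" unfolding B_def by (rule card_permutations) auto
  finally have "card Sigma_perms = 48" by (simp add: eval_nat_numeral)
  moreover have "inj_on perm_mat Sigma_perms" using inj_perm_mat by (auto intro: inj_onI)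
  ultimately show ?thesis unfolding Sigma_grp_eq by (simp add: card_image)
qed

lemma G_L_inj_rows: 
  assumes "M \<in> G_L" "M $ i = M $ j" shows "i = j"
proof -
  obtain N where "M ** N = mat 1" using subgroup_inverse[OF subgroup_G_L assms(1)] by metis
  then have "mat 1 $ i = (mat 1 $ j :: complex ^ 7)" using assms(2) by (metis row_mult)
  then have "(mat 1 $ i $ i :: complex) = mat 1 $ j $ i" by simp
  then show ?thesis by (simp add: mat_def split: if_splits)
qed

text \<open>If \<open>e\<close> is fixed, the relation between \<open>x\<close> and
  \<open>1 + x - e\<close> is preserved, so \<open>a, b, c, d\<close> are permuted; then
  \<open>f\<close> and \<open>g\<close> are permuted as well, by their description through
  differences.\<close>

lemma stabilizer_row_5:
  assumes M: "M \<in> G_L" and r5: "M $ 5 = axis 5 1"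
  shows "M \<in> Sigma_grp"
proof -
  have r14: "M $ i \<in> {axis 1 1, axis 2 1, axis 3 1, axis 4 1}" if "i \<in> {1, 2, 3, 4}" for i
  proof (rule weights_pairs)
    show "M $ i \<in> weights" using G_L_weights[OF M axis_weights(1)[OF that]] by (simp add: row_axis)
    show "M $ i + vector [-1, -1, -1, -1, 1, 1, 1] - axis 5 1 \<in> weights"
      using G_L_weights[OF M axis_weights(2)[OF that]] r5 G_L_hyperplane[OF M]
      by (simp add: row_axis vector_matrix_left_distrib)
  qed
  \<comment> \<open>Distinctness of the rows upgrades the inclusion to equality:
    \<open>weights_common\<close> needs all four axes to occur.\<close>
  have fin: "(\<lambda>i. M $ i) ` {1, 2, 3, 4} = {axis 1 1, axis 2 1, axis 3 1, axis 4 1}"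
  proof (rule card_subset_eq)
    show "(\<lambda>i. M $ i) ` {1, 2, 3, 4} \<subseteq> {axis 1 1, axis 2 1, axis 3 1, axis 4 1}" using r14 by blast
    have "inj_on (\<lambda>i. M $ i) {1, 2, 3, 4}" by (rule inj_onI) (rule G_L_inj_rows[OF M])
    from card_image[OF this] have "card ((\<lambda>i. M $ i) ` {1, 2, 3, 4}) = 4" by simp
    moreover have "card {axis 1 1, axis 2 1, axis 3 1, axis 4 1 :: complex ^ 7} = 4" by (simp add: axis_7 vector_7_eq_iff)
    ultimately show "card ((\<lambda>i. M $ i) ` {1, 2, 3, 4}) = card {axis 1 1, axis 2 1, axis 3 1, axis 4 1 :: complex ^ 7}" by simp
  qed auto
  have r67: "M $ k \<in> {axis 6 1, axis 7 1}" if "k \<in> {6, 7}" for k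
  proof -
    have *: "M $ k - y \<in> weights" if "y \<in> {axis 1 1, axis 2 1, axis 3 1, axis 4 1}" for y
    proof -
      from that fin obtain i where i: "i \<in> {1, 2, 3, 4}" "y = M $ i" by (metis imageE)
      have "axis k 1 - axis i 1 \<in> weights" using \<open>k \<in> {6, 7}\<close> axis_weights(3,4)[OF i(1)] by auto
      from G_L_weights[OF M this] show ?thesis by (simp add: row_axis vector_matrix_left_distrib i)
    qed
    show ?thesis by (rule weights_common) (rule *, blast)+
  qed
  have all: "i \<in> {1, 2, 3, 4} \<or> i \<in> {6, 7} \<or> i = 5" for i :: 7 using UNIV_7 by (metis UNIV_I insert_iff)
  have "\<exists>k. M $ i = axis k 1 \<and> (i \<in> {1, 2, 3, 4} \<longrightarrow> k \<in> {1, 2, 3, 4}) \<and> (i \<in> {6, 7} \<longrightarrow> k \<in> {6, 7}) \<and> (i = 5 \<longrightarrow> k = 5)" for i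
  proof -
    have d: "i \<in> {1, 2, 3, 4} \<Longrightarrow> i \<notin> {6, 7} \<and> i \<noteq> 5" "i \<in> {6, 7} \<Longrightarrow> i \<notin> {1, 2, 3, 4} \<and> i \<noteq> 5"  "(5 :: 7) \<notin> {1, 2, 3, 4}" "(5 :: 7) \<notin> {6, 7}" by auto
    consider "i \<in> {1, 2, 3, 4}" | "i \<in> {6, 7}" | "i = 5" using all by blast
    then show ?thesis
    proof cases
      case 1 with r14[OF 1] d(1) show ?thesis by blast
    next
      case 2 with r67[OF 2] d(2) show ?thesis by blast
    next
      case 3 with r5 d(3,4) show ?thesis by blast
    qed
  qed
  then obtain \<pi> where \<pi>: "\<And>i. M $ i = axis (\<pi> i) 1" "\<And>i. i \<in> {1, 2, 3, 4} \<Longrightarrow> \<pi> i \<in> {1, 2, 3, 4}" "\<And>i. i \<in> {6, 7} \<Longrightarrow> \<pi> i \<in> {6, 7}" "\<pi> 5 = 5"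
    by metis
  have inj: "inj \<pi>" by (rule injI) (metis G_L_inj_rows[OF M] \<pi>(1))
  have p: "(\<lambda>i. if i \<in> S then \<pi> i else i) permutes S" if S: "finite S" "\<And>i. i \<in> S \<Longrightarrow> \<pi> i \<in> S" for S
  proof (rule bij_imp_permutes)
    have "\<pi> ` S = S" using S inj by (intro endo_inj_surj) (auto intro: inj_on_subset)
    then have "bij_betw \<pi> S S" using inj by (auto simp: bij_betw_def intro: inj_on_subset)
    then show "bij_betw (\<lambda>i. if i \<in> S then \<pi> i else i) S S" by (rule bij_betw_cong[THEN iffD1, rotated]) auto
  qed auto
  have "\<pi> = (\<lambda>i. if i \<in> {1, 2, 3, 4} then \<pi> i else i) \<circ> (\<lambda>i. if i \<in> {6, 7} then \<pi> i else i)"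
  proof
    fix i :: 7 consider "i \<in> {1, 2, 3, 4}" | "i \<in> {6, 7}" | "i = 5" using all by blast
    then show "\<pi> i = ((\<lambda>i. if i \<in> {1, 2, 3, 4} then \<pi> i else i) \<circ> (\<lambda>i. if i \<in> {6, 7} then \<pi> i else i)) i"
      by cases (use \<pi>(2)[of i] \<pi>(3)[of i] \<pi>(4) in auto)
  qed
  then have "\<pi> \<in> Sigma_perms" unfolding Sigma_perms_def using p[of "{1, 2, 3, 4}"] p[of "{6, 7}"] \<pi> by blast
  then have "perm_mat \<pi> \<in> Sigma_grp" by (simp add: Sigma_grp_eq)
  then obtain N where N: "N \<in> Sigma_grp" "perm_mat \<pi> ** N = mat 1" "N ** perm_mat \<pi> = mat 1"
    using subgroup_inverse[OF subgroup_Sigma] by metis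
  \<comment> \<open>Row \<open>i\<close> of \<open>M\<close> is the axis \<open>\<pi> i\<close>,
    whereas \<open>perm_mat\<close> is defined through columns; hence \<open>M\<close> is the
    inverse of \<open>perm_mat \<pi>\<close>.\<close>
  have "M ** perm_mat \<pi> = mat 1"
    by (simp add: vec_eq_iff row_mult \<pi>(1) row_perm_mat axis_def mat_def inj_eq[OF inj] eq_commute)
  then have "M = N" by (metis N(2) matrix_mul_assoc matrix_mul_lid matrix_mul_rid)
  with N show ?thesis by simp
qed

lemma right_coset_row_5:
  assumes "M \<in> G_L" "N \<in> G_L" "M $ 5 = N $ 5"
  obtains \<sigma> where "\<sigma> \<in> Sigma_grp" "M = \<sigma> ** N"
proof -
  obtain K where K: "K \<in> G_L" "N ** K = mat 1" "K ** N = mat 1" using subgroup_inverse[OF subgroup_G_L assms(2)] by metis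
  have "(M ** K) $ 5 = axis 5 1" using assms(3) K(2) by (metis axis_7(5) row_5_one row_mult)
  then have "M ** K \<in> Sigma_grp" using stabilizer_row_5 G_L_mult[OF assms(1) K(1)] by blast
  moreover have "M = (M ** K) ** N" using K by (simp flip: matrix_mul_assoc)
  ultimately show ?thesis using that by blast
qed

lemma Sigma_row_5: "\<sigma> \<in> Sigma_grp \<Longrightarrow> \<sigma> $ 5 = axis 5 1"
  using row_orbit0 row_orbit0_def row_mult[of "mat 1" \<sigma> 5] by (auto simp: row_5_one axis_7)

text \<open>The fifth row of a permutation matrix is an axis vector, and the only axis vector among
  the 40 rows is the fifth one.\<close>

theorem Sigma_grp_permutation_matrices: "Sigma_grp = {M \<in> G_L. \<exists>\<sigma>. bij \<sigma> \<and> M = perm_mat \<sigma>}"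
proof
  show "Sigma_grp \<subseteq> {M \<in> G_L. \<exists>\<sigma>. bij \<sigma> \<and> M = perm_mat \<sigma>}"
  proof
    fix M assume M: "M \<in> Sigma_grp"
    then obtain \<sigma> \<tau> where "M = perm_mat (\<sigma> \<circ> \<tau>)" "\<sigma> permutes {1, 2, 3, 4}" "\<tau> permutes {6, 7}"
      unfolding Sigma_grp_eq Sigma_perms_def by blast
    then show "M \<in> {M \<in> G_L. \<exists>\<sigma>. bij \<sigma> \<and> M = perm_mat \<sigma>}"
      using M Sigma_subset_G_L permutes_bij bij_comp by blast
  qed
  show "{M \<in> G_L. \<exists>\<sigma>. bij \<sigma> \<and> M = perm_mat \<sigma>} \<subseteq> Sigma_grp"
  proof safe
    fix \<sigma> :: "7 \<Rightarrow> 7" assume M: "perm_mat \<sigma> \<in> G_L" and \<sigma>: "bij \<sigma>"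
    then obtain j where j: "\<sigma> j = 5" by (metis bij_is_surj surjD)
    have "5 = \<sigma> i \<longleftrightarrow> i = j" for i using \<sigma> j by (metis bij_is_inj injD)
    then have "perm_mat \<sigma> $ 5 = axis j 1"
      by (simp add: perm_mat_def vec_eq_iff axis_def)
    moreover have "j = 5" if "axis j 1 \<in> all_rows"
    proof -
      have "j \<in> UNIV" by simp
      then show ?thesis using that unfolding UNIV_7
        by (elim insertE[of j] emptyE; simp add: axis_7 all_rows_def row_orbit_defs vector_7_eq_iff)
    qed
    ultimately have "perm_mat \<sigma> $ 5 = axis 5 1" using G_L_row_5[OF M] by auto
    then show "perm_mat \<sigma> \<in> Sigma_grp" using stabilizer_row_5 M by blast
  qed
qed

section \<open>Double cosets\<close>

lemma GL7_simps: "\<one>\<^bsub>GL7\<^esub> = mat 1" "M \<otimes>\<^bsub>GL7\<^esub> N = M ** N"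
  by (simp_all add: GL7_def)

lemma G_L_pow: "M \<in> G_L \<Longrightarrow> M [^]\<^bsub>GL7\<^esub> (n::nat) \<in> G_L"
  using one_in_Sigma Sigma_subset_G_L by (induction n) (auto simp: GL7_simps intro: G_L_mult)

lemma generators_in_G_L: "A_mat \<in> G_L" "cyc_mat [1, 2] \<in> G_L" "cyc_mat [2, 3] \<in> G_L" "cyc_mat [3, 4] \<in> G_L"
  "cyc_mat [6, 7] \<in> G_L"
  unfolding G_L_def Sigma_gens_def by (rule generate.incl, blast)+

lemma cycle_123_in_G_L: "cyc_mat [1, 2, 3] \<in> G_L"
proof -
  have "cyc_mat [1, 2, 3] = cyc_mat [1, 2] ** cyc_mat [2, 3]"
    by (simp add: perm_mat_mult)
  then show ?thesis using G_L_mult[OF generators_in_G_L(2,3)] by simp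
qed

lemma coset_reps_in_G_L: "set coset_reps \<subseteq> G_L"
  unfolding coset_reps_def using one_in_Sigma Sigma_subset_G_L
  by (auto intro!: G_L_pow G_L_mult generators_in_G_L cycle_123_in_G_L simp del: cycle_of_list.simps)

text \<open>The left factor does not affect the fifth row and the right factor moves it within its
  orbit; conversely, equal fifth rows differ by a left factor from \<open>\<Sigma>\<close>.\<close>

lemma double_coset_G_L:
  assumes "\<alpha> \<in> G_L"
  shows "double_coset GL7 Sigma_grp \<alpha> = {\<beta> \<in> G_L. \<beta> $ 5 \<in> {\<alpha> $ 5 v* \<tau> | \<tau>. \<tau> \<in> Sigma_grp}}"
proof (intro equalityI subsetI)
  fix \<beta> assume "\<beta> \<in> double_coset GL7 Sigma_grp \<alpha>"
  then obtain \<sigma> \<tau> where "\<sigma> \<in> Sigma_grp" "\<tau> \<in> Sigma_grp" "\<beta> = \<sigma> ** \<alpha> ** \<tau>"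
    by (auto simp: double_coset_def GL7_def)
  then show "\<beta> \<in> {\<beta> \<in> G_L. \<beta> $ 5 \<in> {\<alpha> $ 5 v* \<tau> | \<tau>. \<tau> \<in> Sigma_grp}}"
    using assms Sigma_subset_G_L by (auto simp: row_mult Sigma_row_5 row_axis intro!: G_L_mult)
next
  fix \<beta> assume "\<beta> \<in> {\<beta> \<in> G_L. \<beta> $ 5 \<in> {\<alpha> $ 5 v* \<tau> | \<tau>. \<tau> \<in> Sigma_grp}}"
  then obtain \<tau> where \<tau>: "\<tau> \<in> Sigma_grp" "\<beta> \<in> G_L" "\<beta> $ 5 = (\<alpha> ** \<tau>) $ 5" by (auto simp: row_mult)
  then obtain \<sigma> where "\<sigma> \<in> Sigma_grp" "\<beta> = \<sigma> ** (\<alpha> ** \<tau>)"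
    using right_coset_row_5[of \<beta> "\<alpha> ** \<tau>"] assms Sigma_subset_G_L G_L_mult by blast
  then show "\<beta> \<in> double_coset GL7 Sigma_grp \<alpha>"
    using \<tau> by (auto simp: double_coset_def GL7_def matrix_mul_assoc)
qed

lemma card_row_fibre:
  assumes "M \<in> G_L"
  shows "card {\<beta> \<in> G_L. \<beta> $ 5 = M $ 5} = 48"
proof -
  have "{\<beta> \<in> G_L. \<beta> $ 5 = M $ 5} = (\<lambda>\<sigma>. \<sigma> ** M) ` Sigma_grp"
    using assms Sigma_subset_G_L right_coset_row_5[OF _ assms]
    by (auto simp: row_mult Sigma_row_5 row_axis intro!: G_L_mult) blast
  moreover have "inj_on (\<lambda>\<sigma>. \<sigma> ** M) Sigma_grp"
  proof (rule inj_onI)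
    fix \<sigma> \<tau> assume eq: "\<sigma> ** M = \<tau> ** M"
    obtain N where "M ** N = mat 1" using subgroup_inverse[OF subgroup_G_L assms] by metis
    then show "\<sigma> = \<tau>" using eq by (metis matrix_mul_assoc matrix_mul_rid)
  qed
  ultimately show ?thesis by (simp add: card_image card_Sigma_grp)
qed

text \<open>The double coset is fibred over the orbit, each fibre being a right coset with 48
  elements.\<close>

lemma card_double_coset:
  assumes "\<alpha> \<in> G_L" and R: "{\<alpha> $ 5 v* \<tau> | \<tau>. \<tau> \<in> Sigma_grp} = R" "finite R"
  shows "card (double_coset GL7 Sigma_grp \<alpha>) = card R * 48"
proof -
  have fib: "card {\<beta> \<in> G_L. \<beta> $ 5 = r} = 48" if "r \<in> R" for r
  proof -
    from that R obtain \<tau> where "\<tau> \<in> Sigma_grp" "r = (\<alpha> ** \<tau>) $ 5" by (auto simp: row_mult)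
    then show ?thesis using card_row_fibre[of "\<alpha> ** \<tau>"] assms(1) Sigma_subset_G_L G_L_mult by auto
  qed
  have "double_coset GL7 Sigma_grp \<alpha> = (\<Union>r\<in>R. {\<beta> \<in> G_L. \<beta> $ 5 = r})"
    unfolding double_coset_G_L[OF assms(1)] R by auto
  also have "card \<dots> = (\<Sum>r\<in>R. card {\<beta> \<in> G_L. \<beta> $ 5 = r})"
  proof (rule card_UN_disjoint[OF R(2)])
    show "\<forall>r\<in>R. finite {\<beta> \<in> G_L. \<beta> $ 5 = r}" using fib by (intro ballI card_ge_0_finite) simp
  qed auto
  finally show ?thesis using fib by simp
qed

lemma Sigma_orbit_eq:
  assumes "x \<in> {y v* \<tau> | \<tau>. \<tau> \<in> Sigma_grp}"
  shows "{x v* \<tau> | \<tau>. \<tau> \<in> Sigma_grp} = {y v* \<tau> | \<tau>. \<tau> \<in> Sigma_grp}"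
proof -
  from assms obtain \<sigma> where \<sigma>: "\<sigma> \<in> Sigma_grp" "x = y v* \<sigma>" by auto
  then obtain \<rho> where \<rho>: "\<rho> \<in> Sigma_grp" "\<sigma> ** \<rho> = mat 1" using subgroup_inverse[OF subgroup_Sigma] by metis
  then have "y = x v* \<rho>" using \<sigma> by (simp add: vector_matrix_mul_assoc)
  moreover have "{u v* \<tau> | \<tau>. \<tau> \<in> Sigma_grp} \<subseteq> {v v* \<tau> | \<tau>. \<tau> \<in> Sigma_grp}" if "u = v v* \<sigma>" "\<sigma> \<in> Sigma_grp" for u v \<sigma>
    using that(2) Sigma_mult unfolding that(1) vector_matrix_mul_assoc by blast
  ultimately show ?thesis using \<sigma> \<rho> by blast
qed

lemma coset_reps_row_5:
  "map (\<lambda>\<alpha>. {\<alpha> $ 5 v* \<tau> | \<tau>. \<tau> \<in> Sigma_grp}) coset_reps = [row_orbit0, row_orbit1, row_orbit2, row_orbit3, row_orbit4, row_orbit5]"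
proof -
  have r: "M $ 5 = vector [0, 0, 0, 0, 1, 0, 0] v* M" for M :: "complex ^ 7 ^ 7"
    using row_axis[of 5 M] by (simp add: axis_7)
  show ?thesis
    unfolding coset_reps_def row_orbits[symmetric] list.map r
    by (simp add: numeral_eq_Suc GL7_simps row_actions del: cycle_of_list.simps flip: vector_matrix_mul_assoc)
qed

lemma finite_card_row_orbits:
  "map card [row_orbit0, row_orbit1, row_orbit2, row_orbit3, row_orbit4, row_orbit5] = [1, 12, 12, 12, 2, 1]"
  "\<forall>R\<in>set [row_orbit0, row_orbit1, row_orbit2, row_orbit3, row_orbit4, row_orbit5]. finite R"
  by (simp_all add: row_orbit_defs vector_7_eq_iff)

lemma disjoint_row_orbits:
  "sorted_wrt disjnt [row_orbit0, row_orbit1, row_orbit2, row_orbit3, row_orbit4, row_orbit5]"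
  by (simp add: row_orbit_defs vector_7_eq_iff)

theorem double_coset_decomposition:
  "card (double_coset GL7 Sigma_grp ` G_L) = 6"
  "double_coset GL7 Sigma_grp ` G_L = set (map (double_coset GL7 Sigma_grp) coset_reps)"
  "map (\<lambda>\<alpha>. card (double_coset GL7 Sigma_grp \<alpha>)) coset_reps = [1 * 48, 12 * 48, 12 * 48, 12 * 48, 2 * 48, 1 * 48]"
proof -
  define orb where "orb \<alpha> = {\<alpha> $ 5 v* \<tau> | \<tau>. \<tau> \<in> Sigma_grp}" for \<alpha> :: "complex ^ 7 ^ 7"
  define Rs where "Rs = [row_orbit0, row_orbit1, row_orbit2, row_orbit3, row_orbit4, row_orbit5]"
  have D: "double_coset GL7 Sigma_grp \<alpha> = {\<beta> \<in> G_L. \<beta> $ 5 \<in> orb \<alpha>}" if "\<alpha> \<in> G_L" for \<alpha>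
    unfolding orb_def by (rule double_coset_G_L[OF that])
  have orbs: "map orb coset_reps = Rs"
    unfolding orb_def Rs_def by (rule coset_reps_row_5)
  have self: "\<alpha> $ 5 \<in> orb \<alpha>" for \<alpha> unfolding orb_def by (rule Sigma_orbit_base)
  show eq: "double_coset GL7 Sigma_grp ` G_L = set (map (double_coset GL7 Sigma_grp) coset_reps)"
  proof
    show "double_coset GL7 Sigma_grp ` G_L \<subseteq> set (map (double_coset GL7 Sigma_grp) coset_reps)"
    proof
      fix X assume "X \<in> double_coset GL7 Sigma_grp ` G_L"
      then obtain \<alpha> where \<alpha>: "\<alpha> \<in> G_L" "X = double_coset GL7 Sigma_grp \<alpha>" by auto
      have "\<alpha> $ 5 \<in> \<Union> (set Rs)" using G_L_row_5[OF \<alpha>(1)] by (auto simp: all_rows_def Rs_def)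
      then obtain \<beta> where \<beta>: "\<beta> \<in> set coset_reps" "\<alpha> $ 5 \<in> orb \<beta>" unfolding orbs[symmetric] by auto
      then have "orb \<alpha> = orb \<beta>" unfolding orb_def by (intro Sigma_orbit_eq)
      then have "X = double_coset GL7 Sigma_grp \<beta>" using \<alpha> \<beta> coset_reps_in_G_L D by auto
      then show "X \<in> set (map (double_coset GL7 Sigma_grp) coset_reps)" using \<beta> by auto
    qed
    show "set (map (double_coset GL7 Sigma_grp) coset_reps) \<subseteq> double_coset GL7 Sigma_grp ` G_L"
      using coset_reps_in_G_L by auto
  qed
  have "sorted_wrt (\<lambda>\<alpha> \<beta>. disjnt (orb \<alpha>) (orb \<beta>)) coset_reps"
    using disjoint_row_orbits unfolding Rs_def[symmetric] orbs[symmetric] by (simp add: sorted_wrt_map)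
  then have "sorted_wrt (\<lambda>\<alpha> \<beta>. double_coset GL7 Sigma_grp \<alpha> \<noteq> double_coset GL7 Sigma_grp \<beta>) coset_reps"
  proof (rule sorted_wrt_mono_rel[rotated])
    fix \<alpha> \<beta> assume ab: "\<alpha> \<in> set coset_reps" "\<beta> \<in> set coset_reps" "disjnt (orb \<alpha>) (orb \<beta>)"
    then have "\<alpha> \<in> double_coset GL7 Sigma_grp \<alpha>" "\<alpha> \<notin> double_coset GL7 Sigma_grp \<beta>"
      using coset_reps_in_G_L self[of \<alpha>] D by (auto simp: disjnt_iff)
    then show "double_coset GL7 Sigma_grp \<alpha> \<noteq> double_coset GL7 Sigma_grp \<beta>" by auto
  qed
  then have "distinct (map (double_coset GL7 Sigma_grp) coset_reps)"
    unfolding distinct_conv_nth sorted_wrt_iff_nth_less by (metis length_map nth_map linorder_neqE_nat)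
  from distinct_card[OF this] show "card (double_coset GL7 Sigma_grp ` G_L) = 6"
    unfolding eq by (simp add: coset_reps_def)
  have "map (\<lambda>\<alpha>. card (double_coset GL7 Sigma_grp \<alpha>)) coset_reps = map (\<lambda>\<alpha>. card (orb \<alpha>) * 48) coset_reps"
  proof (rule map_cong[OF refl])
    fix \<alpha> assume \<alpha>: "\<alpha> \<in> set coset_reps"
    then have "orb \<alpha> \<in> set Rs" unfolding orbs[symmetric] by auto
    then show "card (double_coset GL7 Sigma_grp \<alpha>) = card (orb \<alpha>) * 48"
      using \<alpha> coset_reps_in_G_L finite_card_row_orbits(2) unfolding Rs_def[symmetric]
      by (intro card_double_coset) (auto simp: orb_def)
  qed
  also have "\<dots> = map (\<lambda>n. n * 48) (map card Rs)" unfolding orbs[symmetric] by simp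
  also have "\<dots> = [1 * 48, 12 * 48, 12 * 48, 12 * 48, 2 * 48, 1 * 48]"
    using finite_card_row_orbits(1) unfolding Rs_def[symmetric] by simp
  finally show "map (\<lambda>\<alpha>. card (double_coset GL7 Sigma_grp \<alpha>)) coset_reps = [1 * 48, 12 * 48, 12 * 48, 12 * 48, 2 * 48, 1 * 48]" .
qed

section \<open>Analytic continuation and invariance\<close>

definition dot :: "complex ^ 7 \<Rightarrow> complex ^ 7 \<Rightarrow> complex" where
  "dot r x = (\<Sum>i\<in>UNIV. r $ i * x $ i)"

lemma dot_vector_matrix: "dot (r v* M) x = dot r (M *v x)"
proof -
  have "dot (r v* M) x = (\<Sum>j\<in>UNIV. \<Sum>i\<in>UNIV. r $ i * M $ i $ j * x $ j)"
    unfolding dot_def vector_matrix_mult_def by (simp add: sum_distrib_left sum_distrib_right mult_ac)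
  also have "\<dots> = (\<Sum>i\<in>UNIV. \<Sum>j\<in>UNIV. r $ i * M $ i $ j * x $ j)" by (rule sum.swap)
  also have "\<dots> = dot r (M *v x)"
    unfolding dot_def matrix_vector_mult_def by (simp add: sum_distrib_left mult_ac)
  finally show ?thesis .
qed

lemma matrix_vector_dot: "(M *v x) $ i = dot (M $ i) x"
  by (simp add: dot_def matrix_vector_mult_def)

definition hyperplane :: "(complex ^ 7) set" where
  "hyperplane = {x. dot (vector [-1, -1, -1, -1, 1, 1, 1]) x = 1}"

lemma hyperplane_iff: "x \<in> hyperplane \<longleftrightarrow> x $ 5 + x $ 6 + x $ 7 - x $ 1 - x $ 2 - x $ 3 - x $ 4 = 1"
  by (simp add: hyperplane_def dot_def sum_7 algebra_simps)

lemma G_L_preserves_hyperplane: "M \<in> G_L \<Longrightarrow> x \<in> hyperplane \<Longrightarrow> M *v x \<in> hyperplane"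
  unfolding hyperplane_def using G_L_hyperplane[of M] by (simp flip: dot_vector_matrix)

definition Lv :: "complex ^ 7 \<Rightarrow> complex" where
  "Lv x = Lr (x $ 1) (x $ 2) (x $ 3) (x $ 4) (x $ 5) (x $ 6) (x $ 7)"

lemma F43r_eq_F43:
  assumes "balanced a b c d e f g" "e \<notin> \<int>\<^sub>\<le>\<^sub>0" "f \<notin> \<int>\<^sub>\<le>\<^sub>0" "g \<notin> \<int>\<^sub>\<le>\<^sub>0"
  shows "F43r a b c d e f g = F43 a b c d e f g * (rGamma e * rGamma f * rGamma g)"
proof -
  define t where "t n = pochhammer a n * pochhammer b n * pochhammer c n * pochhammer d n /
          (fact n * pochhammer e n * pochhammer f n * pochhammer g n)" for n
  define r where "r = rGamma e * rGamma f * rGamma g"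
  have r: "r \<noteq> 0" unfolding r_def using assms by (simp add: rGamma_eq_zero_iff)
  have rg: "rGamma (x + of_nat n) = rGamma x / pochhammer x n" if "x \<notin> \<int>\<^sub>\<le>\<^sub>0" for x :: complex and n
    using pochhammer_rGamma[of x n] pochhammer_eq_0_imp_nonpos_Int[of x n] that by (auto simp: field_simps)
  have T: "F43r_term a b c d e f g = (\<lambda>n. r * t n)"
    unfolding F43r_term_def t_def r_def using assms by (simp add: rg mult_ac)
  have "summable t" using F43r_summable[OF assms(1)] r unfolding T by (simp add: summable_cmult_iff)
  then have "F43r a b c d e f g = r * suminf t" unfolding F43r_def T by (rule suminf_mult)
  then show ?thesis by (simp add: F43_def t_def[abs_def] r_def)
qed

lemma balanced_dual:
  "balanced a b c d e f g \<Longrightarrow> balanced (1 + a - e) (1 + b - e) (1 + c - e) (1 + d - e) (2 - e) (1 + f - e) (1 + g - e)"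
  by (simp add: balanced_def algebra_simps)

lemma L_eq_Lv:
  assumes "x \<in> hyperplane" "L_defined x"
  shows "L x = Lv x"
proof -
  obtain a b c d e f g where x: "x = vector [a, b, c, d, e, f, g]" by (rule vector_7_cases)
  have bal: "balanced a b c d e f g" using assms(1) by (simp add: x hyperplane_iff balanced_def)
  have ni: "e \<notin> \<int>" "f \<notin> \<int>\<^sub>\<le>\<^sub>0" "g \<notin> \<int>\<^sub>\<le>\<^sub>0" "1 + f - e \<notin> \<int>\<^sub>\<le>\<^sub>0" "1 + g - e \<notin> \<int>\<^sub>\<le>\<^sub>0"
    using assms(2) by (auto simp: L_defined_def x)
  then have e: "e \<notin> \<int>\<^sub>\<le>\<^sub>0" using nonpos_Ints_Int by blast
  have e2: "2 - e \<notin> \<int>\<^sub>\<le>\<^sub>0"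
  proof
    assume "2 - e \<in> \<int>\<^sub>\<le>\<^sub>0"
    then have "2 - (2 - e) \<in> \<int>" by (intro Ints_diff Ints_numeral nonpos_Ints_Int)
    with ni(1) show False by simp
  qed
  have sym: "F43 p q r s t u v = F43 p q r s u v t" for p q r s t u v
    unfolding F43_def by (simp add: mult_ac)
  show ?thesis
    unfolding L_def Lv_def Lr_def x vector_7_nth Let_def
      F43r_eq_F43[OF bal e ni(2,3)] F43r_eq_F43[OF balanced_dual[OF bal] e2 ni(4,5)]
      sym[of _ _ _ _ "2 - e"]
    by (simp add: diff_divide_distrib mult_ac)
qed

lemma sin_pi_eq_0_iff: "sin (complex_of_real pi * z) = 0 \<longleftrightarrow> z \<in> \<int>"
proof -
  have "sin (complex_of_real pi * z) = 0 \<longleftrightarrow> (\<exists>n::int. complex_of_real pi * z = of_real (real_of_int n * pi))"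
    using sin_eq_0 by (simp only: mult.commute)
  also have "\<dots> \<longleftrightarrow> (\<exists>n::int. z = of_int n)"
    by (simp add: mult.commute)
  finally show ?thesis by (auto simp: Ints_def)
qed

lemma Lr_holomorphic:
  assumes S: "open S"
    and hol: "a holomorphic_on S" "b holomorphic_on S" "c holomorphic_on S" "d holomorphic_on S"
    "e holomorphic_on S" "f holomorphic_on S" "g holomorphic_on S"
    and bal: "\<And>s. s \<in> S \<Longrightarrow> balanced (a s) (b s) (c s) (d s) (e s) (f s) (g s)"
    and e: "\<And>s. s \<in> S \<Longrightarrow> e s \<notin> \<int>"
  shows "(\<lambda>s. Lr (a s) (b s) (c s) (d s) (e s) (f s) (g s)) holomorphic_on S"
proof -
  have h: "(\<lambda>s. 1 + a s - e s) holomorphic_on S" "(\<lambda>s. 1 + b s - e s) holomorphic_on S" "(\<lambda>s. 1 + c s - e s) holomorphic_on S"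
    "(\<lambda>s. 1 + d s - e s) holomorphic_on S" "(\<lambda>s. 2 - e s) holomorphic_on S" "(\<lambda>s. 1 + f s - e s) holomorphic_on S" "(\<lambda>s. 1 + g s - e s) holomorphic_on S"
    by (intro holomorphic_intros hol)+
  have sn: "sin (complex_of_real pi * e s) \<noteq> 0" if "s \<in> S" for s
    using e[OF that] by (simp add: sin_pi_eq_0_iff)
  have F1: "(\<lambda>s. F43r (a s) (b s) (c s) (d s) (e s) (f s) (g s)) holomorphic_on S"
    using bal by (intro F43r_holomorphic S hol)
  have F2: "(\<lambda>s. F43r (1 + a s - e s) (1 + b s - e s) (1 + c s - e s) (1 + d s - e s) (2 - e s) (1 + f s - e s) (1 + g s - e s)) holomorphic_on S"
    using bal by (intro F43r_holomorphic S h balanced_dual)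
  show ?thesis
    unfolding Lr_def by (intro holomorphic_intros F1 F2 hol h) (use sn in auto)
qed

section \<open>Continuation along quadratic curves\<close>

text \<open>Each integer is attained at finitely many \<open>s\<close>, since \<open>u\<close> is
  not an integer and so the polynomial is not zero. Countability is what keeps the complement of the
  bad points connected.\<close>

lemma countable_quadratic_Ints:
  fixes u v w :: complex
  assumes "u \<notin> \<int>"
  shows "countable {s. u + s * v + s^2 * w \<in> \<int>}"
proof -
  have "finite {s. u + s * v + s^2 * w = n}" if "n \<in> \<int>" for n
  proof -
    have "[:u - n, v, w:] \<noteq> 0" using assms that by auto
    then have "finite {s. poly [:u - n, v, w:] s = 0}" by (rule poly_roots_finite)
    also have "{s. poly [:u - n, v, w:] s = 0} = {s. u + s * v + s^2 * w = n}"
      by (auto simp: algebra_simps power2_eq_square eq_diff_eq)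
    finally show ?thesis .
  qed
  moreover have "countable (\<int> :: complex set)" unfolding Ints_def by (intro countable_image) auto
  moreover have "{s. u + s * v + s^2 * w \<in> \<int>} = (\<Union>n\<in>\<int>. {s. u + s * v + s^2 * w = n})" by auto
  ultimately show ?thesis by (simp add: countable_UN countable_finite)
qed

definition real_vec :: "complex ^ 7 \<Rightarrow> bool" where
  "real_vec x \<longleftrightarrow> (\<forall>i. x $ i \<in> \<real>)"

text \<open>Expressed through \<open>Lv\<close>, so that only the two fifth coordinates must avoid
  the integers, a condition invisible to the other parameters.\<close>

definition Lv_invariant :: "complex ^ 7 ^ 7 \<Rightarrow> bool" where
  "Lv_invariant M \<longleftrightarrow> (\<forall>x\<in>hyperplane. x $ 5 \<notin> \<int> \<longrightarrow> (M *v x) $ 5 \<notin> \<int> \<longrightarrow> Lv (M *v x) = Lv x)"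

text \<open>
  The curve \<open>s \<mapsto> x0 + s w1 + s\<^sup>2 w2\<close> with real \<open>w1, w2\<close> is real for real \<open>s\<close>, and it can be chosen to
  reach an arbitrary point of the hyperplane at \<open>s = 1 + \<i>\<close>.
\<close>

lemma Lv_invariantI:
  fixes x0 :: "complex ^ 7"
  assumes M: "\<And>x. x \<in> hyperplane \<Longrightarrow> M *v x \<in> hyperplane"
    and U: "open U" and x0: "x0 \<in> U" "x0 \<in> hyperplane" "real_vec x0" "x0 $ 5 \<notin> \<int>" "(M *v x0) $ 5 \<notin> \<int>"
    and eq: "\<And>x. x \<in> U \<Longrightarrow> x \<in> hyperplane \<Longrightarrow> real_vec x \<Longrightarrow> Lv (M *v x) = Lv x"
  shows "Lv_invariant M"
  unfolding Lv_invariant_def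
proof (intro ballI impI)
  fix x :: "complex ^ 7" assume x: "x \<in> hyperplane" "x $ 5 \<notin> \<int>" "(M *v x) $ 5 \<notin> \<int>"
  \<comment> \<open>At \<open>s = 1 + \<i>\<close> one has \<open>s^2 = 2 * \<i>\<close>, so
    \<open>s * w1 + s^2 * w2\<close> has real part \<open>w1\<close> and imaginary part
    \<open>w1 + 2 * w2\<close>; solving for \<open>x - x0\<close> gives these formulas.\<close>
  define w1 :: "complex ^ 7" where "w1 = (\<chi> i. of_real (Re (x $ i - x0 $ i)))"
  define w2 :: "complex ^ 7" where "w2 = (\<chi> i. of_real ((Im (x $ i - x0 $ i) - Re (x $ i - x0 $ i)) / 2))"
  define X where "X s = x0 + s *s w1 + s^2 *s w2" for s
  define \<sigma> where "\<sigma> = 1 + \<i>"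
  have Xi: "X s $ i = x0 $ i + s * w1 $ i + s^2 * w2 $ i" for s i by (simp add: X_def)
  have X0: "X 0 = x0" by (simp add: X_def)
  have X\<sigma>: "X \<sigma> = x"
    by (simp add: vec_eq_iff Xi w1_def w2_def \<sigma>_def complex_eq_iff power2_eq_square field_simps)
  have MX: "(M *v X s) $ i = (M *v x0) $ i + s * (M *v w1) $ i + s^2 * (M *v w2) $ i" for s i
    by (simp add: X_def matrix_vector_right_distrib vector_scalar_commute)
  have hp: "X s \<in> hyperplane" for s
  proof -
    have "x $ 5 + x $ 6 + x $ 7 - x $ 1 - x $ 2 - x $ 3 - x $ 4 = 1" "x0 $ 5 + x0 $ 6 + x0 $ 7 - x0 $ 1 - x0 $ 2 - x0 $ 3 - x0 $ 4 = 1"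
      using x(1) x0(2) by (auto simp: hyperplane_iff)
    then have "w1 $ 5 + w1 $ 6 + w1 $ 7 - w1 $ 1 - w1 $ 2 - w1 $ 3 - w1 $ 4 = 0"
      "w2 $ 5 + w2 $ 6 + w2 $ 7 - w2 $ 1 - w2 $ 2 - w2 $ 3 - w2 $ 4 = 0"
      by (auto simp: w1_def w2_def complex_eq_iff field_simps)
    moreover have "X s $ 5 + X s $ 6 + X s $ 7 - X s $ 1 - X s $ 2 - X s $ 3 - X s $ 4
      = (x0 $ 5 + x0 $ 6 + x0 $ 7 - x0 $ 1 - x0 $ 2 - x0 $ 3 - x0 $ 4)
        + s * (w1 $ 5 + w1 $ 6 + w1 $ 7 - w1 $ 1 - w1 $ 2 - w1 $ 3 - w1 $ 4)
        + s^2 * (w2 $ 5 + w2 $ 6 + w2 $ 7 - w2 $ 1 - w2 $ 2 - w2 $ 3 - w2 $ 4)"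
      unfolding Xi by (simp add: algebra_simps)
    ultimately show ?thesis using x0(2) by (simp add: hyperplane_iff)
  qed
  \<comment> \<open>The parameters at which one of the two sides is singular: a closed, countable
    set, so its complement is open and connected.\<close>
  define B where "B = {s. x0 $ 5 + s * w1 $ 5 + s^2 * w2 $ 5 \<in> \<int>} \<union> {s. (M *v x0) $ 5 + s * (M *v w1) $ 5 + s^2 * (M *v w2) $ 5 \<in> \<int>}"
  define S where "S = - B"
  have B: "s \<in> B \<longleftrightarrow> X s $ 5 \<in> \<int> \<or> (M *v X s) $ 5 \<in> \<int>" for s by (simp add: B_def Xi MX)
  have "countable B" unfolding B_def using x0 by (intro countable_Un countable_quadratic_Ints)
  then have conn: "connected S" unfolding S_def
    by (intro path_connected_imp_connected path_connected_complement_countable) auto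
  have "closed ((\<lambda>s. u + s * v + s^2 * w) -` \<int>)" for u v w :: complex
    by (intro closed_vimage closed_Ints continuous_intros)
  then have "closed B" unfolding B_def vimage_def by (intro closed_Un)
  then have opn: "open S" unfolding S_def by auto
  have hol: "(\<lambda>s. Lv (M *v X s) - Lv (X s)) holomorphic_on S"
  proof (intro holomorphic_on_diff)
    show "(\<lambda>s. Lv (X s)) holomorphic_on S"
      unfolding Lv_def
    proof (intro Lr_holomorphic opn)
      show "balanced (X s $ 1) (X s $ 2) (X s $ 3) (X s $ 4) (X s $ 5) (X s $ 6) (X s $ 7)" for s
        using hp by (simp add: hyperplane_iff balanced_def)
      show "X s $ 5 \<notin> \<int>" if "s \<in> S" for s using that B by (auto simp: S_def)
    qed (unfold Xi, (intro holomorphic_intros)+)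
    show "(\<lambda>s. Lv (M *v X s)) holomorphic_on S"
      unfolding Lv_def
    proof (intro Lr_holomorphic opn)
      show "balanced ((M *v X s) $ 1) ((M *v X s) $ 2) ((M *v X s) $ 3) ((M *v X s) $ 4) ((M *v X s) $ 5) ((M *v X s) $ 6) ((M *v X s) $ 7)" for s
        using M[OF hp] by (simp add: hyperplane_iff balanced_def)
      show "(M *v X s) $ 5 \<notin> \<int>" if "s \<in> S" for s using that B by (auto simp: S_def)
    qed (unfold MX, (intro holomorphic_intros)+)
  qed
  have "continuous_on UNIV (\<lambda>s. \<chi> i. x0 $ i + s * w1 $ i + s^2 * w2 $ i)"
    by (intro continuous_intros)
  also have "(\<lambda>s. \<chi> i. x0 $ i + s * w1 $ i + s^2 * w2 $ i) = X"
    by (simp add: fun_eq_iff vec_eq_iff Xi)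
  finally have "continuous_on UNIV X" .
  then have "open (X -` U)" using U by (simp add: open_vimage)
  moreover have "0 \<in> X -` U" using X0 x0 by simp
  moreover have S0: "0 \<in> S" using x0 by (simp add: S_def B X0)
  ultimately obtain r where r: "r > 0" "ball 0 r \<subseteq> X -` U \<inter> S"
    using open_contains_ball opn by (metis IntI open_Int)
  \<comment> \<open>The identity is known only at real points, but small positive reals already
    accumulate at 0, which lies in the domain.\<close>
  have isl: "0 islimpt {complex_of_real t |t. 0 < t \<and> t < r}"
    unfolding islimpt_approachable
  proof (intro allI impI)
    fix \<epsilon> :: real assume \<epsilon>: "\<epsilon> > 0"
    define t where "t = min \<epsilon> r / 2"
    have "0 < t" "t < r" "t < \<epsilon>" using \<epsilon> r(1) by (auto simp: t_def)
    then show "\<exists>s\<in>{complex_of_real t |t. 0 < t \<and> t < r}. s \<noteq> 0 \<and> dist s 0 < \<epsilon>"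
      by (intro bexI[of _ "complex_of_real t"]) auto
  qed
  have "Lv (M *v X \<sigma>) - Lv (X \<sigma>) = 0"
  proof (rule analytic_continuation[OF hol opn conn _ S0 isl])
    show "{complex_of_real t |t. 0 < t \<and> t < r} \<subseteq> S" using r(2) by auto
    show "\<sigma> \<in> S" using x by (simp add: S_def B X\<sigma>)
    fix s assume "s \<in> {complex_of_real t |t. 0 < t \<and> t < r}"
    then obtain t where t: "s = of_real t" "0 < t" "t < r" by auto
    then have "s \<in> ball 0 r" by simp
    then have "X s \<in> U" using r(2) by auto
    moreover have "real_vec (X s)"
      using x0(3) unfolding real_vec_def Xi t w1_def w2_def by auto
    ultimately show "Lv (M *v X s) - Lv (X s) = 0" using eq[OF _ hp] by simp
  qed
  then show "Lv (M *v x) = Lv x" by (simp add: X\<sigma>)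
qed

lemma Lv_invariantD:
  "Lv_invariant M \<Longrightarrow> x \<in> hyperplane \<Longrightarrow> x $ 5 \<notin> \<int> \<Longrightarrow> (M *v x) $ 5 \<notin> \<int> \<Longrightarrow> Lv (M *v x) = Lv x"
  by (simp add: Lv_invariant_def)

lemma open_not_Ints_row: "open {x :: complex ^ 7. (M *v x) $ 5 \<notin> \<int>}"
proof -
  have "closed ((\<lambda>x :: complex ^ 7. \<Sum>j\<in>UNIV. M $ 5 $ j * x $ j) -` \<int>)"
    by (intro closed_vimage closed_Ints continuous_intros)
  then show ?thesis by (simp add: open_closed vimage_def Compl_eq matrix_vector_mult_def)
qed

text \<open>Slightly off the centre \<open>(1/2, 1/2, 1/2, 1/2, 1, 1, 1)\<close>, where every row takes the value 1.\<close>

definition generic_point :: "complex ^ 7" where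
  "generic_point = vector [50/100, 51/100, 53/100, 57/100, 61/100, 120/100, 130/100]"

lemma not_Ints_Re: "0 < Re z \<and> Re z < 1 \<or> 1 < Re z \<and> Re z < 2 \<Longrightarrow> z \<notin> \<int>"
proof
  assume z: "0 < Re z \<and> Re z < 1 \<or> 1 < Re z \<and> Re z < 2" "z \<in> \<int>"
  then obtain n :: int where "z = of_int n" by (auto elim: Ints_cases)
  then show False using z(1) by auto
qed

text \<open>All 40 values of the fifth coordinate on the orbit of this point lie strictly between 0
  and 2 and differ from 1.\<close>

lemma generic_point: "generic_point \<in> hyperplane" "real_vec generic_point"
  "M \<in> G_L \<Longrightarrow> (M *v generic_point) $ 5 \<notin> \<int>"
proof -
  show "generic_point \<in> hyperplane" by (simp add: hyperplane_iff generic_point_def)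
  show "real_vec generic_point" unfolding real_vec_def forall_7 by (simp add: generic_point_def)
  have "dot r generic_point \<notin> \<int>" if "r \<in> all_rows" for r
    using that unfolding all_rows_def row_orbit_defs
    by (elim UnE insertE emptyE; intro not_Ints_Re; simp add: dot_def sum_7 generic_point_def)
  then show "M \<in> G_L \<Longrightarrow> (M *v generic_point) $ 5 \<notin> \<int>"
    using G_L_row_5 by (simp add: matrix_vector_dot)
qed

text \<open>The two identities can be chained only where \<open>N *v x\<close> has a non-integral
  fifth coordinate, which the conclusion does not assume. They are chained on an open set around
  \<open>generic_point\<close>, and continuation supplies the missing points.\<close>

lemma Lv_invariant_mult:
  assumes G: "M \<in> G_L" "N \<in> G_L" and inv: "Lv_invariant M" "Lv_invariant N"
  shows "Lv_invariant (M ** N)"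
proof (rule Lv_invariantI[where ?x0.0 = generic_point])
  define U where "U = {x. x $ 5 \<notin> \<int>} \<inter> {x. (N *v x) $ 5 \<notin> \<int>} \<inter> {x. (M ** N *v x) $ 5 \<notin> \<int>}"
  show "open U"
    unfolding U_def using open_not_Ints_row[of "mat 1"] by (intro open_Int open_not_Ints_row) simp
  have mat1: "mat 1 \<in> G_L" using one_in_Sigma Sigma_subset_G_L by auto
  show "generic_point $ 5 \<notin> \<int>" "(M ** N *v generic_point) $ 5 \<notin> \<int>"
    using generic_point(3)[OF mat1] generic_point(3)[OF G_L_mult[OF G]] by auto
  then show "generic_point \<in> U" using generic_point(3)[OF G(2)] by (simp add: U_def)
  show "generic_point \<in> hyperplane" "real_vec generic_point" by (fact generic_point)+
  show "M ** N *v x \<in> hyperplane" if "x \<in> hyperplane" for x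
    using that G by (intro G_L_preserves_hyperplane G_L_mult)
  show "Lv (M ** N *v x) = Lv x" if "x \<in> U" "x \<in> hyperplane" for x
    using that Lv_invariantD[OF inv(1), of "N *v x"] Lv_invariantD[OF inv(2), of x] G_L_preserves_hyperplane[OF G(2)]
    by (auto simp: U_def simp flip: matrix_vector_mul_assoc)
qed

lemma Lr_symmetric:
  "Lr a b c d e f g = Lr b a c d e f g" "Lr a b c d e f g = Lr a c b d e f g" "Lr a b c d e f g = Lr a b d c e f g"
  "Lr a b c d e f g = Lr a b c d e g f"
  by (simp_all add: Lr_def F43r_def F43r_term_def mult_ac)

lemma Lv_invariant_Sigma_gens: "h \<in> Sigma_gens \<Longrightarrow> Lv_invariant h"
  unfolding Lv_invariant_def
proof (intro ballI impI)
  fix x assume "h \<in> Sigma_gens"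
  then show "Lv (h *v x) = Lv x"
    unfolding Sigma_gens_def
    by (cases x rule: vector_7_cases; elim insertE emptyE;
        simp add: vector_actions Lv_def Lr_symmetric del: cycle_of_list.simps; fact Lr_symmetric)
qed

section \<open>The basic invariance and its extension to the whole group\<close>

definition swap_mat :: "complex ^ 7 ^ 7" where
  "swap_mat = (cyc_mat [1, 2, 3] ** cyc_mat [6, 7] ** A_mat) [^]\<^bsub>GL7\<^esub> (2::nat)"

lemma swap_mat_in_G_L: "swap_mat \<in> G_L"
  using coset_reps_in_G_L by (simp add: coset_reps_def swap_mat_def)

lemma swap_mat_vector:
  "swap_mat *v vector [a, b, c, d, e, f, g] =
    vector [f + g - b - c - d, g - c, a, f - c, e + f + g - b - c - c - d, f + g - c - d, f + g - b - c]"
  by (simp add: swap_mat_def numeral_eq_Suc GL7_simps vector_actions vector_7_eq_iff algebra_simps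
      del: cycle_of_list.simps flip: matrix_vector_mul_assoc)

text \<open>This word expresses the generator \<open>A_mat\<close> by \<open>swap_mat\<close> and
  \<open>\<Sigma>\<close>, so one analytic identity is enough. It is verified as an identity of
  linear forms on a general vector.\<close>

lemma A_mat_factorization:
  "A_mat = cyc_mat [6, 7] ** (swap_mat ** (cyc_mat [1, 2] ** (cyc_mat [2, 3] ** (swap_mat ** (cyc_mat [1, 2] ** swap_mat)))))"
  unfolding matrix_eq
proof
  fix x :: "complex ^ 7"
  show "A_mat *v x = cyc_mat [6, 7] ** (swap_mat ** (cyc_mat [1, 2] ** (cyc_mat [2, 3] ** (swap_mat ** (cyc_mat [1, 2] ** swap_mat))))) *v x"
    by (cases x rule: vector_7_cases)
       (simp add: vector_actions swap_mat_vector vector_7_eq_iff algebra_simps del: cycle_of_list.simps flip: matrix_vector_mul_assoc)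
qed

lemma Lv_invariant_swap_mat: "Lv_invariant swap_mat"
proof (rule Lv_invariantI[where ?x0.0 = "vector [1/2, 1/2, 3/4, 1/2, 1/4, 3/2, 3/2]"])
  \<comment> \<open>The hypotheses of \<open>Lr_swap_real\<close> with \<open>b, d, a, c\<close> in
    the places of \<open>a, b, c, d\<close>, written as strict inequalities between real parts to
    obtain an open set.\<close>
  define U :: "(complex ^ 7) set" where "U = {x. 0 < Re (x $ 1)} \<inter> {x. 0 < Re (x $ 2)} \<inter> {x. 0 < Re (x $ 4)}
    \<inter> {x. Re (x $ 3) < Re (x $ 6)} \<inter> {x. Re (x $ 3) < Re (x $ 7)} \<inter> {x. 0 < Re (x $ 5)} \<inter> {x. Re (x $ 5) < 1}
    \<inter> {x. Re (x $ 1) < Re (x $ 3)} \<inter> {x. Re (x $ 3) < Re (x $ 1) + 1}"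
  show "open U" unfolding U_def by (intro open_Int open_Collect_less continuous_intros)
  let ?x = "vector [1/2, 1/2, 3/4, 1/2, 1/4, 3/2, 3/2] :: complex ^ 7"
  show "?x \<in> U" by (simp add: U_def)
  show "?x \<in> hyperplane" by (simp add: hyperplane_iff)
  show "real_vec ?x" unfolding real_vec_def forall_7 by simp
  show "?x $ 5 \<notin> \<int>" by (intro not_Ints_Re) simp
  show "(swap_mat *v ?x) $ 5 \<notin> \<int>" unfolding swap_mat_vector vector_7_nth by (intro not_Ints_Re) simp
  show "swap_mat *v x \<in> hyperplane" if "x \<in> hyperplane" for x
    using that swap_mat_in_G_L by (rule G_L_preserves_hyperplane[rotated])
  fix x assume x: "x \<in> U" "x \<in> hyperplane" "real_vec x"
  then have "\<forall>i. \<exists>y. x $ i = of_real y" unfolding real_vec_def by (auto elim!: Reals_cases)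
  then obtain y where y: "\<And>i. x $ i = of_real (y i)" by metis
  define a b c d e f g where yd: "a = y 1" "b = y 2" "c = y 3" "d = y 4" "e = y 5" "f = y 6" "g = y 7"
  have xv: "x = vector [of_real a, of_real b, of_real c, of_real d, of_real e, of_real f, of_real g]"
    unfolding vec_eq_iff forall_7 by (simp add: y yd)
  have ineq: "0 < a" "0 < b" "0 < d" "c < f" "c < g" "0 < e" "e < 1" "a < c" "c < a + 1"
    using x(1) by (auto simp: U_def xv)
  have "complex_of_real (e + f + g - a - b - c - d) = of_real 1"
    using x(2) by (simp add: xv hyperplane_iff)
  then have bal: "e + f + g - a - b - c - d = 1" by (simp only: of_real_eq_iff)
  \<comment> \<open>In this order the parameters produced by the interchange agree with those of
    \<open>swap_mat\<close> up to permutations under which \<open>Lr\<close> is symmetric.\<close>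
  have "Lr (of_real b) (of_real d) (of_real a) (of_real c) (of_real e) (of_real f) (of_real g)
     = Lr (of_real (f - c)) (of_real (g - c)) (of_real a) (of_real (1 + a - e)) (of_real (1 + a - c)) (of_real (1 + b + a - e)) (of_real (1 + d + a - e))"
    using bal ineq by (intro Lr_swap_real) auto
  moreover have "swap_mat *v x = vector [of_real (1 + a - e), of_real (g - c), of_real a, of_real (f - c), of_real (1 + a - c), of_real (1 + b + a - e), of_real (1 + d + a - e)]"
  proof -
    have e: "e = 1 + a + b + c + d - f - g" using bal by simp
    show ?thesis unfolding xv swap_mat_vector e by (simp add: vector_7_eq_iff algebra_simps)
  qed
  ultimately show "Lv (swap_mat *v x) = Lv x"
    by (simp add: Lv_def xv) (metis Lr_symmetric)
qed

theorem Lv_invariant_G_L: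
  assumes "M \<in> G_L"
  shows "Lv_invariant M"
  using assms unfolding G_L_def
proof (rule generate_induct_involutions)
  show "Lv_invariant (mat 1)" by (simp add: Lv_invariant_def)
  have "Lv_invariant A_mat"
    by (subst A_mat_factorization) (intro Lv_invariant_mult Lv_invariant_swap_mat Lv_invariant_Sigma_gens swap_mat_in_G_L generators_in_G_L G_L_mult;
      simp add: Sigma_gens_def del: cycle_of_list.simps)
  then show "Lv_invariant h" if "h \<in> insert A_mat Sigma_gens" for h
    using that Lv_invariant_Sigma_gens by auto
  show "Lv_invariant (M ** N)" if "M \<in> generate GL7 (insert A_mat Sigma_gens)" "N \<in> generate GL7 (insert A_mat Sigma_gens)"
     "Lv_invariant M" "Lv_invariant N" for M N
    using that by (intro Lv_invariant_mult) (auto simp: G_L_def)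
qed auto

lemma L_invariant_G_L:
  assumes "M \<in> G_L" "x \<in> hyperplane" "M *v x = y" "L_defined x" "L_defined y"
  shows "L x = L y"
proof -
  have y: "y \<in> hyperplane" using G_L_preserves_hyperplane assms by auto
  have "x $ 5 \<notin> \<int>" "y $ 5 \<notin> \<int>" using assms by (auto simp: L_defined_def Let_def)
  then have "Lv y = Lv x" using Lv_invariantD[OF Lv_invariant_G_L[OF assms(1)] assms(2)] assms(3) by auto
  then show ?thesis using L_eq_Lv assms y by simp
qed

text \<open>The matrices produce homogeneous forms, while the listed parameters contain constants;
  eliminating \<open>e\<close> by the hyperplane equation makes both sides comparable.\<close>

lemma coset_reps_vector:
  assumes "e + f + g - a - b - c - d = (1 :: complex)"
  shows "map (\<lambda>\<alpha>. \<alpha> *v vector [a, b, c, d, e, f, g]) coset_reps =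
    [vector [a, b, c, d, e, f, g],
     vector [a, b, g - c, g - d, 1 + a + b - f, 1 + a + b - e, g],
     vector [1 + a - e, g - c, a, f - c, 1 + a - c, 1 + a + b - e, 1 + a + d - e],
     vector [1 + d - e, 1 + a - e, g - c, g - b, 1 + g - b - c, 1 + a + d - e, 1 + g - e],
     vector [g - a, g - b, g - c, g - d, 1 + g - f, 1 + g - e, g],
     vector [1 + c - e, 1 + d - e, 1 + a - e, 1 + b - e, 2 - e, 1 + g - e, 1 + f - e]]"
proof -
  have e: "e = 1 + a + b + c + d - f - g" using assms by (simp add: algebra_simps)
  show ?thesis
    unfolding coset_reps_def e
    by (simp add: numeral_eq_Suc GL7_simps vector_actions vector_7_eq_iff algebra_simps del: cycle_of_list.simps flip: matrix_vector_mul_assoc)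
qed

theorem theorem4p2:
  shows
    "Sigma_grp = {M \<in> G_L. \<exists>\<sigma>. bij \<sigma> \<and> M = perm_mat \<sigma>} \<and>
     (card (double_coset GL7 Sigma_grp ` G_L) = 6 \<and>
      set coset_reps \<subseteq> G_L \<and>
      double_coset GL7 Sigma_grp ` G_L = set (map (double_coset GL7 Sigma_grp) coset_reps) \<and>
      map (\<lambda>\<alpha>. card (double_coset GL7 Sigma_grp \<alpha>)) coset_reps =
        [1 * 48, 12 * 48, 12 * 48, 12 * 48, 2 * 48, 1 * 48]) \<and>
     (\<forall>a b c d e f g :: complex. e + f + g - a - b - c - d = 1 \<longrightarrow>
       (let x = vector [a, b, c, d, e, f, g] in
        list_all2
          (\<lambda>\<alpha> y. \<alpha> *v x = y \<and> (L_defined x \<and> L_defined y \<longrightarrow> L x = L y))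
          coset_reps
          [vector [a, b, c, d, e, f, g],
           vector [a, b, g - c, g - d, 1 + a + b - f, 1 + a + b - e, g],
           vector [1 + a - e, g - c, a, f - c, 1 + a - c, 1 + a + b - e, 1 + a + d - e],
           vector [1 + d - e, 1 + a - e, g - c, g - b, 1 + g - b - c, 1 + a + d - e, 1 + g - e],
           vector [g - a, g - b, g - c, g - d, 1 + g - f, 1 + g - e, g],
           vector [1 + c - e, 1 + d - e, 1 + a - e, 1 + b - e, 2 - e, 1 + g - e, 1 + f - e]]))"
proof (intro conjI allI impI)
  fix a b c d e f g :: complex
  assume bal: "e + f + g - a - b - c - d = 1"
  define x :: "complex ^ 7" where "x = vector [a, b, c, d, e, f, g]"
  have x: "x \<in> hyperplane" using bal by (simp add: x_def hyperplane_iff)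
  have "\<alpha> *v x = y \<longrightarrow> L_defined x \<and> L_defined y \<longrightarrow> L x = L y" if "\<alpha> \<in> set coset_reps" for \<alpha> y
    using that coset_reps_in_G_L L_invariant_G_L[OF _ x] by blast
  \<comment> \<open>The invariances are collected for the actual images of \<open>x\<close>; it
    remains to identify these images with the listed vectors.\<close>
  then have "list_all2 (\<lambda>\<alpha> y. \<alpha> *v x = y \<and> (L_defined x \<and> L_defined y \<longrightarrow> L x = L y)) coset_reps (map (\<lambda>\<alpha>. \<alpha> *v x) coset_reps)"
    unfolding list_all2_conv_all_nth by (auto dest: nth_mem)
  then show "let x = vector [a, b, c, d, e, f, g] in
        list_all2
          (\<lambda>\<alpha> y. \<alpha> *v x = y \<and> (L_defined x \<and> L_defined y \<longrightarrow> L x = L y))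
          coset_reps
          [vector [a, b, c, d, e, f, g],
           vector [a, b, g - c, g - d, 1 + a + b - f, 1 + a + b - e, g],
           vector [1 + a - e, g - c, a, f - c, 1 + a - c, 1 + a + b - e, 1 + a + d - e],
           vector [1 + d - e, 1 + a - e, g - c, g - b, 1 + g - b - c, 1 + a + d - e, 1 + g - e],
           vector [g - a, g - b, g - c, g - d, 1 + g - f, 1 + g - e, g],
           vector [1 + c - e, 1 + d - e, 1 + a - e, 1 + b - e, 2 - e, 1 + g - e, 1 + f - e]]"
    unfolding Let_def x_def coset_reps_vector[OF bal] .
qed (fact Sigma_grp_permutation_matrices double_coset_decomposition coset_reps_in_G_L)+

end
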